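(* Let $(\mathcal{V},\otimes,I,c)$ be a braided monoidal category, let $(\mathcal{A},\diamond,J)$ be a braided monoidal category (braiding also denoted $c$), and let $*\colon\mathcal{V}\times\mathcal{A}\to\mathcal{A}$ be an opmonoidal left action of $\mathcal{V}$ on $\mathcal{A}$ such that $(-*A)$ has a right adjoint for all $A\in\mathcal{A}$. Let $\underline{\mathcal{A}}$ be the associated monoidal $\mathcal{V}$-category. Then the opmonoidal action is braided if and only if the braiding of $\mathcal{A}$ is $\mathcal{V}$-natural. In this situation $\underline{\mathcal{A}}$ is braided.
   Context: A left action consists of a functor $*$ and coherent natural isomorphisms $\alpha_{XYA}\colon X*(Y*A)\to(X\otimes Y)*A$ and $\lambda_A\colon I*A\to A$. If each $(-*A)$ has a right adjoint $\underline{\mathcal{A}}(A,-)$, these are the hom-objects of a $\mathcal{V}$-category $\underline{\mathcal{A}}$ with underlying category $\mathcal{A}$, with composition and identities obtained by transposing the evident composites of $\alpha^{-1}$ and the counits $\epsilon\colon\underline{\mathcal{A}}(A,B)*A\to B$, and $\lambda_A$. The action is opmonoidal if the functor $*\colon\mathcal{V}\times\mathcal{A}\to\mathcal{A}$ is equipped with an opmonoidal (oplax monoidal) structure $\xi_0\colon I*J\to J$, $\xi_{XYAB}\colon(X\otimes Y)*(A\diamond B)\to(X*A)\diamond(Y*B)$ for which $\alpha$ and $\lambda$ are opmonoidal natural transformations (where $\otimes\colon\mathcal{V}\times\mathcal{V}\to\mathcal{V}$ is strong monoidal via $1\otimes c\otimes1$). In that case $\underline{\mathcal{A}}$ is a monoidal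 $\mathcal{V}$-category with underlying monoidal category $\mathcal{A}$; its tensor $\mathcal{V}$-functor is given on homs by the morphism $T_{ACBD}\colon\underline{\mathcal{A}}(A,B)\otimes\underline{\mathcal{A}}(C,D)\to\underline{\mathcal{A}}(A\diamond C,B\diamond D)$ transpose to $(\epsilon\diamond\epsilon)\cdot\xi$. The opmonoidal action is braided when the opmonoidal functor $*$ is braided, i.e. $c_{X*A,Y*B}\cdot\xi_{XYAB}=\xi_{YXBA}\cdot(c_{X,Y}*c_{A,B})$ for all $X,Y\in\mathcal{V}$, $A,B\in\mathcal{A}$. The braiding of $\mathcal{A}$ is $\mathcal{V}$-natural when, for all $A,B,C,D\in\mathcal{A}$, $$\underline{\mathcal{A}}(c_{A,C}^{-1},c_{B,D})\cdot T_{ACBD}=T_{CADB}\cdot c_{\underline{\mathcal{A}}(A,B),\underline{\mathcal{A}}(C,D)}.$$ The monoidal $\mathcal{V}$-category $\underline{\mathcal{A}}$ is braided (with the braiding of $\mathcal{A}$) when it is equipped with a $\mathcal{V}$-natural braiding on its underlying monoidal category. *)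

theory Defs
  imports Main
begin

section \<open>Categories, functors, adjunctions\<close>

record ('o, 'm) cat =
  Obj :: "'o set"
  Arr :: "'m set"
  Dom :: "'m \<Rightarrow> 'o"
  Cod :: "'m \<Rightarrow> 'o"
  Idn :: "'o \<Rightarrow> 'm"
  Cmp :: "'m \<Rightarrow> 'm \<Rightarrow> 'm" (infixr "\<cdot>\<index>" 55)

definition hom :: "('o, 'm, 'z) cat_scheme \<Rightarrow> 'o \<Rightarrow> 'o \<Rightarrow> 'm set" where
  "hom C a b = {f \<in> Arr C. Dom C f = a \<and> Cod C f = b}"

locale category =
  fixes C (structure)
  assumes arr_dom: "f \<in> Arr C \<Longrightarrow> Dom C f \<in> Obj C"
    and arr_cod: "f \<in> Arr C \<Longrightarrow> Cod C f \<in> Obj C"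
    and id_hom: "a \<in> Obj C \<Longrightarrow> Idn C a \<in> hom C a a"
    and comp_hom: "f \<in> hom C a b \<Longrightarrow> g \<in> hom C b c \<Longrightarrow> g \<cdot> f \<in> hom C a c"
    and comp_id_left: "f \<in> hom C a b \<Longrightarrow> Idn C b \<cdot> f = f"
    and comp_id_right: "f \<in> hom C a b \<Longrightarrow> f \<cdot> Idn C a = f"
    and comp_assoc: "f \<in> hom C a b \<Longrightarrow> g \<in> hom C b c \<Longrightarrow> h \<in> hom C c d \<Longrightarrow>
      (h \<cdot> g) \<cdot> f = h \<cdot> (g \<cdot> f)"

definition inverse_arrs :: "('o, 'm, 'z) cat_scheme \<Rightarrow> 'm \<Rightarrow> 'm \<Rightarrow> bool" where
  "inverse_arrs C f g \<longleftrightarrow> f \<in> Arr C \<and> g \<in> hom C (Cod C f) (Dom C f)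
     \<and> g \<cdot>\<^bsub>C\<^esub> f = Idn C (Dom C f) \<and> f \<cdot>\<^bsub>C\<^esub> g = Idn C (Cod C f)"

definition iso :: "('o, 'm, 'z) cat_scheme \<Rightarrow> 'm \<Rightarrow> bool" where
  "iso C f \<longleftrightarrow> (\<exists>g. inverse_arrs C f g)"

definition inv_arr :: "('o, 'm, 'z) cat_scheme \<Rightarrow> 'm \<Rightarrow> 'm" where
  "inv_arr C f = (THE g. inverse_arrs C f g)"

record ('o, 'm, 'p, 'n) cat_fun =
  FObj :: "'o \<Rightarrow> 'p"
  FArr :: "'m \<Rightarrow> 'n"

locale cat_functor = C: category C + D: category D for C and D +
  fixes F
  assumes obj: "a \<in> Obj C \<Longrightarrow> FObj F a \<in> Obj D"
    and arr: "f \<in> hom C a b \<Longrightarrow> FArr F f \<in> hom D (FObj F a) (FObj F b)"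
    and pres_id: "a \<in> Obj C \<Longrightarrow> FArr F (Idn C a) = Idn D (FObj F a)"
    and pres_comp: "f \<in> hom C a b \<Longrightarrow> g \<in> hom C b c \<Longrightarrow>
      FArr F (g \<cdot>\<^bsub>C\<^esub> f) = FArr F g \<cdot>\<^bsub>D\<^esub> FArr F f"

definition comp_fun where
  "comp_fun G F = \<lparr>FObj = FObj G \<circ> FObj F, FArr = FArr G \<circ> FArr F\<rparr>"

definition id_fun :: "('o, 'm, 'o, 'm) cat_fun" where
  "id_fun = \<lparr>FObj = id, FArr = id\<rparr>"

locale natural_transformation = F: cat_functor C D F + G: cat_functor C D G for C D F G +
  fixes \<theta>
  assumes component: "a \<in> Obj C \<Longrightarrow> \<theta> a \<in> hom D (FObj F a) (FObj G a)"
    and naturality: "f \<in> hom C a b \<Longrightarrow> \<theta> b \<cdot>\<^bsub>D\<^esub> FArr F f = FArr G f \<cdot>\<^bsub>D\<^esub> \<theta> a"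

locale natural_isomorphism = natural_transformation +
  assumes component_iso: "a \<in> Obj C \<Longrightarrow> iso D (\<theta> a)"

text \<open>A right adjoint of a functor from \<open>C\<close> (objects \<open>'o\<close>) to \<open>D\<close> (objects \<open>'p\<close>),
  together with unit and counit.\<close>

record ('p, 'n, 'o, 'm) radj = "('p, 'n, 'o, 'm) cat_fun" +
  AUnit :: "'o \<Rightarrow> 'm"
  ACounit :: "'p \<Rightarrow> 'n"

locale adjunction = F: cat_functor C D F + G: cat_functor D C G
    + unit: natural_transformation C C id_fun "comp_fun G F" "AUnit G"
    + counit: natural_transformation D D "comp_fun F G" id_fun "ACounit G"
    for C D F G +
  assumes triangle_left:
      "a \<in> Obj C \<Longrightarrow> ACounit G (FObj F a) \<cdot>\<^bsub>D\<^esub> FArr F (AUnit G a) = Idn D (FObj F a)"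
    and triangle_right:
      "b \<in> Obj D \<Longrightarrow> FArr G (ACounit G b) \<cdot>\<^bsub>C\<^esub> AUnit G (FObj G b) = Idn C (FObj G b)"


section \<open>Monoidal and braided monoidal categories\<close>

record ('o, 'm) moncat = "('o, 'm) cat" +
  TObj :: "'o \<Rightarrow> 'o \<Rightarrow> 'o" (infixr "\<odot>\<index>" 70)
  TArr :: "'m \<Rightarrow> 'm \<Rightarrow> 'm" (infixr "\<otimes>\<index>" 70)
  Uni :: "'o"
  Asc :: "'o \<Rightarrow> 'o \<Rightarrow> 'o \<Rightarrow> 'm"
  LUn :: "'o \<Rightarrow> 'm"
  RUn :: "'o \<Rightarrow> 'm"

locale monoidal_category = category C for C (structure) +
  assumes tensor_obj: "a \<in> Obj C \<Longrightarrow> b \<in> Obj C \<Longrightarrow> a \<odot> b \<in> Obj C"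
    and tensor_hom: "f \<in> hom C a b \<Longrightarrow> g \<in> hom C a' b' \<Longrightarrow> f \<otimes> g \<in> hom C (a \<odot> a') (b \<odot> b')"
    and tensor_id: "a \<in> Obj C \<Longrightarrow> b \<in> Obj C \<Longrightarrow> Idn C a \<otimes> Idn C b = Idn C (a \<odot> b)"
    and tensor_comp: "f \<in> hom C a b \<Longrightarrow> g \<in> hom C b c \<Longrightarrow> f' \<in> hom C a' b' \<Longrightarrow> g' \<in> hom C b' c' \<Longrightarrow>
      (g \<cdot> f) \<otimes> (g' \<cdot> f') = (g \<otimes> g') \<cdot> (f \<otimes> f')"
    and unit_obj: "Uni C \<in> Obj C"
    and asc_hom: "a \<in> Obj C \<Longrightarrow> b \<in> Obj C \<Longrightarrow> c \<in> Obj C \<Longrightarrow>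
      Asc C a b c \<in> hom C ((a \<odot> b) \<odot> c) (a \<odot> (b \<odot> c))"
    and asc_iso: "a \<in> Obj C \<Longrightarrow> b \<in> Obj C \<Longrightarrow> c \<in> Obj C \<Longrightarrow> iso C (Asc C a b c)"
    and asc_nat: "f \<in> hom C a a' \<Longrightarrow> g \<in> hom C b b' \<Longrightarrow> h \<in> hom C c c' \<Longrightarrow>
      Asc C a' b' c' \<cdot> ((f \<otimes> g) \<otimes> h) = (f \<otimes> (g \<otimes> h)) \<cdot> Asc C a b c"
    and lun_hom: "a \<in> Obj C \<Longrightarrow> LUn C a \<in> hom C (Uni C \<odot> a) a"
    and lun_iso: "a \<in> Obj C \<Longrightarrow> iso C (LUn C a)"
    and lun_nat: "f \<in> hom C a b \<Longrightarrow> LUn C b \<cdot> (Idn C (Uni C) \<otimes> f) = f \<cdot> LUn C a"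
    and run_hom: "a \<in> Obj C \<Longrightarrow> RUn C a \<in> hom C (a \<odot> Uni C) a"
    and run_iso: "a \<in> Obj C \<Longrightarrow> iso C (RUn C a)"
    and run_nat: "f \<in> hom C a b \<Longrightarrow> RUn C b \<cdot> (f \<otimes> Idn C (Uni C)) = f \<cdot> RUn C a"
    and pentagon: "a \<in> Obj C \<Longrightarrow> b \<in> Obj C \<Longrightarrow> c \<in> Obj C \<Longrightarrow> d \<in> Obj C \<Longrightarrow>
      Asc C a b (c \<odot> d) \<cdot> Asc C (a \<odot> b) c d
        = (Idn C a \<otimes> Asc C b c d) \<cdot> Asc C a (b \<odot> c) d \<cdot> (Asc C a b c \<otimes> Idn C d)"
    and triangle: "a \<in> Obj C \<Longrightarrow> b \<in> Obj C \<Longrightarrow>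
      (Idn C a \<otimes> LUn C b) \<cdot> Asc C a (Uni C) b = RUn C a \<otimes> Idn C b"

record ('o, 'm) brcat = "('o, 'm) moncat" +
  Brd :: "'o \<Rightarrow> 'o \<Rightarrow> 'm"

locale braided_monoidal_category = monoidal_category C for C (structure) +
  assumes brd_hom: "a \<in> Obj C \<Longrightarrow> b \<in> Obj C \<Longrightarrow> Brd C a b \<in> hom C (a \<odot> b) (b \<odot> a)"
    and brd_iso: "a \<in> Obj C \<Longrightarrow> b \<in> Obj C \<Longrightarrow> iso C (Brd C a b)"
    and brd_nat: "f \<in> hom C a a' \<Longrightarrow> g \<in> hom C b b' \<Longrightarrow>
      Brd C a' b' \<cdot> (f \<otimes> g) = (g \<otimes> f) \<cdot> Brd C a b"
    and hexagon1: "a \<in> Obj C \<Longrightarrow> b \<in> Obj C \<Longrightarrow> c \<in> Obj C \<Longrightarrow>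
      Asc C b c a \<cdot> Brd C a (b \<odot> c) \<cdot> Asc C a b c
        = (Idn C b \<otimes> Brd C a c) \<cdot> Asc C b a c \<cdot> (Brd C a b \<otimes> Idn C c)"
    and hexagon2: "a \<in> Obj C \<Longrightarrow> b \<in> Obj C \<Longrightarrow> c \<in> Obj C \<Longrightarrow>
      inv_arr C (Asc C c a b) \<cdot> Brd C (a \<odot> b) c \<cdot> inv_arr C (Asc C a b c)
        = (Brd C a c \<otimes> Idn C b) \<cdot> inv_arr C (Asc C a c b) \<cdot> (Idn C a \<otimes> Brd C b c)"

text \<open>The middle-four interchange \<open>1 \<otimes> c\<^bsub>b,c\<^esub> \<otimes> 1\<close> from \<open>(a \<otimes> b) \<otimes> (c \<otimes> d)\<close> to \<open>(a \<otimes> c) \<otimes> (b \<otimes> d)\<close>,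
  with the associativity constraints made explicit.\<close>

definition interchange :: "('o, 'm, 'z) brcat_scheme \<Rightarrow> 'o \<Rightarrow> 'o \<Rightarrow> 'o \<Rightarrow> 'o \<Rightarrow> 'm" where
  "interchange C a b c d =
     inv_arr C (Asc C a c (b \<odot>\<^bsub>C\<^esub> d))
     \<cdot>\<^bsub>C\<^esub> (Idn C a \<otimes>\<^bsub>C\<^esub> (Asc C c b d \<cdot>\<^bsub>C\<^esub> (Brd C b c \<otimes>\<^bsub>C\<^esub> Idn C d) \<cdot>\<^bsub>C\<^esub> inv_arr C (Asc C b c d)))
     \<cdot>\<^bsub>C\<^esub> Asc C a b (c \<odot>\<^bsub>C\<^esub> d)"

definition prod_mon ::
  "('o, 'm, 'y) moncat_scheme \<Rightarrow> ('p, 'n, 'z) moncat_scheme \<Rightarrow> ('o \<times> 'p, 'm \<times> 'n) moncat" where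
  "prod_mon C D =
    \<lparr>Obj = Obj C \<times> Obj D, Arr = Arr C \<times> Arr D,
     Dom = map_prod (Dom C) (Dom D), Cod = map_prod (Cod C) (Cod D),
     Idn = map_prod (Idn C) (Idn D),
     Cmp = (\<lambda>(g, g') (f, f'). (g \<cdot>\<^bsub>C\<^esub> f, g' \<cdot>\<^bsub>D\<^esub> f')),
     TObj = (\<lambda>(a, a') (b, b'). (a \<odot>\<^bsub>C\<^esub> b, a' \<odot>\<^bsub>D\<^esub> b')),
     TArr = (\<lambda>(f, f') (g, g'). (f \<otimes>\<^bsub>C\<^esub> g, f' \<otimes>\<^bsub>D\<^esub> g')),
     Uni = (Uni C, Uni D),
     Asc = (\<lambda>(a, a') (b, b') (c, c'). (Asc C a b c, Asc D a' b' c')),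
     LUn = map_prod (LUn C) (LUn D), RUn = map_prod (RUn C) (RUn D)\<rparr>"

definition prod_br ::
  "('o, 'm, 'y) brcat_scheme \<Rightarrow> ('p, 'n, 'z) brcat_scheme \<Rightarrow> ('o \<times> 'p, 'm \<times> 'n) brcat" where
  "prod_br C D = moncat.extend (prod_mon C D)
     (brcat.fields (\<lambda>(a, a') (b, b'). (Brd C a b, Brd D a' b')))"


section \<open>Opmonoidal functors and transformations\<close>

record ('o, 'm, 'p, 'n) opmon_fun = "('o, 'm, 'p, 'n) cat_fun" +
  FUni :: "'n"
  FTen :: "'o \<Rightarrow> 'o \<Rightarrow> 'n"

locale opmonoidal_functor = C: monoidal_category C + D: monoidal_category D + cat_functor C D F
    for C D F +
  assumes funi_hom: "FUni F \<in> hom D (FObj F (Uni C)) (Uni D)"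
    and ften_hom: "a \<in> Obj C \<Longrightarrow> b \<in> Obj C \<Longrightarrow>
      FTen F a b \<in> hom D (FObj F (a \<odot>\<^bsub>C\<^esub> b)) (FObj F a \<odot>\<^bsub>D\<^esub> FObj F b)"
    and ften_nat: "f \<in> hom C a a' \<Longrightarrow> g \<in> hom C b b' \<Longrightarrow>
      FTen F a' b' \<cdot>\<^bsub>D\<^esub> FArr F (f \<otimes>\<^bsub>C\<^esub> g) = (FArr F f \<otimes>\<^bsub>D\<^esub> FArr F g) \<cdot>\<^bsub>D\<^esub> FTen F a b"
    and ften_assoc: "a \<in> Obj C \<Longrightarrow> b \<in> Obj C \<Longrightarrow> c \<in> Obj C \<Longrightarrow>
      Asc D (FObj F a) (FObj F b) (FObj F c)
          \<cdot>\<^bsub>D\<^esub> (FTen F a b \<otimes>\<^bsub>D\<^esub> Idn D (FObj F c)) \<cdot>\<^bsub>D\<^esub> FTen F (a \<odot>\<^bsub>C\<^esub> b) c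
        = (Idn D (FObj F a) \<otimes>\<^bsub>D\<^esub> FTen F b c) \<cdot>\<^bsub>D\<^esub> FTen F a (b \<odot>\<^bsub>C\<^esub> c) \<cdot>\<^bsub>D\<^esub> FArr F (Asc C a b c)"
    and ften_lunit: "a \<in> Obj C \<Longrightarrow>
      LUn D (FObj F a) \<cdot>\<^bsub>D\<^esub> (FUni F \<otimes>\<^bsub>D\<^esub> Idn D (FObj F a)) \<cdot>\<^bsub>D\<^esub> FTen F (Uni C) a = FArr F (LUn C a)"
    and ften_runit: "a \<in> Obj C \<Longrightarrow>
      RUn D (FObj F a) \<cdot>\<^bsub>D\<^esub> (Idn D (FObj F a) \<otimes>\<^bsub>D\<^esub> FUni F) \<cdot>\<^bsub>D\<^esub> FTen F a (Uni C) = FArr F (RUn C a)"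

locale opmonoidal_transformation = F: opmonoidal_functor C D F + G: opmonoidal_functor C D G
    + natural_transformation C D F G \<theta> for C D F G \<theta> +
  assumes opmon_tensor: "a \<in> Obj C \<Longrightarrow> b \<in> Obj C \<Longrightarrow>
      (\<theta> a \<otimes>\<^bsub>D\<^esub> \<theta> b) \<cdot>\<^bsub>D\<^esub> FTen F a b = FTen G a b \<cdot>\<^bsub>D\<^esub> \<theta> (a \<odot>\<^bsub>C\<^esub> b)"
    and opmon_unit: "FUni F = FUni G \<cdot>\<^bsub>D\<^esub> \<theta> (Uni C)"

locale braided_opmonoidal_functor = C: braided_monoidal_category C + D: braided_monoidal_category D
    + opmonoidal_functor C D F for C D F +
  assumes ften_braid: "a \<in> Obj C \<Longrightarrow> b \<in> Obj C \<Longrightarrow>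
      Brd D (FObj F a) (FObj F b) \<cdot>\<^bsub>D\<^esub> FTen F a b = FTen F b a \<cdot>\<^bsub>D\<^esub> FArr F (Brd C a b)"

definition opmon_id :: "('o, 'm, 'z) moncat_scheme \<Rightarrow> ('o, 'm, 'o, 'm) opmon_fun" where
  "opmon_id C = \<lparr>FObj = id, FArr = id, FUni = Idn C (Uni C), FTen = (\<lambda>a b. Idn C (a \<odot>\<^bsub>C\<^esub> b))\<rparr>"

text \<open>The composite \<open>G \<circ> F\<close>, where \<open>E\<close> is the codomain of \<open>G\<close>.\<close>

definition opmon_comp :: "('r, 's, 'z) moncat_scheme \<Rightarrow> ('p, 'n, 'r, 's, 'x) opmon_fun_scheme
    \<Rightarrow> ('o, 'm, 'p, 'n, 'y) opmon_fun_scheme \<Rightarrow> ('o, 'm, 'r, 's) opmon_fun" where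
  "opmon_comp E G F =
    \<lparr>FObj = FObj G \<circ> FObj F, FArr = FArr G \<circ> FArr F,
     FUni = FUni G \<cdot>\<^bsub>E\<^esub> FArr G (FUni F),
     FTen = (\<lambda>a b. FTen G (FObj F a) (FObj F b) \<cdot>\<^bsub>E\<^esub> FArr G (FTen F a b))\<rparr>"

definition opmon_prod :: "('o, 'm, 'p, 'n, 'x) opmon_fun_scheme \<Rightarrow> ('q, 'k, 'r, 's, 'y) opmon_fun_scheme
    \<Rightarrow> ('o \<times> 'q, 'm \<times> 'k, 'p \<times> 'r, 'n \<times> 's) opmon_fun" where
  "opmon_prod F G =
    \<lparr>FObj = map_prod (FObj F) (FObj G), FArr = map_prod (FArr F) (FArr G),
     FUni = (FUni F, FUni G),
     FTen = (\<lambda>(a, a') (b, b'). (FTen F a b, FTen G a' b'))\<rparr>"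

text \<open>The strict isomorphism from \<open>C \<times> (D \<times> E)\<close> to \<open>(C \<times> D) \<times> E\<close>.\<close>

definition opmon_reassoc :: "('o, 'm, 'x) moncat_scheme \<Rightarrow> ('p, 'n, 'y) moncat_scheme
    \<Rightarrow> ('q, 'k, 'z) moncat_scheme
    \<Rightarrow> ('o \<times> 'p \<times> 'q, 'm \<times> 'n \<times> 'k, ('o \<times> 'p) \<times> 'q, ('m \<times> 'n) \<times> 'k) opmon_fun" where
  "opmon_reassoc C D E =
    \<lparr>FObj = (\<lambda>(a, b, c). ((a, b), c)), FArr = (\<lambda>(f, g, h). ((f, g), h)),
     FUni = ((Idn C (Uni C), Idn D (Uni D)), Idn E (Uni E)),
     FTen = (\<lambda>(a, b, c) (a', b', c').
       ((Idn C (a \<odot>\<^bsub>C\<^esub> a'), Idn D (b \<odot>\<^bsub>D\<^esub> b')), Idn E (c \<odot>\<^bsub>E\<^esub> c')))\<rparr>"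

text \<open>The tensor functor from \<open>V \<times> V\<close> to \<open>V\<close>; its strong monoidal structure is given in the
  opmonoidal direction, from \<open>(x \<otimes> x') \<otimes> (y \<otimes> y')\<close> to \<open>(x \<otimes> y) \<otimes> (x' \<otimes> y')\<close>.\<close>

definition opmon_tensor :: "('o, 'm, 'z) brcat_scheme \<Rightarrow> ('o \<times> 'o, 'm \<times> 'm, 'o, 'm) opmon_fun" where
  "opmon_tensor V =
    \<lparr>FObj = (\<lambda>(x, y). x \<odot>\<^bsub>V\<^esub> y), FArr = (\<lambda>(f, g). f \<otimes>\<^bsub>V\<^esub> g),
     FUni = LUn V (Uni V),
     FTen = (\<lambda>(x, y) (x', y'). interchange V x x' y y')\<rparr>"

text \<open>The functor \<open>a \<mapsto> (I, a)\<close> from \<open>A\<close> to \<open>V \<times> A\<close>.\<close>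

definition opmon_unit :: "('o, 'm, 'y) moncat_scheme \<Rightarrow> ('p, 'n, 'z) moncat_scheme
    \<Rightarrow> ('p, 'n, 'o \<times> 'p, 'm \<times> 'n) opmon_fun" where
  "opmon_unit V A =
    \<lparr>FObj = (\<lambda>a. (Uni V, a)), FArr = (\<lambda>f. (Idn V (Uni V), f)),
     FUni = (Idn V (Uni V), Idn A (Uni A)),
     FTen = (\<lambda>a b. (inv_arr V (LUn V (Uni V)), Idn A (a \<odot>\<^bsub>A\<^esub> b)))\<rparr>"


section \<open>Opmonoidal actions\<close>

text \<open>An action functor together with its constraints \<open>\<alpha>\<close> and \<open>\<lambda>\<close> and its opmonoidal structure
  \<open>\<xi>\<^sub>0\<close> (field \<open>FUni\<close>) and \<open>\<xi>\<^bsub>XYAB\<^esub>\<close> (field \<open>FTen\<close> at \<open>(X, A)\<close> and \<open>(Y, B)\<close>).\<close>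

record ('o, 'm, 'p, 'n) action = "('o \<times> 'p, 'm \<times> 'n, 'p, 'n) opmon_fun" +
  ActAsc :: "'o \<times> 'o \<times> 'p \<Rightarrow> 'n"
  ActUni :: "'p \<Rightarrow> 'n"

definition act_twice :: "('o, 'm, 'y) moncat_scheme \<Rightarrow> ('p, 'n, 'z) moncat_scheme
    \<Rightarrow> ('o, 'm, 'p, 'n, 'x) action_scheme \<Rightarrow> ('o \<times> 'o \<times> 'p, 'm \<times> 'm \<times> 'n, 'p, 'n) opmon_fun" where
  "act_twice V A S = opmon_comp A S (opmon_prod (opmon_id V) S)"

definition act_tensor :: "('o, 'm, 'y) brcat_scheme \<Rightarrow> ('p, 'n, 'z) moncat_scheme
    \<Rightarrow> ('o, 'm, 'p, 'n, 'x) action_scheme \<Rightarrow> ('o \<times> 'o \<times> 'p, 'm \<times> 'm \<times> 'n, 'p, 'n) opmon_fun" where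
  "act_tensor V A S = opmon_comp A S
     (opmon_comp (prod_mon V A) (opmon_prod (opmon_tensor V) (opmon_id A)) (opmon_reassoc V V A))"

definition act_unit :: "('o, 'm, 'y) moncat_scheme \<Rightarrow> ('p, 'n, 'z) moncat_scheme
    \<Rightarrow> ('o, 'm, 'p, 'n, 'x) action_scheme \<Rightarrow> ('p, 'n, 'p, 'n) opmon_fun" where
  "act_unit V A S = opmon_comp A S (opmon_unit V A)"

text \<open>Only the opmonoidal part of \<open>act_tensor\<close> involves the braiding of \<open>V\<close>; the naturality
  and coherence conditions below see just the underlying functors.\<close>

locale left_action = V: braided_monoidal_category V + A: monoidal_category A
    + func: cat_functor "prod_mon V A" A S
    + assoc: natural_isomorphism "prod_mon V (prod_mon V A)" A
        "act_twice V A S" "act_tensor V A S" "ActAsc S"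
    + unit: natural_isomorphism A A "act_unit V A S" "opmon_id A" "ActUni S"
    for V A S +
  assumes act_pentagon: "x \<in> Obj V \<Longrightarrow> y \<in> Obj V \<Longrightarrow> z \<in> Obj V \<Longrightarrow> a \<in> Obj A \<Longrightarrow>
      FArr S (Asc V x y z, Idn A a) \<cdot>\<^bsub>A\<^esub> ActAsc S (x \<odot>\<^bsub>V\<^esub> y, z, a) \<cdot>\<^bsub>A\<^esub> ActAsc S (x, y, FObj S (z, a))
        = ActAsc S (x, y \<odot>\<^bsub>V\<^esub> z, a) \<cdot>\<^bsub>A\<^esub> FArr S (Idn V x, ActAsc S (y, z, a))"
    and act_lunit: "x \<in> Obj V \<Longrightarrow> a \<in> Obj A \<Longrightarrow>
      FArr S (LUn V x, Idn A a) \<cdot>\<^bsub>A\<^esub> ActAsc S (Uni V, x, a) = ActUni S (FObj S (x, a))"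
    and act_runit: "x \<in> Obj V \<Longrightarrow> a \<in> Obj A \<Longrightarrow>
      FArr S (RUn V x, Idn A a) \<cdot>\<^bsub>A\<^esub> ActAsc S (x, Uni V, a) = FArr S (Idn V x, ActUni S a)"

locale opmonoidal_action = left_action V A S + opmonoidal_functor "prod_mon V A" A S
    + assoc_opmon: opmonoidal_transformation "prod_mon V (prod_mon V A)" A
        "act_twice V A S" "act_tensor V A S" "ActAsc S"
    + unit_opmon: opmonoidal_transformation A A "act_unit V A S" "opmon_id A" "ActUni S"
    for V A S

definition braided_action :: "('o, 'm, 'x) brcat_scheme \<Rightarrow> ('p, 'n, 'y) brcat_scheme
    \<Rightarrow> ('o, 'm, 'p, 'n, 'z) action_scheme \<Rightarrow> bool" where
  "braided_action V A S \<longleftrightarrow>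
     opmonoidal_action V A S \<and> braided_opmonoidal_functor (prod_br V A) A S"

text \<open>The functor \<open>-*a\<close> from \<open>V\<close> to \<open>A\<close>.\<close>

definition act_on :: "('p, 'n, 'z) cat_scheme \<Rightarrow> ('o, 'm, 'p, 'n, 'x) action_scheme
    \<Rightarrow> 'p \<Rightarrow> ('o, 'm, 'p, 'n) cat_fun" where
  "act_on A S a = \<lparr>FObj = (\<lambda>x. FObj S (x, a)), FArr = (\<lambda>f. FArr S (f, Idn A a))\<rparr>"


section \<open>Enriched categories\<close>

text \<open>\<open>ECmp E a b c\<close> is the composition morphism from \<open>E(b,c) \<otimes> E(a,b)\<close> to \<open>E(a,c)\<close>.\<close>

record ('a, 'o, 'm) vcat =
  EObj :: "'a set"
  EHom :: "'a \<Rightarrow> 'a \<Rightarrow> 'o"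
  ECmp :: "'a \<Rightarrow> 'a \<Rightarrow> 'a \<Rightarrow> 'm"
  EIdn :: "'a \<Rightarrow> 'm"

locale vcategory = V: monoidal_category V for V +
  fixes E
  assumes ehom_obj: "a \<in> EObj E \<Longrightarrow> b \<in> EObj E \<Longrightarrow> EHom E a b \<in> Obj V"
    and ecmp_hom: "a \<in> EObj E \<Longrightarrow> b \<in> EObj E \<Longrightarrow> c \<in> EObj E \<Longrightarrow>
      ECmp E a b c \<in> hom V (EHom E b c \<odot>\<^bsub>V\<^esub> EHom E a b) (EHom E a c)"
    and eidn_hom: "a \<in> EObj E \<Longrightarrow> EIdn E a \<in> hom V (Uni V) (EHom E a a)"
    and ecmp_assoc: "a \<in> EObj E \<Longrightarrow> b \<in> EObj E \<Longrightarrow> c \<in> EObj E \<Longrightarrow> d \<in> EObj E \<Longrightarrow>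
      ECmp E a b d \<cdot>\<^bsub>V\<^esub> (ECmp E b c d \<otimes>\<^bsub>V\<^esub> Idn V (EHom E a b))
        = ECmp E a c d \<cdot>\<^bsub>V\<^esub> (Idn V (EHom E c d) \<otimes>\<^bsub>V\<^esub> ECmp E a b c)
          \<cdot>\<^bsub>V\<^esub> Asc V (EHom E c d) (EHom E b c) (EHom E a b)"
    and ecmp_lunit: "a \<in> EObj E \<Longrightarrow> b \<in> EObj E \<Longrightarrow>
      ECmp E a b b \<cdot>\<^bsub>V\<^esub> (EIdn E b \<otimes>\<^bsub>V\<^esub> Idn V (EHom E a b)) = LUn V (EHom E a b)"
    and ecmp_runit: "a \<in> EObj E \<Longrightarrow> b \<in> EObj E \<Longrightarrow>
      ECmp E a a b \<cdot>\<^bsub>V\<^esub> (Idn V (EHom E a b) \<otimes>\<^bsub>V\<^esub> EIdn E a) = RUn V (EHom E a b)"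

locale vfunctor = V: monoidal_category V + E: vcategory V E + E': vcategory V E' for V E E' +
  fixes FO and FH
  assumes vobj: "a \<in> EObj E \<Longrightarrow> FO a \<in> EObj E'"
    and vmap_hom: "a \<in> EObj E \<Longrightarrow> b \<in> EObj E \<Longrightarrow> FH a b \<in> hom V (EHom E a b) (EHom E' (FO a) (FO b))"
    and vmap_comp: "a \<in> EObj E \<Longrightarrow> b \<in> EObj E \<Longrightarrow> c \<in> EObj E \<Longrightarrow>
      FH a c \<cdot>\<^bsub>V\<^esub> ECmp E a b c = ECmp E' (FO a) (FO b) (FO c) \<cdot>\<^bsub>V\<^esub> (FH b c \<otimes>\<^bsub>V\<^esub> FH a b)"
    and vmap_id: "a \<in> EObj E \<Longrightarrow> FH a a \<cdot>\<^bsub>V\<^esub> EIdn E a = EIdn E' (FO a)"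

text \<open>The tensor product of \<open>V\<close>-categories, for braided \<open>V\<close>.\<close>

definition vcat_tensor :: "('o, 'm, 'z) brcat_scheme \<Rightarrow> ('a, 'o, 'm, 'x) vcat_scheme
    \<Rightarrow> ('b, 'o, 'm, 'y) vcat_scheme \<Rightarrow> ('a \<times> 'b, 'o, 'm) vcat" where
  "vcat_tensor V E E' =
    \<lparr>EObj = EObj E \<times> EObj E',
     EHom = (\<lambda>(a, a') (b, b'). EHom E a b \<odot>\<^bsub>V\<^esub> EHom E' a' b'),
     ECmp = (\<lambda>(a, a') (b, b') (c, c').
       (ECmp E a b c \<otimes>\<^bsub>V\<^esub> ECmp E' a' b' c')
       \<cdot>\<^bsub>V\<^esub> interchange V (EHom E b c) (EHom E' b' c') (EHom E a b) (EHom E' a' b')),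
     EIdn = (\<lambda>(a, a'). (EIdn E a \<otimes>\<^bsub>V\<^esub> EIdn E' a') \<cdot>\<^bsub>V\<^esub> inv_arr V (LUn V (Uni V)))\<rparr>"

text \<open>\<open>ETen E a c b d\<close> is the effect on homs of the tensor \<open>V\<close>-functor, from
  \<open>E(a,b) \<otimes> E(c,d)\<close> to \<open>E(a\<diamond>c, b\<diamond>d)\<close>. The constraints \<open>EAsc\<close>, \<open>ELUn\<close>, \<open>ERUn\<close>
  (and \<open>EBrd\<close> below) are morphisms of \<open>V\<close> from the unit object to hom-objects.\<close>

record ('a, 'o, 'm) vmoncat = "('a, 'o, 'm) vcat" +
  ETObj :: "'a \<Rightarrow> 'a \<Rightarrow> 'a"
  ETen :: "'a \<Rightarrow> 'a \<Rightarrow> 'a \<Rightarrow> 'a \<Rightarrow> 'm"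
  EUni :: "'a"
  EAsc :: "'a \<Rightarrow> 'a \<Rightarrow> 'a \<Rightarrow> 'm"
  ELUn :: "'a \<Rightarrow> 'm"
  ERUn :: "'a \<Rightarrow> 'm"

record ('a, 'o, 'm) vbrcat = "('a, 'o, 'm) vmoncat" +
  EBrd :: "'a \<Rightarrow> 'a \<Rightarrow> 'm"

text \<open>The underlying category of \<open>E\<close> has as arrows from \<open>a\<close> to \<open>b\<close> the morphisms
  \<open>I \<rightarrow> E(a,b)\<close> of \<open>V\<close>, tagged with \<open>a\<close> and \<open>b\<close>.\<close>

definition underlying :: "('o, 'm, 'z) moncat_scheme \<Rightarrow> ('a, 'o, 'm, 'x) vmoncat_scheme
    \<Rightarrow> ('a, 'a \<times> 'a \<times> 'm) moncat" where
  "underlying V E =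
    \<lparr>Obj = EObj E,
     Arr = {(a, b, f). a \<in> EObj E \<and> b \<in> EObj E \<and> f \<in> hom V (Uni V) (EHom E a b)},
     Dom = (\<lambda>(a, b, f). a), Cod = (\<lambda>(a, b, f). b),
     Idn = (\<lambda>a. (a, a, EIdn E a)),
     Cmp = (\<lambda>(b, c, g) (a, b', f).
       (a, c, ECmp E a b c \<cdot>\<^bsub>V\<^esub> (g \<otimes>\<^bsub>V\<^esub> f) \<cdot>\<^bsub>V\<^esub> inv_arr V (LUn V (Uni V)))),
     TObj = ETObj E,
     TArr = (\<lambda>(a, b, f) (c, d, g).
       (ETObj E a c, ETObj E b d, ETen E a c b d \<cdot>\<^bsub>V\<^esub> (f \<otimes>\<^bsub>V\<^esub> g) \<cdot>\<^bsub>V\<^esub> inv_arr V (LUn V (Uni V)))),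
     Uni = EUni E,
     Asc = (\<lambda>a b c. (ETObj E (ETObj E a b) c, ETObj E a (ETObj E b c), EAsc E a b c)),
     LUn = (\<lambda>a. (ETObj E (EUni E) a, a, ELUn E a)),
     RUn = (\<lambda>a. (ETObj E a (EUni E), a, ERUn E a))\<rparr>"

definition underlying_br :: "('o, 'm, 'z) moncat_scheme \<Rightarrow> ('a, 'o, 'm, 'x) vbrcat_scheme
    \<Rightarrow> ('a, 'a \<times> 'a \<times> 'm) brcat" where
  "underlying_br V E = moncat.extend (underlying V E)
     (brcat.fields (\<lambda>a b. (ETObj E a b, ETObj E b a, EBrd E a b)))"

text \<open>For arrows \<open>f : a' \<rightarrow> a\<close> and \<open>g : b \<rightarrow> b'\<close> of the underlying category, \<open>ehom_arr V E f g\<close> is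
  the morphism \<open>E(f,g) : E(a,b) \<rightarrow> E(a',b')\<close>, that is, \<open>E(1,g)\<close> after \<open>E(f,1)\<close>.\<close>

definition ehom_arr :: "('o, 'm, 'z) moncat_scheme \<Rightarrow> ('a, 'o, 'm, 'x) vcat_scheme
    \<Rightarrow> 'a \<times> 'a \<times> 'm \<Rightarrow> 'a \<times> 'a \<times> 'm \<Rightarrow> 'm" where
  "ehom_arr V E = (\<lambda>(a', a, f) (b, b', g).
     (ECmp E a' b b' \<cdot>\<^bsub>V\<^esub> (g \<otimes>\<^bsub>V\<^esub> Idn V (EHom E a' b)) \<cdot>\<^bsub>V\<^esub> inv_arr V (LUn V (EHom E a' b)))
     \<cdot>\<^bsub>V\<^esub> (ECmp E a' a b \<cdot>\<^bsub>V\<^esub> (Idn V (EHom E a b) \<otimes>\<^bsub>V\<^esub> f) \<cdot>\<^bsub>V\<^esub> inv_arr V (RUn V (EHom E a b))))"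

text \<open>A monoidal \<open>V\<close>-category: the last three axioms say that the associativity and unit constraints,
  which are invertible and coherent in the underlying category, are \<open>V\<close>-natural.\<close>

locale monoidal_vcategory = V: braided_monoidal_category V + E: vcategory V E
    + tensor: vfunctor V "vcat_tensor V E E" E
        "\<lambda>(a, b). ETObj E a b" "\<lambda>(a, c) (b, d). ETen E a c b d"
    + underlying: monoidal_category "underlying V E"
    for V E +
  assumes asc_vnat: "a \<in> EObj E \<Longrightarrow> b \<in> EObj E \<Longrightarrow> c \<in> EObj E \<Longrightarrow>
      a' \<in> EObj E \<Longrightarrow> b' \<in> EObj E \<Longrightarrow> c' \<in> EObj E \<Longrightarrow>
      ehom_arr V E (Idn (underlying V E) (ETObj E (ETObj E a b) c)) (Asc (underlying V E) a' b' c')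
        \<cdot>\<^bsub>V\<^esub> ETen E (ETObj E a b) c (ETObj E a' b') c'
        \<cdot>\<^bsub>V\<^esub> (ETen E a b a' b' \<otimes>\<^bsub>V\<^esub> Idn V (EHom E c c'))
      = ehom_arr V E (Asc (underlying V E) a b c) (Idn (underlying V E) (ETObj E a' (ETObj E b' c')))
        \<cdot>\<^bsub>V\<^esub> ETen E a (ETObj E b c) a' (ETObj E b' c')
        \<cdot>\<^bsub>V\<^esub> (Idn V (EHom E a a') \<otimes>\<^bsub>V\<^esub> ETen E b c b' c')
        \<cdot>\<^bsub>V\<^esub> Asc V (EHom E a a') (EHom E b b') (EHom E c c')"
    and lun_vnat: "a \<in> EObj E \<Longrightarrow> b \<in> EObj E \<Longrightarrow>
      ehom_arr V E (Idn (underlying V E) (ETObj E (EUni E) a)) (LUn (underlying V E) b)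
        \<cdot>\<^bsub>V\<^esub> ETen E (EUni E) a (EUni E) b
        \<cdot>\<^bsub>V\<^esub> (EIdn E (EUni E) \<otimes>\<^bsub>V\<^esub> Idn V (EHom E a b)) \<cdot>\<^bsub>V\<^esub> inv_arr V (LUn V (EHom E a b))
      = ehom_arr V E (LUn (underlying V E) a) (Idn (underlying V E) b)"
    and run_vnat: "a \<in> EObj E \<Longrightarrow> b \<in> EObj E \<Longrightarrow>
      ehom_arr V E (Idn (underlying V E) (ETObj E a (EUni E))) (RUn (underlying V E) b)
        \<cdot>\<^bsub>V\<^esub> ETen E a (EUni E) b (EUni E)
        \<cdot>\<^bsub>V\<^esub> (Idn V (EHom E a b) \<otimes>\<^bsub>V\<^esub> EIdn E (EUni E)) \<cdot>\<^bsub>V\<^esub> inv_arr V (RUn V (EHom E a b))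
      = ehom_arr V E (RUn (underlying V E) a) (Idn (underlying V E) b)"

definition vnatural_braiding :: "('o, 'm, 'z) brcat_scheme \<Rightarrow> ('a, 'o, 'm, 'x) vbrcat_scheme \<Rightarrow> bool" where
  "vnatural_braiding V E \<longleftrightarrow>
    (\<forall>a\<in>EObj E. \<forall>b\<in>EObj E. \<forall>c\<in>EObj E. \<forall>d\<in>EObj E.
      ehom_arr V E (inv_arr (underlying_br V E) (Brd (underlying_br V E) a c))
          (Brd (underlying_br V E) b d) \<cdot>\<^bsub>V\<^esub> ETen E a c b d
        = ETen E c a d b \<cdot>\<^bsub>V\<^esub> Brd V (EHom E a b) (EHom E c d))"

locale braided_monoidal_vcategory = monoidal_vcategory V E
    + underlying: braided_monoidal_category "underlying_br V E" for V E +
  assumes vnatural: "vnatural_braiding V E"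


section \<open>The enriched category associated with an action\<close>

text \<open>\<open>R a\<close> is the right adjoint of \<open>-*a\<close>, so \<open>FObj (R a) b\<close> is the hom-object and
  \<open>ACounit (R a) b\<close> the counit \<open>\<epsilon>\<close>. The transpose of \<open>f : x*a \<rightarrow> b\<close>:\<close>

definition transpose :: "('o, 'm, 'z) cat_scheme \<Rightarrow> ('p \<Rightarrow> ('p, 'n, 'o, 'm, 'y) radj_scheme)
    \<Rightarrow> 'p \<Rightarrow> 'o \<Rightarrow> 'n \<Rightarrow> 'm" where
  "transpose V R a x f = FArr (R a) f \<cdot>\<^bsub>V\<^esub> AUnit (R a) x"

text \<open>The identification of the arrows \<open>f : a \<rightarrow> b\<close> of \<open>A\<close> with those of the underlying category
  of the associated \<open>V\<close>-category.\<close>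

definition name_of :: "('o, 'm, 'w) moncat_scheme \<Rightarrow> ('p, 'n, 'z) cat_scheme
    \<Rightarrow> ('o, 'm, 'p, 'n, 'x) action_scheme \<Rightarrow> ('p \<Rightarrow> ('p, 'n, 'o, 'm, 'y) radj_scheme)
    \<Rightarrow> 'n \<Rightarrow> 'm" where
  "name_of V A S R f = transpose V R (Dom A f) (Uni V) (f \<cdot>\<^bsub>A\<^esub> ActUni S (Dom A f))"

definition assoc_vcat :: "('o, 'm, 'w) moncat_scheme \<Rightarrow> ('p, 'n, 'z) brcat_scheme
    \<Rightarrow> ('o, 'm, 'p, 'n, 'x) action_scheme \<Rightarrow> ('p \<Rightarrow> ('p, 'n, 'o, 'm, 'y) radj_scheme)
    \<Rightarrow> ('p, 'o, 'm) vbrcat" where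
  "assoc_vcat V A S R =
    (let H = (\<lambda>a b. FObj (R a) b);
         \<epsilon> = (\<lambda>a b. ACounit (R a) b)
     in
    \<lparr>EObj = Obj A,
     EHom = H,
     ECmp = (\<lambda>a b c. transpose V R a (H b c \<odot>\<^bsub>V\<^esub> H a b)
       (\<epsilon> b c \<cdot>\<^bsub>A\<^esub> FArr S (Idn V (H b c), \<epsilon> a b) \<cdot>\<^bsub>A\<^esub> inv_arr A (ActAsc S (H b c, H a b, a)))),
     EIdn = (\<lambda>a. transpose V R a (Uni V) (ActUni S a)),
     ETObj = (\<lambda>a b. a \<odot>\<^bsub>A\<^esub> b),
     ETen = (\<lambda>a c b d. transpose V R (a \<odot>\<^bsub>A\<^esub> c) (H a b \<odot>\<^bsub>V\<^esub> H c d)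
       ((\<epsilon> a b \<otimes>\<^bsub>A\<^esub> \<epsilon> c d) \<cdot>\<^bsub>A\<^esub> FTen S (H a b, a) (H c d, c))),
     EUni = Uni A,
     EAsc = (\<lambda>a b c. name_of V A S R (Asc A a b c)),
     ELUn = (\<lambda>a. name_of V A S R (LUn A a)),
     ERUn = (\<lambda>a. name_of V A S R (RUn A a)),
     EBrd = (\<lambda>a b. name_of V A S R (Brd A a b))\<rparr>)"

end

theory Submission
  imports Defs
begin

text \<open>
  By adjointness, a morphism \<open>\<phi> : x \<rightarrow> \<A>(a,b)\<close> is determined by \<open>\<epsilon> \<cdot> (\<phi> * a) : x * a \<rightarrow> b\<close>, and
  in these terms composition, identities, tensor and the action of \<open>\<A>(f,g)\<close> become short expressions in
  \<open>\<alpha>\<close>, \<open>\<lambda>\<close> and \<open>\<xi>\<close>. The two sides of \<open>\<V>\<close>-naturality of the braiding correspond to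
  \<open>(\<epsilon> \<diamondop> \<epsilon>) \<cdot> c \<cdot> \<xi> \<cdot> (1 * c\<^sup>-\<^sup>1)\<close> and \<open>(\<epsilon> \<diamondop> \<epsilon>) \<cdot> \<xi> \<cdot> (c * 1)\<close>. A braided action makes them equal; conversely,
  precomposing with the units of the adjunctions removes the counits. The
  axioms of a monoidal \<open>\<V>\<close>-category translate in the same way into those of the action, except for
  the coherence of the middle-four interchange in \<open>\<V>\<close>. For the latter, every morphism between
  iterated tensor products is compared with its effect on right-nested, unit-free normal forms.
\<close>

text \<open>The normal forms imitate Cayley's representation of a monoid: sending an object
  \<open>t\<close> to the endofunctor \<open>t \<otimes> -\<close> turns tensor products into
  composites, which are strictly associative and unital. This is why every normal form carries a
  tail \<open>w\<close>; faithfulness of \<open>- \<otimes> I\<close> recovers a morphism from its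
  effect. Of a braiding there survives one family of crossings, controlled by the two hexagons,
  naturality and invertibility. The resulting laws of the interchange are what makes a tensor
  product of \<open>\<V>\<close>-categories a \<open>\<V>\<close>-category.

  The equivalence passes through the equations \<open>braided_at x y a c\<close>. Deducing
  \<open>\<V>\<close>-naturality needs them only at hom-objects. Conversely, arbitrary
  \<open>x\<close> and \<open>y\<close> are reached by choosing the targets \<open>b = x * a\<close>
  and \<open>d = y * c\<close> and restricting along the units of the adjunctions: the triangle
  identity turns each counit into an identity, so nothing is left in front of the equation for
  \<open>\<xi>\<close>.\<close>

section \<open>Categories and monoidal categories\<close>

lemma hom_iff [simp]: "f \<in> hom C a b \<longleftrightarrow> f \<in> Arr C \<and> Dom C f = a \<and> Cod C f = b"
  by (simp add: hom_def)

context category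
begin

lemma dom_obj [simp]: "f \<in> Arr C \<Longrightarrow> Dom C f \<in> Obj C"
  and cod_obj [simp]: "f \<in> Arr C \<Longrightarrow> Cod C f \<in> Obj C"
  by (rule arr_dom arr_cod, assumption)+

lemma Idn_simps [simp]:
  assumes "a \<in> Obj C"
  shows "Idn C a \<in> Arr C" "Dom C (Idn C a) = a" "Cod C (Idn C a) = a"
  using id_hom[OF assms] by auto

lemma comp_simps [simp]:
  assumes "f \<in> Arr C" "g \<in> Arr C" "Cod C f = Dom C g"
  shows "g \<cdot> f \<in> Arr C" "Dom C (g \<cdot> f) = Dom C f" "Cod C (g \<cdot> f) = Cod C g"
  using comp_hom[of f "Dom C f" "Dom C g" g "Cod C g"] assms by auto

lemma comp_Idn_left [simp]: "f \<in> Arr C \<Longrightarrow> Cod C f = b \<Longrightarrow> Idn C b \<cdot> f = f"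
  by (rule comp_id_left[where a = "Dom C f"]) simp

lemma comp_Idn_right [simp]: "f \<in> Arr C \<Longrightarrow> Dom C f = a \<Longrightarrow> f \<cdot> Idn C a = f"
  by (rule comp_id_right[where b = "Cod C f"]) simp

lemma comp_assoc_arr [simp]:
  "f \<in> Arr C \<Longrightarrow> g \<in> Arr C \<Longrightarrow> h \<in> Arr C \<Longrightarrow> Cod C f = Dom C g \<Longrightarrow> Cod C g = Dom C h \<Longrightarrow>
    (h \<cdot> g) \<cdot> f = h \<cdot> (g \<cdot> f)"
  by (rule comp_assoc[where a = "Dom C f" and b = "Dom C g" and c = "Dom C h" and d = "Cod C h"]) simp_all

text \<open>The simp rule \<open>comp_assoc_arr\<close> nests composites to the right, so an
  equation for \<open>g \<cdot> f\<close> no longer matches inside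
  \<open>g \<cdot> (f \<cdot> k)\<close>. This lemma and the next carry such an equation past a tail
  \<open>k\<close>.\<close>

lemma comp_cong_tail:
  assumes "g \<cdot> f = h" "k \<in> Arr C" "f \<in> Arr C" "g \<in> Arr C" "Cod C k = Dom C f" "Cod C f = Dom C g"
  shows "g \<cdot> (f \<cdot> k) = h \<cdot> k"
  using assms comp_assoc_arr[of k f g] by simp

lemma comp_cong_tail2:
  assumes "g \<cdot> f = h \<cdot> l" "k \<in> Arr C" "f \<in> Arr C" "g \<in> Arr C" "h \<in> Arr C" "l \<in> Arr C"
    "Cod C k = Dom C f" "Cod C f = Dom C g" "Dom C l = Dom C f" "Cod C l = Dom C h"
  shows "g \<cdot> (f \<cdot> k) = h \<cdot> (l \<cdot> k)"
  using assms comp_cong_tail[of g f "h \<cdot> l" k] by simp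

lemma inverse_arrsD:
  assumes "inverse_arrs C f g"
  shows "f \<in> Arr C" "g \<in> Arr C" "Dom C g = Cod C f" "Cod C g = Dom C f"
    "g \<cdot> f = Idn C (Dom C f)" "f \<cdot> g = Idn C (Cod C f)"
  using assms by (auto simp: inverse_arrs_def)

lemma inverse_arrs_unique:
  assumes "inverse_arrs C f g" "inverse_arrs C f h"
  shows "g = h"
proof -
  note [simp] = inverse_arrsD[OF assms(1)] inverse_arrsD(2-4)[OF assms(2)]
  have "g = g \<cdot> (f \<cdot> h)" by (simp add: inverse_arrsD(6)[OF assms(2)])
  also have "\<dots> = (g \<cdot> f) \<cdot> h" by (rule comp_assoc_arr[symmetric]) simp_all
  also have "\<dots> = h" by simp
  finally show ?thesis .
qed

lemma inv_arr_eq: "inverse_arrs C f g \<Longrightarrow> inv_arr C f = g"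
  unfolding inv_arr_def by (rule the_equality) (auto intro: inverse_arrs_unique)

lemma isoI: "inverse_arrs C f g \<Longrightarrow> iso C f"
  by (auto simp: iso_def)

lemma inverse_arrs_inv: "iso C f \<Longrightarrow> inverse_arrs C f (inv_arr C f)"
  by (auto simp: iso_def inv_arr_eq)

lemma iso_arr: "iso C f \<Longrightarrow> f \<in> Arr C"
  by (auto simp: iso_def inverse_arrs_def)

lemma inv_simps [simp]:
  assumes "iso C f"
  shows "inv_arr C f \<in> Arr C" "Dom C (inv_arr C f) = Cod C f" "Cod C (inv_arr C f) = Dom C f"
    "inv_arr C f \<cdot> f = Idn C (Dom C f)" "f \<cdot> inv_arr C f = Idn C (Cod C f)"
  using inverse_arrsD[OF inverse_arrs_inv[OF assms]] by auto

lemma inv_tail [simp]: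
  assumes "iso C f" "k \<in> Arr C"
  shows "Cod C k = Dom C f \<Longrightarrow> inv_arr C f \<cdot> (f \<cdot> k) = k"
    "Cod C k = Cod C f \<Longrightarrow> f \<cdot> (inv_arr C f \<cdot> k) = k"
  using assms by (simp_all add: comp_cong_tail iso_arr)

lemma inverse_arrs_sym: "inverse_arrs C f g \<Longrightarrow> inverse_arrs C g f"
  by (auto simp: inverse_arrs_def)

lemma iso_inv: "iso C f \<Longrightarrow> iso C (inv_arr C f)"
  using inverse_arrs_inv inverse_arrs_sym isoI by blast

lemma inverse_arrs_Idn: "a \<in> Obj C \<Longrightarrow> inverse_arrs C (Idn C a) (Idn C a)"
  by (auto simp: inverse_arrs_def)

lemma iso_Idn [simp]: "a \<in> Obj C \<Longrightarrow> iso C (Idn C a)"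
  by (rule isoI) (rule inverse_arrs_Idn)

lemma inverse_arrs_comp:
  assumes "inverse_arrs C f f'" "inverse_arrs C g g'" "Cod C f = Dom C g"
  shows "inverse_arrs C (g \<cdot> f) (f' \<cdot> g')"
proof -
  note f = inverse_arrsD[OF assms(1)] and g = inverse_arrsD[OF assms(2)]
  have "g' \<cdot> (g \<cdot> f) = f" "f \<cdot> (f' \<cdot> g') = g'"
    using f g assms(3) by (simp_all add: comp_cong_tail)
  then show ?thesis
    using f g assms(3) by (simp add: inverse_arrs_def)
qed

lemma iso_comp: "iso C f \<Longrightarrow> iso C g \<Longrightarrow> Cod C f = Dom C g \<Longrightarrow> iso C (g \<cdot> f)"
  by (meson inverse_arrs_comp inverse_arrs_inv isoI)

lemma iso_cancel_left:
  assumes "iso C f" "f \<cdot> g = f \<cdot> h" "g \<in> Arr C" "h \<in> Arr C" "Cod C g = Dom C f" "Cod C h = Dom C f"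
  shows "g = h"
proof -
  have "g = inv_arr C f \<cdot> (f \<cdot> g)" using assms(1,3,5) by simp
  also have "\<dots> = inv_arr C f \<cdot> (f \<cdot> h)" using assms(2) by (rule arg_cong)
  also have "\<dots> = h" using assms(1,4,6) by simp
  finally show ?thesis .
qed

lemma iso_cancel_right:
  assumes "iso C f" "g \<cdot> f = h \<cdot> f" "g \<in> Arr C" "h \<in> Arr C" "Dom C g = Cod C f" "Dom C h = Cod C f"
  shows "g = h"
proof -
  have "g = (g \<cdot> f) \<cdot> inv_arr C f" using assms(1,3,5) by (simp add: iso_arr)
  also have "\<dots> = (h \<cdot> f) \<cdot> inv_arr C f" using assms(2) by (rule arg_cong)
  also have "\<dots> = h" using assms(1,4,6) by (simp add: iso_arr)
  finally show ?thesis .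
qed

text \<open>Conjugating a commutative square by its two invertible sides; naturality of inverse
  constraints comes from here.\<close>

lemma inv_square:
  assumes "iso C f" "iso C g" "f \<cdot> h = k \<cdot> g" "h \<in> Arr C" "k \<in> Arr C"
    "Cod C h = Dom C f" "Dom C h = Dom C g" "Cod C g = Dom C k" "Cod C k = Cod C f"
  shows "inv_arr C f \<cdot> k = h \<cdot> inv_arr C g"
proof -
  have "inv_arr C f \<cdot> k = inv_arr C f \<cdot> ((k \<cdot> g) \<cdot> inv_arr C g)"
    using assms(1,2,4-) by (simp add: iso_arr)
  also have "\<dots> = inv_arr C f \<cdot> ((f \<cdot> h) \<cdot> inv_arr C g)"
    by (simp only: assms(3))
  also have "\<dots> = h \<cdot> inv_arr C g"
    using assms(1,2,4-) by (simp add: iso_arr)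
  finally show ?thesis .
qed

end

section \<open>Calculation in a monoidal category\<close>

context monoidal_category
begin

declare tensor_obj [simp] unit_obj [simp] asc_iso [simp] lun_iso [simp] run_iso [simp]

lemma tensor_simps [simp]:
  assumes "f \<in> Arr C" "g \<in> Arr C"
  shows "f \<otimes> g \<in> Arr C" "Dom C (f \<otimes> g) = Dom C f \<odot> Dom C g" "Cod C (f \<otimes> g) = Cod C f \<odot> Cod C g"
  using tensor_hom[of f "Dom C f" "Cod C f" g "Dom C g" "Cod C g"] assms by auto

lemma constraint_simps [simp]:
  shows "a \<in> Obj C \<Longrightarrow> b \<in> Obj C \<Longrightarrow> c \<in> Obj C \<Longrightarrow> Asc C a b c \<in> Arr C"
    "a \<in> Obj C \<Longrightarrow> b \<in> Obj C \<Longrightarrow> c \<in> Obj C \<Longrightarrow> Dom C (Asc C a b c) = (a \<odot> b) \<odot> c"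
    "a \<in> Obj C \<Longrightarrow> b \<in> Obj C \<Longrightarrow> c \<in> Obj C \<Longrightarrow> Cod C (Asc C a b c) = a \<odot> (b \<odot> c)"
    "a \<in> Obj C \<Longrightarrow> LUn C a \<in> Arr C"
    "a \<in> Obj C \<Longrightarrow> Dom C (LUn C a) = Uni C \<odot> a"
    "a \<in> Obj C \<Longrightarrow> Cod C (LUn C a) = a"
    "a \<in> Obj C \<Longrightarrow> RUn C a \<in> Arr C"
    "a \<in> Obj C \<Longrightarrow> Dom C (RUn C a) = a \<odot> Uni C"
    "a \<in> Obj C \<Longrightarrow> Cod C (RUn C a) = a"
  using asc_hom[of a b c] lun_hom[of a] run_hom[of a] by auto

lemma tensor_Idn [simp]: "a \<in> Obj C \<Longrightarrow> b \<in> Obj C \<Longrightarrow> Idn C a \<otimes> Idn C b = Idn C (a \<odot> b)"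
  by (rule tensor_id)

lemma tensor_comp_arr:
  assumes "f \<in> Arr C" "g \<in> Arr C" "f' \<in> Arr C" "g' \<in> Arr C"
    "Cod C f = Dom C g" "Cod C f' = Dom C g'"
  shows "(g \<otimes> g') \<cdot> (f \<otimes> f') = (g \<cdot> f) \<otimes> (g' \<cdot> f')"
  by (rule tensor_comp[symmetric, where a = "Dom C f" and b = "Dom C g" and c = "Cod C g"
        and a' = "Dom C f'" and b' = "Dom C g'" and c' = "Cod C g'"]) (use assms in simp_all)

lemma tensor_comp_tail:
  assumes "f \<in> Arr C" "g \<in> Arr C" "f' \<in> Arr C" "g' \<in> Arr C"
    "Cod C f = Dom C g" "Cod C f' = Dom C g'"
    "k \<in> Arr C" "Cod C k = Dom C f \<odot> Dom C f'"
  shows "(g \<otimes> g') \<cdot> ((f \<otimes> f') \<cdot> k) = ((g \<cdot> f) \<otimes> (g' \<cdot> f')) \<cdot> k"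
  using assms by (simp add: comp_cong_tail tensor_comp_arr)

text \<open>Interchange law oriented towards a single tensor of composites. It is added only on
  demand, because naturality squares need the split form.\<close>

lemmas tensor_merge = tensor_comp_arr tensor_comp_tail

lemma asc_natural:
  "f \<in> Arr C \<Longrightarrow> g \<in> Arr C \<Longrightarrow> h \<in> Arr C \<Longrightarrow>
    Asc C (Cod C f) (Cod C g) (Cod C h) \<cdot> ((f \<otimes> g) \<otimes> h)
      = (f \<otimes> (g \<otimes> h)) \<cdot> Asc C (Dom C f) (Dom C g) (Dom C h)"
  by (rule asc_nat) simp_all

lemma inverse_arrs_tensor:
  assumes "inverse_arrs C f f'" "inverse_arrs C g g'"
  shows "inverse_arrs C (f \<otimes> g) (f' \<otimes> g')"
  using inverse_arrsD[OF assms(1)] inverse_arrsD[OF assms(2)]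
  by (simp add: inverse_arrs_def tensor_comp_arr)

lemma iso_tensor: "iso C f \<Longrightarrow> iso C g \<Longrightarrow> iso C (f \<otimes> g)"
  by (meson inverse_arrs_tensor inverse_arrs_inv isoI)

text \<open>Naturality of the invertible \<open>LUn\<close> exhibits \<open>f\<close> as the
  conjugate of \<open>I \<otimes> f\<close>.\<close>

lemma tensor_unit_left_faithful:
  assumes "Idn C (Uni C) \<otimes> f = Idn C (Uni C) \<otimes> g" "f \<in> hom C a b" "g \<in> hom C a b"
  shows "f = g"
proof (rule iso_cancel_right)
  show "f \<cdot> LUn C a = g \<cdot> LUn C a"
    using lun_nat[OF assms(2)] lun_nat[OF assms(3)] by (simp only: assms(1))
qed (use assms(2,3) in auto)

lemma tensor_unit_right_faithful:
  assumes "f \<otimes> Idn C (Uni C) = g \<otimes> Idn C (Uni C)" "f \<in> hom C a b" "g \<in> hom C a b"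
  shows "f = g"
proof (rule iso_cancel_right)
  show "f \<cdot> RUn C a = g \<cdot> RUn C a"
    using run_nat[OF assms(2)] run_nat[OF assms(3)] by (simp only: assms(1))
qed (use assms(2,3) in auto)

lemma lun_inv_natural:
  "f \<in> hom C a b \<Longrightarrow> inv_arr C (LUn C b) \<cdot> f = (Idn C (Uni C) \<otimes> f) \<cdot> inv_arr C (LUn C a)"
  using lun_nat[of f a b] by (intro inv_square) auto

lemma run_inv_natural:
  "f \<in> hom C a b \<Longrightarrow> inv_arr C (RUn C b) \<cdot> f = (f \<otimes> Idn C (Uni C)) \<cdot> inv_arr C (RUn C a)"
  using run_nat[of f a b] by (intro inv_square) auto

text \<open>Kelly's redundancy: tensoring with the unit object on the left is faithful, and after that
  the equation follows from the pentagon for \<open>I, I, a, b\<close> and two triangles.\<close>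

lemma lun_tensor:
  assumes [simp]: "a \<in> Obj C" "b \<in> Obj C"
  shows "LUn C (a \<odot> b) \<cdot> Asc C (Uni C) a b = LUn C a \<otimes> Idn C b"
proof -
  let ?I = "Uni C" and ?i = "Idn C (Uni C)"
  \<comment> \<open>The two rightmost factors of the long side of the pentagon for
    \<open>I, I, a, b\<close>. They form an isomorphism, which is cancelled at the end.\<close>
  let ?z = "Asc C ?I (?I \<odot> a) b \<cdot> (Asc C ?I ?I a \<otimes> Idn C b)"
  have z: "iso C ?z" by (intro iso_comp iso_tensor) simp_all
  have "(?i \<otimes> (LUn C (a \<odot> b) \<cdot> Asc C ?I a b)) \<cdot> ?z
      = (?i \<otimes> LUn C (a \<odot> b)) \<cdot> ((?i \<otimes> Asc C ?I a b) \<cdot> ?z)"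
    by (simp add: tensor_merge)
  also have "\<dots> = (?i \<otimes> LUn C (a \<odot> b)) \<cdot> (Asc C ?I ?I (a \<odot> b) \<cdot> Asc C (?I \<odot> ?I) a b)"
    by (simp add: pentagon)
  also have "\<dots> = (RUn C ?I \<otimes> Idn C (a \<odot> b)) \<cdot> Asc C (?I \<odot> ?I) a b"
    by (simp add: comp_cong_tail[OF triangle])
  also have "\<dots> = Asc C ?I a b \<cdot> ((RUn C ?I \<otimes> Idn C a) \<otimes> Idn C b)"
    by (simp add: asc_natural[of "RUn C ?I" "Idn C a" "Idn C b", simplified])
  also have "\<dots> = Asc C ?I a b \<cdot> (((?i \<otimes> LUn C a) \<otimes> Idn C b) \<cdot> (Asc C ?I ?I a \<otimes> Idn C b))"
    by (simp add: tensor_merge triangle)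
  also have "\<dots> = (?i \<otimes> (LUn C a \<otimes> Idn C b)) \<cdot> ?z"
    by (simp add: comp_cong_tail2[OF asc_natural[of ?i "LUn C a" "Idn C b", simplified]])
  finally have eq: "(?i \<otimes> (LUn C (a \<odot> b) \<cdot> Asc C ?I a b)) \<cdot> ?z = (?i \<otimes> (LUn C a \<otimes> Idn C b)) \<cdot> ?z" .
  have "?i \<otimes> (LUn C (a \<odot> b) \<cdot> Asc C ?I a b) = ?i \<otimes> (LUn C a \<otimes> Idn C b)"
    by (rule iso_cancel_right[OF z eq]) simp_all
  then show ?thesis
    by (rule tensor_unit_left_faithful[of _ _ "(?I \<odot> a) \<odot> b" "a \<odot> b"]) simp_all
qed

end


section \<open>Coherence by normal forms\<close>

text \<open>Bracketings are kept as syntax because an object of \<open>C\<close> may be a tensor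
  product in several ways, so that its normal form is not a function of the object.\<close>

datatype 'o word = Empty | Letter 'o | Join "'o word" "'o word"

primrec word_obj :: "('o, 'm, 'z) moncat_scheme \<Rightarrow> 'o word \<Rightarrow> 'o" where
  "word_obj C Empty = Uni C"
| "word_obj C (Letter a) = a"
| "word_obj C (Join t s) = word_obj C t \<odot>\<^bsub>C\<^esub> word_obj C s"

text \<open>Joining words is strictly associative and unital for this action.\<close>

primrec word_act :: "('o, 'm, 'z) moncat_scheme \<Rightarrow> 'o word \<Rightarrow> 'o \<Rightarrow> 'o" where
  "word_act C Empty w = w"
| "word_act C (Letter a) w = a \<odot>\<^bsub>C\<^esub> w"
| "word_act C (Join t s) w = word_act C t (word_act C s w)"

primrec word_map :: "('o, 'm, 'z) moncat_scheme \<Rightarrow> 'o word \<Rightarrow> 'm \<Rightarrow> 'm" where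
  "word_map C Empty h = h"
| "word_map C (Letter a) h = Idn C a \<otimes>\<^bsub>C\<^esub> h"
| "word_map C (Join t s) h = word_map C t (word_map C s h)"

text \<open>Components in \<open>w\<close> of a natural isomorphism from
  \<open>t \<otimes> -\<close> to the endofunctor with object part \<open>word_act C t\<close> and
  arrow part \<open>word_map C t\<close>. At a join, reassociate, then normalize the right word and
  finally the left one; units are erased by \<open>LUn\<close>.\<close>

primrec normalize :: "('o, 'm, 'z) moncat_scheme \<Rightarrow> 'o word \<Rightarrow> 'o \<Rightarrow> 'm" where
  "normalize C Empty w = LUn C w"
| "normalize C (Letter a) w = Idn C (a \<odot>\<^bsub>C\<^esub> w)"
| "normalize C (Join t s) w = normalize C t (word_act C s w)
     \<cdot>\<^bsub>C\<^esub> (Idn C (word_obj C t) \<otimes>\<^bsub>C\<^esub> normalize C s w) \<cdot>\<^bsub>C\<^esub> Asc C (word_obj C t) (word_obj C s) w"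

definition word_in :: "('o, 'm, 'z) moncat_scheme \<Rightarrow> 'o word \<Rightarrow> bool" where
  "word_in C t \<longleftrightarrow> set_word t \<subseteq> Obj C"

lemma word_in_simps [simp]:
  "word_in C Empty" "word_in C (Letter a) \<longleftrightarrow> a \<in> Obj C"
  "word_in C (Join t s) \<longleftrightarrow> word_in C t \<and> word_in C s"
  by (auto simp: word_in_def)

text \<open>\<open>\<phi>\<close> is what \<open>f \<otimes> w\<close> becomes when its source and target are replaced by their right-nested,
  unit-free normal forms. The coherence isomorphisms all become identities.\<close>

definition normal_form :: "('o, 'm, 'z) moncat_scheme \<Rightarrow> 'o word \<Rightarrow> 'o word \<Rightarrow> 'm \<Rightarrow> ('o \<Rightarrow> 'm) \<Rightarrow> bool" where
  "normal_form C t s f \<phi> \<longleftrightarrow> word_in C t \<and> word_in C s \<and> f \<in> hom C (word_obj C t) (word_obj C s)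
     \<and> (\<forall>w\<in>Obj C. \<phi> w \<in> hom C (word_act C t w) (word_act C s w)
          \<and> normalize C s w \<cdot>\<^bsub>C\<^esub> (f \<otimes>\<^bsub>C\<^esub> Idn C w) = \<phi> w \<cdot>\<^bsub>C\<^esub> normalize C t w)"

context monoidal_category
begin

lemma word_obj_in [simp]: "word_in C t \<Longrightarrow> word_obj C t \<in> Obj C"
  by (induction t) simp_all

lemma word_act_in [simp]: "word_in C t \<Longrightarrow> w \<in> Obj C \<Longrightarrow> word_act C t w \<in> Obj C"
  by (induction t arbitrary: w) simp_all

lemma word_map_simps [simp]:
  assumes "word_in C t" "h \<in> Arr C"
  shows "word_map C t h \<in> Arr C" "Dom C (word_map C t h) = word_act C t (Dom C h)"
    "Cod C (word_map C t h) = word_act C t (Cod C h)"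
  using assms by (induction t arbitrary: h) simp_all

lemma word_map_Idn [simp]: "word_in C t \<Longrightarrow> w \<in> Obj C \<Longrightarrow> word_map C t (Idn C w) = Idn C (word_act C t w)"
  by (induction t arbitrary: w) simp_all

lemma normalize_simps [simp]:
  assumes "word_in C t" "w \<in> Obj C"
  shows "normalize C t w \<in> Arr C" "Dom C (normalize C t w) = word_obj C t \<odot> w"
    "Cod C (normalize C t w) = word_act C t w"
  using assms by (induction t arbitrary: w) simp_all

lemma normalize_iso [simp]: "word_in C t \<Longrightarrow> w \<in> Obj C \<Longrightarrow> iso C (normalize C t w)"
  by (induction t arbitrary: w) (simp_all add: iso_comp iso_tensor)

text \<open>Naturality of \<open>LUn\<close> settles the empty word. For a join, naturality of the
  associator is followed by both induction hypotheses; the one for \<open>t\<close> is applied to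
  \<open>word_map C s h\<close>, which is why \<open>h\<close> is generalized.\<close>

lemma normalize_natural:
  "word_in C t \<Longrightarrow> h \<in> Arr C \<Longrightarrow>
    normalize C t (Cod C h) \<cdot> (Idn C (word_obj C t) \<otimes> h) = word_map C t h \<cdot> normalize C t (Dom C h)"
proof (induction t arbitrary: h)
  case Empty
  then show ?case using lun_nat[of h "Dom C h" "Cod C h"] by simp
next
  case (Letter a)
  then show ?case by simp
next
  case (Join t s)
  let ?t = "word_obj C t" and ?s = "word_obj C s"
  have [simp]: "word_in C t" "word_in C s" "h \<in> Arr C" using Join.prems by auto
  have "normalize C (Join t s) (Cod C h) \<cdot> (Idn C (?t \<odot> ?s) \<otimes> h)
      = normalize C t (word_act C s (Cod C h)) \<cdot> (Idn C ?t \<otimes> normalize C s (Cod C h))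
        \<cdot> (Idn C ?t \<otimes> (Idn C ?s \<otimes> h)) \<cdot> Asc C ?t ?s (Dom C h)"
    using asc_natural[of "Idn C ?t" "Idn C ?s" h] by simp
  also have "\<dots> = normalize C t (word_act C s (Cod C h)) \<cdot> (Idn C ?t \<otimes> word_map C s h)
        \<cdot> (Idn C ?t \<otimes> normalize C s (Dom C h)) \<cdot> Asc C ?t ?s (Dom C h)"
    using Join.IH(2)[of h] by (simp add: tensor_merge)
  also have "\<dots> = word_map C t (word_map C s h) \<cdot> normalize C (Join t s) (Dom C h)"
    using comp_cong_tail2[OF Join.IH(1)[of "word_map C s h"],
        of "(Idn C ?t \<otimes> normalize C s (Dom C h)) \<cdot> Asc C ?t ?s (Dom C h)"] by simp
  finally show ?case by simp
qed

lemma normal_form_word_in: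
  "normal_form C t s f \<phi> \<Longrightarrow> word_in C t" "normal_form C t s f \<phi> \<Longrightarrow> word_in C s"
  by (simp_all add: normal_form_def)

lemma normal_form_arr:
  assumes "normal_form C t s f \<phi>"
  shows "f \<in> Arr C" "Dom C f = word_obj C t" "Cod C f = word_obj C s"
  using assms by (simp_all add: normal_form_def)

lemma normal_form_arrs:
  assumes "normal_form C t s f \<phi>" "w \<in> Obj C"
  shows "\<phi> w \<in> Arr C" "Dom C (\<phi> w) = word_act C t w" "Cod C (\<phi> w) = word_act C s w"
  using assms by (simp_all add: normal_form_def)

lemma normal_form_eq:
  "normal_form C t s f \<phi> \<Longrightarrow> w \<in> Obj C \<Longrightarrow>
    normalize C s w \<cdot> (f \<otimes> Idn C w) = \<phi> w \<cdot> normalize C t w"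
  by (simp add: normal_form_def)

lemma normal_formI:
  assumes "word_in C t" "word_in C s" "f \<in> hom C (word_obj C t) (word_obj C s)"
    "\<And>w. w \<in> Obj C \<Longrightarrow> \<phi> w \<in> hom C (word_act C t w) (word_act C s w)"
    "\<And>w. w \<in> Obj C \<Longrightarrow> normalize C s w \<cdot> (f \<otimes> Idn C w) = \<phi> w \<cdot> normalize C t w"
  shows "normal_form C t s f \<phi>"
  using assms by (simp add: normal_form_def)

text \<open>Take \<open>w\<close> to be the unit: \<open>normalize\<close> is invertible and
  \<open>- \<otimes> I\<close> is faithful, so the effect on normal forms determines the
  morphism.\<close>

lemma normal_form_unique:
  assumes "normal_form C t s f \<phi>" "normal_form C t s g \<psi>" "\<And>w. w \<in> Obj C \<Longrightarrow> \<phi> w = \<psi> w"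
  shows "f = g"
proof -
  note [simp] = normal_form_word_in[OF assms(1)] normal_form_arr[OF assms(1)] normal_form_arr[OF assms(2)]
  have "normalize C s (Uni C) \<cdot> (f \<otimes> Idn C (Uni C)) = normalize C s (Uni C) \<cdot> (g \<otimes> Idn C (Uni C))"
    by (simp only: normal_form_eq[OF assms(1)] normal_form_eq[OF assms(2)] assms(3) unit_obj)
  then have "f \<otimes> Idn C (Uni C) = g \<otimes> Idn C (Uni C)"
    by (rule iso_cancel_left[rotated]) simp_all
  then show ?thesis
    by (rule tensor_unit_right_faithful[of _ _ "word_obj C t" "word_obj C s"]) simp_all
qed

text \<open>In the other direction, invertibility of \<open>normalize\<close> makes the effect
  unique. Applied to the hexagons, this turns axioms about \<open>Brd\<close> into equations between
  crossings.\<close>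

lemma normal_form_determined:
  assumes "normal_form C t s f \<phi>" "normal_form C t s g \<psi>" "f = g" "w \<in> Obj C"
  shows "\<phi> w = \<psi> w"
proof (rule iso_cancel_right)
  note [simp] = normal_form_word_in[OF assms(1)] assms(4)
  show "iso C (normalize C t w)" by simp
  show "\<phi> w \<cdot> normalize C t w = \<psi> w \<cdot> normalize C t w"
    using normal_form_eq[OF assms(1,4)] normal_form_eq[OF assms(2,4)] assms(3) by simp
qed (use normal_form_arrs[OF assms(1,4)] normal_form_arrs[OF assms(2,4)] assms(4)
    normal_form_word_in[OF assms(1)] in simp_all)

lemma normal_form_cong:
  "normal_form C t s f \<phi> \<Longrightarrow> (\<And>w. w \<in> Obj C \<Longrightarrow> \<phi> w = \<psi> w) \<Longrightarrow> normal_form C t s f \<psi>"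
  by (simp add: normal_form_def)

text \<open>Conjugation by the normalizations. It is of use where the effect has no simpler
  description, as for the braiding.\<close>

lemma normal_form_exists:
  assumes "word_in C t" "word_in C s" "f \<in> hom C (word_obj C t) (word_obj C s)"
  shows "normal_form C t s f (\<lambda>w. normalize C s w \<cdot> (f \<otimes> Idn C w) \<cdot> inv_arr C (normalize C t w))"
  by (rule normal_formI) (use assms in simp_all)

text \<open>Naturality in the tail comes for free, because \<open>\<phi>\<close> is the conjugate of
  the natural family \<open>f \<otimes> w\<close> by natural isomorphisms.\<close>

lemma normal_form_natural:
  assumes "normal_form C t s f \<phi>" "h \<in> Arr C"
  shows "\<phi> (Cod C h) \<cdot> word_map C t h = word_map C s h \<cdot> \<phi> (Dom C h)"
proof (rule iso_cancel_right)
  note [simp] = normal_form_word_in[OF assms(1)] normal_form_arr[OF assms(1)] assms(2)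
    normal_form_arrs[OF assms(1)]
  show "iso C (normalize C t (Dom C h))" by simp
  have "\<phi> (Cod C h) \<cdot> (word_map C t h \<cdot> normalize C t (Dom C h))
      = \<phi> (Cod C h) \<cdot> (normalize C t (Cod C h) \<cdot> (Idn C (word_obj C t) \<otimes> h))"
    by (simp add: normalize_natural)
  also have "\<dots> = normalize C s (Cod C h) \<cdot> ((f \<otimes> Idn C (Cod C h)) \<cdot> (Idn C (word_obj C t) \<otimes> h))"
    by (subst comp_cong_tail2[OF normal_form_eq[OF assms(1), symmetric]]) simp_all
  also have "\<dots> = normalize C s (Cod C h) \<cdot> ((Idn C (word_obj C s) \<otimes> h) \<cdot> (f \<otimes> Idn C (Dom C h)))"
    by (simp add: tensor_merge)
  also have "\<dots> = word_map C s h \<cdot> (normalize C s (Dom C h) \<cdot> (f \<otimes> Idn C (Dom C h)))"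
    by (subst comp_cong_tail2[OF normalize_natural]) simp_all
  also have "\<dots> = word_map C s h \<cdot> (\<phi> (Dom C h) \<cdot> normalize C t (Dom C h))"
    by (simp add: normal_form_eq[OF assms(1)])
  finally show "(\<phi> (Cod C h) \<cdot> word_map C t h) \<cdot> normalize C t (Dom C h)
      = (word_map C s h \<cdot> \<phi> (Dom C h)) \<cdot> normalize C t (Dom C h)"
    by simp
qed (use normal_form_arrs[OF assms(1)] assms(2) normal_form_word_in[OF assms(1)] in simp_all)

lemma normal_form_Idn:
  "word_in C t \<Longrightarrow> normal_form C t t (Idn C (word_obj C t)) (\<lambda>w. Idn C (word_act C t w))"
  by (rule normal_formI) simp_all

lemma normal_form_comp:
  assumes "normal_form C s r g \<psi>" "normal_form C t s f \<phi>"
  shows "normal_form C t r (g \<cdot> f) (\<lambda>w. \<psi> w \<cdot> \<phi> w)"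
proof (rule normal_formI)
  note [simp] = normal_form_word_in[OF assms(1)] normal_form_arr[OF assms(1)] normal_form_arrs[OF assms(1)]
    normal_form_word_in[OF assms(2)] normal_form_arr[OF assms(2)] normal_form_arrs[OF assms(2)]
  fix w assume [simp]: "w \<in> Obj C"
  have "normalize C r w \<cdot> ((g \<cdot> f) \<otimes> Idn C w) = normalize C r w \<cdot> ((g \<otimes> Idn C w) \<cdot> (f \<otimes> Idn C w))"
    by (simp add: tensor_merge)
  also have "\<dots> = \<psi> w \<cdot> (normalize C s w \<cdot> (f \<otimes> Idn C w))"
    by (subst comp_cong_tail2[OF normal_form_eq[OF assms(1)]]) simp_all
  also have "\<dots> = \<psi> w \<cdot> (\<phi> w \<cdot> normalize C t w)"
    by (simp add: normal_form_eq[OF assms(2)])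
  finally show "normalize C r w \<cdot> ((g \<cdot> f) \<otimes> Idn C w) = (\<psi> w \<cdot> \<phi> w) \<cdot> normalize C t w"
    by simp
qed (use normal_form_word_in[OF assms(1)] normal_form_arr[OF assms(1)] normal_form_arrs[OF assms(1)]
    normal_form_word_in[OF assms(2)] normal_form_arr[OF assms(2)] normal_form_arrs[OF assms(2)] in simp_all)

lemma normal_form_inv:
  assumes "normal_form C t s f \<phi>" "iso C f" "\<And>w. w \<in> Obj C \<Longrightarrow> inverse_arrs C (\<phi> w) (\<psi> w)"
  shows "normal_form C s t (inv_arr C f) \<psi>"
proof (rule normal_formI)
  note [simp] = normal_form_word_in[OF assms(1)] normal_form_arr[OF assms(1)] normal_form_arrs[OF assms(1)]
    assms(2) inverse_arrsD[OF assms(3)]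
  fix w assume [simp]: "w \<in> Obj C"
  have "\<psi> w \<cdot> normalize C s w
      = \<psi> w \<cdot> (normalize C s w \<cdot> ((f \<otimes> Idn C w) \<cdot> (inv_arr C f \<otimes> Idn C w)))"
    by (simp add: tensor_merge)
  also have "\<dots> = \<psi> w \<cdot> (\<phi> w \<cdot> (normalize C t w \<cdot> (inv_arr C f \<otimes> Idn C w)))"
    by (subst comp_cong_tail2[OF normal_form_eq[OF assms(1)]]) simp_all
  also have "\<dots> = normalize C t w \<cdot> (inv_arr C f \<otimes> Idn C w)"
    by (subst comp_cong_tail[OF inverse_arrsD(5)[OF assms(3)]]) simp_all
  finally show "normalize C t w \<cdot> (inv_arr C f \<otimes> Idn C w) = \<psi> w \<cdot> normalize C s w" ..
qed (use normal_form_word_in[OF assms(1)] normal_form_arr[OF assms(1)] normal_form_arrs[OF assms(1)]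
    assms(2) inverse_arrsD[OF assms(3)] in simp_all)

text \<open>Factor \<open>f \<otimes> g\<close> as \<open>g\<close> followed by \<open>f\<close>:
  first \<open>g\<close> acts behind the untouched word \<open>t\<close>, and then \<open>f\<close>
  acts with \<open>word_act C s' w\<close> as its tail.\<close>

lemma normal_form_tensor:
  assumes "normal_form C t s f \<phi>" "normal_form C t' s' g \<psi>"
  shows "normal_form C (Join t t') (Join s s') (f \<otimes> g) (\<lambda>w. \<phi> (word_act C s' w) \<cdot> word_map C t (\<psi> w))"
proof (rule normal_formI)
  note [simp] = normal_form_word_in[OF assms(1)] normal_form_arr[OF assms(1)] normal_form_arrs[OF assms(1)]
    normal_form_word_in[OF assms(2)] normal_form_arr[OF assms(2)] normal_form_arrs[OF assms(2)]
  fix w assume [simp]: "w \<in> Obj C"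
  let ?t = "word_obj C t" and ?t' = "word_obj C t'" and ?s = "word_obj C s" and ?s' = "word_obj C s'"
  have "normalize C (Join s s') w \<cdot> ((f \<otimes> g) \<otimes> Idn C w)
      = normalize C s (word_act C s' w) \<cdot> ((Idn C ?s \<otimes> normalize C s' w) \<cdot> ((f \<otimes> (g \<otimes> Idn C w)) \<cdot> Asc C ?t ?t' w))"
    using asc_natural[of f g "Idn C w"] by simp
  also have "\<dots> = normalize C s (word_act C s' w) \<cdot> ((f \<otimes> (\<psi> w \<cdot> normalize C t' w)) \<cdot> Asc C ?t ?t' w)"
    by (simp add: tensor_merge normal_form_eq[OF assms(2)])
  also have "\<dots> = normalize C s (word_act C s' w) \<cdot> ((f \<otimes> Idn C (word_act C s' w))
      \<cdot> ((Idn C ?t \<otimes> \<psi> w) \<cdot> ((Idn C ?t \<otimes> normalize C t' w) \<cdot> Asc C ?t ?t' w)))"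
    by (simp add: tensor_merge)
  also have "\<dots> = \<phi> (word_act C s' w) \<cdot> (normalize C t (word_act C s' w)
      \<cdot> ((Idn C ?t \<otimes> \<psi> w) \<cdot> ((Idn C ?t \<otimes> normalize C t' w) \<cdot> Asc C ?t ?t' w)))"
    by (subst comp_cong_tail2[OF normal_form_eq[OF assms(1)]]) simp_all
  also have "\<dots> = \<phi> (word_act C s' w) \<cdot> (word_map C t (\<psi> w) \<cdot> normalize C (Join t t') w)"
    using comp_cong_tail2[OF normalize_natural[of t "\<psi> w"],
        of "(Idn C ?t \<otimes> normalize C t' w) \<cdot> Asc C ?t ?t' w"] by simp
  finally show "normalize C (Join s s') w \<cdot> ((f \<otimes> g) \<otimes> Idn C w)
      = (\<phi> (word_act C s' w) \<cdot> word_map C t (\<psi> w)) \<cdot> normalize C (Join t t') w"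
    by simp
qed (use normal_form_word_in[OF assms(1)] normal_form_arr[OF assms(1)] normal_form_arrs[OF assms(1)]
    normal_form_word_in[OF assms(2)] normal_form_arr[OF assms(2)] normal_form_arrs[OF assms(2)] in simp_all)

text \<open>The two bracketings have the same normal form, and the pentagon with \<open>w\<close> as
  fourth object says that their normalizations differ by exactly the associator.\<close>

lemma normal_form_asc:
  assumes [simp]: "word_in C t" "word_in C s" "word_in C r"
  shows "normal_form C (Join (Join t s) r) (Join t (Join s r))
    (Asc C (word_obj C t) (word_obj C s) (word_obj C r))
    (\<lambda>w. Idn C (word_act C t (word_act C s (word_act C r w))))"
proof (rule normal_formI)
  fix w assume [simp]: "w \<in> Obj C"
  let ?t = "word_obj C t" and ?s = "word_obj C s" and ?r = "word_obj C r"
  let ?nt = "normalize C t (word_act C s (word_act C r w))"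
    and ?ns = "normalize C s (word_act C r w)" and ?nr = "normalize C r w"
  have "normalize C (Join t (Join s r)) w \<cdot> (Asc C ?t ?s ?r \<otimes> Idn C w)
      = ?nt \<cdot> ((Idn C ?t \<otimes> (?ns \<cdot> (Idn C ?s \<otimes> ?nr))) \<cdot> ((Idn C ?t \<otimes> Asc C ?s ?r w)
        \<cdot> (Asc C ?t (?s \<odot> ?r) w \<cdot> (Asc C ?t ?s ?r \<otimes> Idn C w))))"
    by (simp add: tensor_merge)
  also have "\<dots> = ?nt \<cdot> ((Idn C ?t \<otimes> (?ns \<cdot> (Idn C ?s \<otimes> ?nr)))
      \<cdot> (Asc C ?t ?s (?r \<odot> w) \<cdot> Asc C (?t \<odot> ?s) ?r w))"
    by (simp add: pentagon)
  also have "\<dots> = ?nt \<cdot> ((Idn C ?t \<otimes> ?ns) \<cdot> ((Idn C ?t \<otimes> (Idn C ?s \<otimes> ?nr))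
      \<cdot> (Asc C ?t ?s (?r \<odot> w) \<cdot> Asc C (?t \<odot> ?s) ?r w)))"
    by (simp add: tensor_merge)
  also have "\<dots> = ?nt \<cdot> ((Idn C ?t \<otimes> ?ns) \<cdot> (Asc C ?t ?s (word_act C r w)
      \<cdot> ((Idn C (?t \<odot> ?s) \<otimes> ?nr) \<cdot> Asc C (?t \<odot> ?s) ?r w)))"
    using comp_cong_tail2[OF asc_natural[of "Idn C ?t" "Idn C ?s" ?nr], of "Asc C (?t \<odot> ?s) ?r w"] by simp
  also have "\<dots> = normalize C (Join (Join t s) r) w" by simp
  finally show "normalize C (Join t (Join s r)) w \<cdot> (Asc C ?t ?s ?r \<otimes> Idn C w)
    = Idn C (word_act C t (word_act C s (word_act C r w))) \<cdot> normalize C (Join (Join t s) r) w"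
    by simp
qed simp_all

lemma normal_form_asc_inv:
  assumes [simp]: "word_in C t" "word_in C s" "word_in C r"
  shows "normal_form C (Join t (Join s r)) (Join (Join t s) r)
    (inv_arr C (Asc C (word_obj C t) (word_obj C s) (word_obj C r)))
    (\<lambda>w. Idn C (word_act C t (word_act C s (word_act C r w))))"
  by (rule normal_form_inv[OF normal_form_asc]) (simp_all add: inverse_arrs_Idn)

text \<open>Here \<open>lun_tensor\<close> enters, because the unit stands in front of both
  \<open>t\<close> and the tail. For \<open>RUn\<close> the triangle axiom itself does this
  work.\<close>

lemma normal_form_lun:
  assumes [simp]: "word_in C t"
  shows "normal_form C (Join Empty t) t (LUn C (word_obj C t)) (\<lambda>w. Idn C (word_act C t w))"
proof (rule normal_formI)
  fix w assume [simp]: "w \<in> Obj C"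
  have "normalize C (Join Empty t) w
      = (LUn C (word_act C t w) \<cdot> (Idn C (Uni C) \<otimes> normalize C t w)) \<cdot> Asc C (Uni C) (word_obj C t) w"
    by simp
  also have "\<dots> = normalize C t w \<cdot> (LUn C (word_obj C t \<odot> w) \<cdot> Asc C (Uni C) (word_obj C t) w)"
    by (subst lun_nat[of _ "word_obj C t \<odot> w"]) simp_all
  finally show "normalize C t w \<cdot> (LUn C (word_obj C t) \<otimes> Idn C w)
      = Idn C (word_act C t w) \<cdot> normalize C (Join Empty t) w"
    by (simp add: lun_tensor)
qed simp_all

lemma normal_form_lun_inv:
  assumes [simp]: "word_in C t"
  shows "normal_form C t (Join Empty t) (inv_arr C (LUn C (word_obj C t))) (\<lambda>w. Idn C (word_act C t w))"
  by (rule normal_form_inv[OF normal_form_lun]) (simp_all add: inverse_arrs_Idn)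

lemma normal_form_run:
  assumes [simp]: "word_in C t"
  shows "normal_form C (Join t Empty) t (RUn C (word_obj C t)) (\<lambda>w. Idn C (word_act C t w))"
  by (rule normal_formI) (simp_all add: triangle)

end


section \<open>The interchange of a braided monoidal category\<close>

context braided_monoidal_category
begin

declare brd_iso [simp]

lemma brd_simps [simp]:
  assumes "a \<in> Obj C" "b \<in> Obj C"
  shows "Brd C a b \<in> Arr C" "Dom C (Brd C a b) = a \<odot> b" "Cod C (Brd C a b) = b \<odot> a"
  using brd_hom[OF assms] by auto

lemma brd_natural:
  "f \<in> Arr C \<Longrightarrow> g \<in> Arr C \<Longrightarrow>
    Brd C (Cod C f) (Cod C g) \<cdot> (f \<otimes> g) = (g \<otimes> f) \<cdot> Brd C (Dom C f) (Dom C g)"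
  by (rule brd_nat) simp_all

text \<open>The braiding seen between normal forms. Unlike the associators and unit constraints it
  does not become an identity in general.\<close>

definition crossing :: "'a word \<Rightarrow> 'a word \<Rightarrow> 'a \<Rightarrow> 'b" where
  "crossing t s w = normalize C (Join s t) w \<cdot> (Brd C (word_obj C t) (word_obj C s) \<otimes> Idn C w)
     \<cdot> inv_arr C (normalize C (Join t s) w)"

lemma normal_form_brd:
  "word_in C t \<Longrightarrow> word_in C s \<Longrightarrow>
    normal_form C (Join t s) (Join s t) (Brd C (word_obj C t) (word_obj C s)) (crossing t s)"
  using normal_form_exists[of "Join t s" "Join s t" "Brd C (word_obj C t) (word_obj C s)"]
  unfolding crossing_def by simp

lemma crossing_simps [simp]:
  assumes "word_in C t" "word_in C s" "w \<in> Obj C"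
  shows "crossing t s w \<in> Arr C" "Dom C (crossing t s w) = word_act C t (word_act C s w)"
    "Cod C (crossing t s w) = word_act C s (word_act C t w)"
  using normal_form_arrs[OF normal_form_brd[OF assms(1,2)] assms(3)] by simp_all

lemma crossing_iso [simp]:
  assumes [simp]: "word_in C t" "word_in C s" "w \<in> Obj C"
  shows "iso C (crossing t s w)"
proof -
  have 1: "iso C (normalize C (Join s t) w)" "iso C (normalize C (Join t s) w)"
    by (rule normalize_iso; simp)+
  show ?thesis
    unfolding crossing_def by (intro iso_comp iso_tensor iso_inv 1) (simp_all del: normalize.simps)
qed

lemma crossing_natural:
  assumes "word_in C t" "word_in C s" "h \<in> Arr C"
  shows "crossing t s (Cod C h) \<cdot> word_map C t (word_map C s h)
    = word_map C s (word_map C t h) \<cdot> crossing t s (Dom C h)"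
  using normal_form_natural[OF normal_form_brd[OF assms(1,2)] assms(3)] by simp

text \<open>The first hexagon after its associators have become identities: \<open>t\<close> passes
  \<open>s\<close> first and then \<open>r\<close>.\<close>

lemma crossing_Join_right:
  assumes [simp]: "word_in C t" "word_in C s" "word_in C r" "w \<in> Obj C"
  shows "crossing t (Join s r) w = word_map C s (crossing t r w) \<cdot> crossing t s (word_act C r w)"
proof -
  let ?t = "word_obj C t" and ?s = "word_obj C s" and ?r = "word_obj C r"
  \<comment> \<open>Each side of the hexagon receives its normal form. The identities stay in place
    because \<open>normal_form_comp\<close> and \<open>normal_form_tensor\<close> produce exactly
    this shape; the final \<open>simp\<close> erases them.\<close>
  have 1: "normal_form C (Join (Join t s) r) (Join s (Join r t))
      (Asc C ?s ?r ?t \<cdot> Brd C ?t (?s \<odot> ?r) \<cdot> Asc C ?t ?s ?r)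
      (\<lambda>w. Idn C (word_act C s (word_act C r (word_act C t w)))
        \<cdot> (crossing t (Join s r) w \<cdot> Idn C (word_act C t (word_act C s (word_act C r w)))))"
    by (rule normal_form_comp[OF normal_form_asc
          normal_form_comp[OF normal_form_brd[of t "Join s r", simplified] normal_form_asc]]) simp_all
  have 2: "normal_form C (Join (Join t s) r) (Join s (Join r t))
      ((Idn C ?s \<otimes> Brd C ?t ?r) \<cdot> Asc C ?s ?t ?r \<cdot> (Brd C ?t ?s \<otimes> Idn C ?r))
      (\<lambda>w. (Idn C (word_act C s (word_act C (Join r t) w)) \<cdot> word_map C s (crossing t r w))
        \<cdot> (Idn C (word_act C s (word_act C t (word_act C r w)))
        \<cdot> (crossing t s (word_act C r w) \<cdot> word_map C (Join t s) (Idn C (word_act C r w)))))"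
    by (rule normal_form_comp[OF normal_form_tensor[OF normal_form_Idn normal_form_brd]
          normal_form_comp[OF normal_form_asc normal_form_tensor[OF normal_form_brd normal_form_Idn]]]) simp_all
  show ?thesis
    using normal_form_determined[OF 1 2 hexagon1[of ?t ?s ?r] assms(4)] by simp
qed

text \<open>The second hexagon, read in the same way: \<open>s\<close> passes \<open>r\<close>
  first, and then \<open>t\<close> does.\<close>

lemma crossing_Join_left:
  assumes [simp]: "word_in C t" "word_in C s" "word_in C r" "w \<in> Obj C"
  shows "crossing (Join t s) r w = crossing t r (word_act C s w) \<cdot> word_map C t (crossing s r w)"
proof -
  let ?t = "word_obj C t" and ?s = "word_obj C s" and ?r = "word_obj C r"
  have 1: "normal_form C (Join t (Join s r)) (Join (Join r t) s)
      (inv_arr C (Asc C ?r ?t ?s) \<cdot> Brd C (?t \<odot> ?s) ?r \<cdot> inv_arr C (Asc C ?t ?s ?r))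
      (\<lambda>w. Idn C (word_act C r (word_act C t (word_act C s w)))
        \<cdot> (crossing (Join t s) r w \<cdot> Idn C (word_act C t (word_act C s (word_act C r w)))))"
    by (rule normal_form_comp[OF normal_form_asc_inv
          normal_form_comp[OF normal_form_brd[of "Join t s" r, simplified] normal_form_asc_inv]]) simp_all
  have 2: "normal_form C (Join t (Join s r)) (Join (Join r t) s)
      ((Brd C ?t ?r \<otimes> Idn C ?s) \<cdot> inv_arr C (Asc C ?t ?r ?s) \<cdot> (Idn C ?t \<otimes> Brd C ?s ?r))
      (\<lambda>w. (crossing t r (word_act C s w) \<cdot> word_map C (Join t r) (Idn C (word_act C s w)))
        \<cdot> (Idn C (word_act C t (word_act C r (word_act C s w)))
        \<cdot> (Idn C (word_act C t (word_act C (Join r s) w)) \<cdot> word_map C t (crossing s r w))))"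
    by (rule normal_form_comp[OF normal_form_tensor[OF normal_form_brd normal_form_Idn]
          normal_form_comp[OF normal_form_asc_inv normal_form_tensor[OF normal_form_Idn normal_form_brd]]]) simp_all
  show ?thesis
    using normal_form_determined[OF 1 2 hexagon2[of ?t ?s ?r] assms(4)] by simp
qed

text \<open>Naturality identifies the crossing \<open>e\<close> past \<open>I\<close> with the one past \<open>I \<otimes> I\<close>, which a
  hexagon computes as \<open>e \<cdot> e\<close>.\<close>

lemma crossing_Empty_right:
  assumes [simp]: "word_in C t" "w \<in> Obj C"
  shows "crossing t Empty w = Idn C (word_act C t w)"
proof -
  let ?t = "word_obj C t" and ?E = "Join Empty Empty :: 'a word"
  have 1: "normal_form C (Join t ?E) (Join Empty t) (Brd C ?t (Uni C) \<cdot> (Idn C ?t \<otimes> LUn C (Uni C)))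
      (crossing t Empty)"
    by (rule normal_form_cong[OF normal_form_comp[OF normal_form_brd[of t Empty, simplified]
          normal_form_tensor[OF normal_form_Idn normal_form_lun[of Empty, simplified]]]]) simp_all
  have 2: "normal_form C (Join t ?E) (Join Empty t) ((LUn C (Uni C) \<otimes> Idn C ?t) \<cdot> Brd C ?t (Uni C \<odot> Uni C))
      (crossing t ?E)"
    by (rule normal_form_cong[OF normal_form_comp[OF normal_form_tensor[OF normal_form_lun[of Empty, simplified] normal_form_Idn]
          normal_form_brd[of t ?E, simplified]]]) simp_all
  have 3: "Brd C ?t (Uni C) \<cdot> (Idn C ?t \<otimes> LUn C (Uni C)) = (LUn C (Uni C) \<otimes> Idn C ?t) \<cdot> Brd C ?t (Uni C \<odot> Uni C)"
    using brd_natural[of "Idn C ?t" "LUn C (Uni C)"] by simp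
  have "crossing t Empty w = crossing t ?E w"
    using normal_form_determined[OF 1 2 3 assms(2)] by simp
  then have "crossing t Empty w \<cdot> Idn C (word_act C t w) = crossing t Empty w \<cdot> crossing t Empty w"
    using crossing_Join_right[of t Empty Empty w] by simp
  \<comment> \<open>An invertible idempotent is an identity.\<close>
  then show ?thesis
    by (rule iso_cancel_left[rotated, THEN sym]) simp_all
qed

lemma crossing_Empty_left:
  assumes [simp]: "word_in C t" "w \<in> Obj C"
  shows "crossing Empty t w = Idn C (word_act C t w)"
proof -
  let ?t = "word_obj C t" and ?E = "Join Empty Empty :: 'a word"
  have 1: "normal_form C (Join ?E t) (Join t Empty) (Brd C (Uni C) ?t \<cdot> (LUn C (Uni C) \<otimes> Idn C ?t))
      (crossing Empty t)"
    by (rule normal_form_cong[OF normal_form_comp[OF normal_form_brd[of Empty t, simplified]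
          normal_form_tensor[OF normal_form_lun[of Empty, simplified] normal_form_Idn]]]) simp_all
  have 2: "normal_form C (Join ?E t) (Join t Empty) ((Idn C ?t \<otimes> LUn C (Uni C)) \<cdot> Brd C (Uni C \<odot> Uni C) ?t)
      (crossing ?E t)"
    by (rule normal_form_cong[OF normal_form_comp[OF normal_form_tensor[OF normal_form_Idn normal_form_lun[of Empty, simplified]]
          normal_form_brd[of ?E t, simplified]]]) simp_all
  have 3: "Brd C (Uni C) ?t \<cdot> (LUn C (Uni C) \<otimes> Idn C ?t) = (Idn C ?t \<otimes> LUn C (Uni C)) \<cdot> Brd C (Uni C \<odot> Uni C) ?t"
    using brd_natural[of "LUn C (Uni C)" "Idn C ?t"] by simp
  have "crossing Empty t w = crossing ?E t w"
    using normal_form_determined[OF 1 2 3 assms(2)] by simp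
  then have "crossing Empty t w \<cdot> Idn C (word_act C t w) = crossing Empty t w \<cdot> crossing Empty t w"
    using crossing_Join_left[of Empty Empty t w] by simp
  then show ?thesis
    by (rule iso_cancel_left[rotated, THEN sym]) simp_all
qed

lemma interchange_simps [simp]:
  assumes "a \<in> Obj C" "b \<in> Obj C" "c \<in> Obj C" "d \<in> Obj C"
  shows "interchange C a b c d \<in> Arr C" "Dom C (interchange C a b c d) = (a \<odot> b) \<odot> (c \<odot> d)"
    "Cod C (interchange C a b c d) = (a \<odot> c) \<odot> (b \<odot> d)"
  using assms by (simp_all add: interchange_def)

text \<open>The associators disappear. What is left is \<open>s\<close> crossing \<open>r\<close>,
  behind \<open>t\<close> and with \<open>q\<close> absorbed into the tail.\<close>

lemma normal_form_interchange:
  assumes [simp]: "word_in C t" "word_in C s" "word_in C r" "word_in C q"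
  shows "normal_form C (Join (Join t s) (Join r q)) (Join (Join t r) (Join s q))
    (interchange C (word_obj C t) (word_obj C s) (word_obj C r) (word_obj C q))
    (\<lambda>w. word_map C t (crossing s r (word_act C q w)))"
  unfolding interchange_def
  by (rule normal_form_cong[OF normal_form_comp[OF normal_form_asc_inv[of t r "Join s q", simplified]
      normal_form_comp[OF normal_form_tensor[OF normal_form_Idn[of t] normal_form_comp[OF normal_form_asc[of r s q]
        normal_form_comp[OF normal_form_tensor[OF normal_form_brd[of s r] normal_form_Idn[of q]]
          normal_form_asc_inv[of s r q]]]]
      normal_form_asc[of t s "Join r q", simplified]]]]) simp_all

text \<open>On one side \<open>a'\<close> first passes \<open>b\<close>, and then \<open>a'\<close>
  and \<open>b'\<close> together pass \<open>c\<close>; on the other \<open>b'\<close> first passes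
  \<open>c\<close>, and then \<open>a'\<close> passes \<open>b\<close> and \<open>c\<close>
  together. The hexagons split the joint crossings, and the two orders agree because
  \<open>a'\<close> past \<open>b\<close> and \<open>b'\<close> past \<open>c\<close> act on
  disjoint factors.\<close>

lemma interchange_assoc:
  assumes [simp]: "a \<in> Obj C" "a' \<in> Obj C" "b \<in> Obj C" "b' \<in> Obj C" "c \<in> Obj C" "c' \<in> Obj C"
  shows "(Asc C a b c \<otimes> Asc C a' b' c') \<cdot> interchange C (a \<odot> b) (a' \<odot> b') c c'
      \<cdot> (interchange C a a' b b' \<otimes> Idn C (c \<odot> c'))
    = interchange C a a' (b \<odot> c) (b' \<odot> c') \<cdot> (Idn C (a \<odot> a') \<otimes> interchange C b b' c c')
      \<cdot> Asc C (a \<odot> a') (b \<odot> b') (c \<odot> c')"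
proof (rule normal_form_unique)
  let ?a = "Letter a" and ?a' = "Letter a'" and ?b = "Letter b" and ?b' = "Letter b'"
    and ?c = "Letter c" and ?c' = "Letter c'"
  show "normal_form C (Join (Join (Join ?a ?a') (Join ?b ?b')) (Join ?c ?c'))
      (Join (Join ?a (Join ?b ?c)) (Join ?a' (Join ?b' ?c')))
      ((Asc C a b c \<otimes> Asc C a' b' c') \<cdot> interchange C (a \<odot> b) (a' \<odot> b') c c'
        \<cdot> (interchange C a a' b b' \<otimes> Idn C (c \<odot> c')))
      (\<lambda>w. word_map C ?a (word_map C ?b (crossing (Join ?a' ?b') ?c (c' \<odot> w)))
        \<cdot> word_map C ?a (crossing ?a' ?b (b' \<odot> c \<odot> c' \<odot> w)))"
    by (rule normal_form_cong[OF normal_form_comp[OF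
          normal_form_tensor[OF normal_form_asc[of ?a ?b ?c, simplified] normal_form_asc[of ?a' ?b' ?c', simplified]]
          normal_form_comp[OF normal_form_interchange[of "Join ?a ?b" "Join ?a' ?b'" ?c ?c', simplified]
            normal_form_tensor[OF normal_form_interchange[of ?a ?a' ?b ?b', simplified]
              normal_form_Idn[of "Join ?c ?c'", simplified]]]]])
      simp_all
  show "normal_form C (Join (Join (Join ?a ?a') (Join ?b ?b')) (Join ?c ?c'))
      (Join (Join ?a (Join ?b ?c)) (Join ?a' (Join ?b' ?c')))
      (interchange C a a' (b \<odot> c) (b' \<odot> c') \<cdot> (Idn C (a \<odot> a') \<otimes> interchange C b b' c c')
        \<cdot> Asc C (a \<odot> a') (b \<odot> b') (c \<odot> c'))
      (\<lambda>w. word_map C ?a (crossing ?a' (Join ?b ?c) (b' \<odot> c' \<odot> w))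
        \<cdot> word_map C ?a (word_map C ?a' (word_map C ?b (crossing ?b' ?c (c' \<odot> w)))))"
    by (rule normal_form_cong[OF normal_form_comp[OF
          normal_form_interchange[of ?a ?a' "Join ?b ?c" "Join ?b' ?c'", simplified]
          normal_form_comp[OF normal_form_tensor[OF normal_form_Idn[of "Join ?a ?a'", simplified]
              normal_form_interchange[of ?b ?b' ?c ?c', simplified]]
            normal_form_asc[of "Join ?a ?a'" "Join ?b ?b'" "Join ?c ?c'", simplified]]]])
      simp_all
next
  fix w assume [simp]: "w \<in> Obj C"
  let ?a = "Letter a" and ?a' = "Letter a'" and ?b = "Letter b" and ?b' = "Letter b'"
    and ?c = "Letter c" and ?c' = "Letter c'"
  let ?x = "crossing ?b' ?c (c' \<odot> w)"
  have "word_map C ?b (crossing (Join ?a' ?b') ?c (c' \<odot> w)) \<cdot> crossing ?a' ?b (b' \<odot> c \<odot> c' \<odot> w)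
      = word_map C ?b (crossing ?a' ?c (b' \<odot> c' \<odot> w))
        \<cdot> (word_map C ?b (word_map C ?a' ?x) \<cdot> crossing ?a' ?b (b' \<odot> c \<odot> c' \<odot> w))"
    by (simp add: crossing_Join_left tensor_merge)
  \<comment> \<open>Naturality in the tail slides \<open>?x\<close>, the crossing of
    \<open>b'\<close> and \<open>c\<close>, past the crossing of \<open>a'\<close> and
    \<open>b\<close>.\<close>
  also have "\<dots> = word_map C ?b (crossing ?a' ?c (b' \<odot> c' \<odot> w))
        \<cdot> (crossing ?a' ?b (c \<odot> b' \<odot> c' \<odot> w) \<cdot> word_map C ?a' (word_map C ?b ?x))"
    using crossing_natural[of ?a' ?b ?x] by simp
  also have "\<dots> = crossing ?a' (Join ?b ?c) (b' \<odot> c' \<odot> w) \<cdot> word_map C ?a' (word_map C ?b ?x)"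
    by (simp add: crossing_Join_right)
  finally show "word_map C ?a (word_map C ?b (crossing (Join ?a' ?b') ?c (c' \<odot> w)))
        \<cdot> word_map C ?a (crossing ?a' ?b (b' \<odot> c \<odot> c' \<odot> w))
      = word_map C ?a (crossing ?a' (Join ?b ?c) (b' \<odot> c' \<odot> w))
        \<cdot> word_map C ?a (word_map C ?a' (word_map C ?b ?x))"
    by (simp add: tensor_merge)
qed

text \<open>The only crossing in this interchange moves the unit past \<open>a\<close>, so in normal
  form it is an identity like all the other factors.\<close>

lemma interchange_lunit:
  assumes [simp]: "a \<in> Obj C" "b \<in> Obj C"
  shows "(LUn C a \<otimes> LUn C b) \<cdot> interchange C (Uni C) (Uni C) a b
    \<cdot> (inv_arr C (LUn C (Uni C)) \<otimes> Idn C (a \<odot> b)) = LUn C (a \<odot> b)"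
  by (rule normal_form_unique[OF normal_form_comp[OF
        normal_form_tensor[OF normal_form_lun[of "Letter a", simplified] normal_form_lun[of "Letter b", simplified]]
        normal_form_comp[OF normal_form_interchange[of Empty Empty "Letter a" "Letter b", simplified]
          normal_form_tensor[OF normal_form_lun_inv[of Empty, simplified]
            normal_form_Idn[of "Join (Letter a) (Letter b)", simplified]]]]
        normal_form_lun[of "Join (Letter a) (Letter b)", simplified]])
    (simp add: crossing_Empty_left)

lemma interchange_runit:
  assumes [simp]: "a \<in> Obj C" "b \<in> Obj C"
  shows "(RUn C a \<otimes> RUn C b) \<cdot> interchange C a b (Uni C) (Uni C)
    \<cdot> (Idn C (a \<odot> b) \<otimes> inv_arr C (LUn C (Uni C))) = RUn C (a \<odot> b)"
  by (rule normal_form_unique[OF normal_form_comp[OF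
        normal_form_tensor[OF normal_form_run[of "Letter a", simplified] normal_form_run[of "Letter b", simplified]]
        normal_form_comp[OF normal_form_interchange[of "Letter a" "Letter b" Empty Empty, simplified]
          normal_form_tensor[OF normal_form_Idn[of "Join (Letter a) (Letter b)", simplified]
            normal_form_lun_inv[of Empty, simplified]]]]
        normal_form_run[of "Join (Letter a) (Letter b)", simplified]])
    (simp add: crossing_Empty_right)

lemma asc_inv_natural:
  assumes [simp]: "f \<in> Arr C" "g \<in> Arr C" "h \<in> Arr C"
  shows "inv_arr C (Asc C (Cod C f) (Cod C g) (Cod C h)) \<cdot> (f \<otimes> (g \<otimes> h))
      = ((f \<otimes> g) \<otimes> h) \<cdot> inv_arr C (Asc C (Dom C f) (Dom C g) (Dom C h))"
  using asc_natural[OF assms] by (intro inv_square) simp_all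

lemma interchange_natural:
  assumes [simp]: "f \<in> Arr C" "g \<in> Arr C" "h \<in> Arr C" "k \<in> Arr C"
  shows "interchange C (Cod C f) (Cod C g) (Cod C h) (Cod C k) \<cdot> ((f \<otimes> g) \<otimes> (h \<otimes> k))
    = ((f \<otimes> h) \<otimes> (g \<otimes> k)) \<cdot> interchange C (Dom C f) (Dom C g) (Dom C h) (Dom C k)"
proof -
  \<comment> \<open>The middle of the interchange, which takes \<open>b\<close> past
    \<open>c\<close> inside the leading factor. Its naturality is proved first and then carried
    through the outer associators.\<close>
  define m where "m = (\<lambda>b c d. Asc C c b d \<cdot> (Brd C b c \<otimes> Idn C d) \<cdot> inv_arr C (Asc C b c d))"
  have m_simps [simp]: "m b c d \<in> Arr C" "Dom C (m b c d) = b \<odot> (c \<odot> d)" "Cod C (m b c d) = c \<odot> (b \<odot> d)"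
    if "b \<in> Obj C" "c \<in> Obj C" "d \<in> Obj C" for b c d
    using that by (simp_all add: m_def)
  have int: "interchange C a b c d = inv_arr C (Asc C a c (b \<odot> d)) \<cdot> (Idn C a \<otimes> m b c d) \<cdot> Asc C a b (c \<odot> d)"
    for a b c d by (simp add: interchange_def m_def)
  have "m (Cod C g) (Cod C h) (Cod C k) \<cdot> (g \<otimes> (h \<otimes> k))
      = Asc C (Cod C h) (Cod C g) (Cod C k) \<cdot> ((Brd C (Cod C g) (Cod C h) \<otimes> Idn C (Cod C k))
        \<cdot> (((g \<otimes> h) \<otimes> k) \<cdot> inv_arr C (Asc C (Dom C g) (Dom C h) (Dom C k))))"
    by (simp add: m_def asc_inv_natural)
  also have "\<dots> = Asc C (Cod C h) (Cod C g) (Cod C k) \<cdot> (((h \<otimes> g) \<otimes> k)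
        \<cdot> ((Brd C (Dom C g) (Dom C h) \<otimes> Idn C (Dom C k)) \<cdot> inv_arr C (Asc C (Dom C g) (Dom C h) (Dom C k))))"
    by (simp add: tensor_merge brd_natural)
  also have "\<dots> = (h \<otimes> (g \<otimes> k)) \<cdot> m (Dom C g) (Dom C h) (Dom C k)"
    by (subst comp_cong_tail2[OF asc_natural]) (simp_all add: m_def)
  finally have m: "m (Cod C g) (Cod C h) (Cod C k) \<cdot> (g \<otimes> (h \<otimes> k)) = (h \<otimes> (g \<otimes> k)) \<cdot> m (Dom C g) (Dom C h) (Dom C k)" .
  have "interchange C (Cod C f) (Cod C g) (Cod C h) (Cod C k) \<cdot> ((f \<otimes> g) \<otimes> (h \<otimes> k))
      = inv_arr C (Asc C (Cod C f) (Cod C h) (Cod C g \<odot> Cod C k)) \<cdot> ((Idn C (Cod C f) \<otimes> m (Cod C g) (Cod C h) (Cod C k))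
        \<cdot> ((f \<otimes> (g \<otimes> (h \<otimes> k))) \<cdot> Asc C (Dom C f) (Dom C g) (Dom C h \<odot> Dom C k)))"
    using asc_natural[of f g "h \<otimes> k"] by (simp add: int)
  also have "\<dots> = inv_arr C (Asc C (Cod C f) (Cod C h) (Cod C g \<odot> Cod C k)) \<cdot> ((f \<otimes> (h \<otimes> (g \<otimes> k)))
        \<cdot> ((Idn C (Dom C f) \<otimes> m (Dom C g) (Dom C h) (Dom C k)) \<cdot> Asc C (Dom C f) (Dom C g) (Dom C h \<odot> Dom C k)))"
    by (simp add: tensor_merge m)
  also have "\<dots> = ((f \<otimes> h) \<otimes> (g \<otimes> k)) \<cdot> interchange C (Dom C f) (Dom C g) (Dom C h) (Dom C k)"
    using comp_cong_tail2[OF asc_inv_natural[of f h "g \<otimes> k"],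
        of "(Idn C (Dom C f) \<otimes> m (Dom C g) (Dom C h) (Dom C k)) \<cdot> Asc C (Dom C f) (Dom C g) (Dom C h \<odot> Dom C k)"]
    by (simp add: int)
  finally show ?thesis .
qed

text \<open>Naturality of the interchange brings the compositions of \<open>E\<close> and
  \<open>E'\<close> side by side, where the axioms of the two factors apply separately. The
  remaining rearrangements of hom-objects agree by \<open>interchange_assoc\<close>,
  \<open>interchange_lunit\<close> and \<open>interchange_runit\<close>.\<close>

lemma vcat_tensor_vcategory:
  fixes E E'
  assumes "vcategory C E" "vcategory C E'"
  shows "vcategory C (vcat_tensor C E E')"
proof -
  interpret E: vcategory C E by fact
  interpret E': vcategory C E' by fact
  note [simp] = E.ehom_obj E'.ehom_obj
  have M [simp]: "ECmp E a b c \<in> Arr C" "Dom C (ECmp E a b c) = EHom E b c \<odot> EHom E a b"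
      "Cod C (ECmp E a b c) = EHom E a c" if "a \<in> EObj E" "b \<in> EObj E" "c \<in> EObj E" for a b c
    using E.ecmp_hom[OF that] by auto
  have M' [simp]: "ECmp E' a b c \<in> Arr C" "Dom C (ECmp E' a b c) = EHom E' b c \<odot> EHom E' a b"
      "Cod C (ECmp E' a b c) = EHom E' a c" if "a \<in> EObj E'" "b \<in> EObj E'" "c \<in> EObj E'" for a b c
    using E'.ecmp_hom[OF that] by auto
  have j [simp]: "EIdn E a \<in> Arr C" "Dom C (EIdn E a) = Uni C" "Cod C (EIdn E a) = EHom E a a"
    if "a \<in> EObj E" for a
    using E.eidn_hom[OF that] by auto
  have j' [simp]: "EIdn E' a \<in> Arr C" "Dom C (EIdn E' a) = Uni C" "Cod C (EIdn E' a) = EHom E' a a"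
    if "a \<in> EObj E'" for a
    using E'.eidn_hom[OF that] by auto
  have assoc: "((ECmp E a b d \<otimes> ECmp E' a' b' d') \<cdot> interchange C (EHom E b d) (EHom E' b' d') (EHom E a b) (EHom E' a' b'))
      \<cdot> (((ECmp E b c d \<otimes> ECmp E' b' c' d') \<cdot> interchange C (EHom E c d) (EHom E' c' d') (EHom E b c) (EHom E' b' c'))
        \<otimes> Idn C (EHom E a b \<odot> EHom E' a' b'))
    = ((ECmp E a c d \<otimes> ECmp E' a' c' d') \<cdot> interchange C (EHom E c d) (EHom E' c' d') (EHom E a c) (EHom E' a' c'))
      \<cdot> (Idn C (EHom E c d \<odot> EHom E' c' d')
        \<otimes> ((ECmp E a b c \<otimes> ECmp E' a' b' c') \<cdot> interchange C (EHom E b c) (EHom E' b' c') (EHom E a b) (EHom E' a' b')))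
      \<cdot> Asc C (EHom E c d \<odot> EHom E' c' d') (EHom E b c \<odot> EHom E' b' c') (EHom E a b \<odot> EHom E' a' b')"
    if [simp]: "a \<in> EObj E" "b \<in> EObj E" "c \<in> EObj E" "d \<in> EObj E"
      "a' \<in> EObj E'" "b' \<in> EObj E'" "c' \<in> EObj E'" "d' \<in> EObj E'" for a b c d a' b' c' d'
  proof -
    let ?H = "EHom E" and ?H' = "EHom E'" and ?M = "ECmp E" and ?M' = "ECmp E'"
    let ?i = "interchange C (?H c d) (?H' c' d') (?H b c) (?H' b' c')"
      and ?i' = "interchange C (?H b c) (?H' b' c') (?H a b) (?H' a' b')"
    let ?h = "Idn C (?H a b \<odot> ?H' a' b')" and ?k = "Idn C (?H c d \<odot> ?H' c' d')"
    let ?al = "Asc C (?H c d \<odot> ?H' c' d') (?H b c \<odot> ?H' b' c') (?H a b \<odot> ?H' a' b')"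
    have "((?M a b d \<otimes> ?M' a' b' d') \<cdot> interchange C (?H b d) (?H' b' d') (?H a b) (?H' a' b'))
        \<cdot> (((?M b c d \<otimes> ?M' b' c' d') \<cdot> ?i) \<otimes> ?h)
      = (?M a b d \<otimes> ?M' a' b' d') \<cdot> (interchange C (?H b d) (?H' b' d') (?H a b) (?H' a' b')
        \<cdot> (((?M b c d \<otimes> ?M' b' c' d') \<otimes> (Idn C (?H a b) \<otimes> Idn C (?H' a' b'))) \<cdot> (?i \<otimes> ?h)))"
      by (simp add: tensor_merge)
    also have "\<dots> = (?M a b d \<otimes> ?M' a' b' d') \<cdot> (((?M b c d \<otimes> Idn C (?H a b)) \<otimes> (?M' b' c' d' \<otimes> Idn C (?H' a' b')))
        \<cdot> (interchange C (?H c d \<odot> ?H b c) (?H' c' d' \<odot> ?H' b' c') (?H a b) (?H' a' b') \<cdot> (?i \<otimes> ?h)))"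
      using comp_cong_tail2[OF interchange_natural[of "?M b c d" "?M' b' c' d'" "Idn C (?H a b)" "Idn C (?H' a' b')"],
          of "?i \<otimes> ?h"] by simp
    also have "\<dots> = ((?M a c d \<otimes> ?M' a' c' d') \<cdot> (((Idn C (?H c d) \<otimes> ?M a b c) \<otimes> (Idn C (?H' c' d') \<otimes> ?M' a' b' c'))))
        \<cdot> ((Asc C (?H c d) (?H b c) (?H a b) \<otimes> Asc C (?H' c' d') (?H' b' c') (?H' a' b'))
        \<cdot> (interchange C (?H c d \<odot> ?H b c) (?H' c' d' \<odot> ?H' b' c') (?H a b) (?H' a' b') \<cdot> (?i \<otimes> ?h)))"
      by (simp add: tensor_merge E.ecmp_assoc E'.ecmp_assoc)
    also have "\<dots> = (?M a c d \<otimes> ?M' a' c' d') \<cdot> (((Idn C (?H c d) \<otimes> ?M a b c) \<otimes> (Idn C (?H' c' d') \<otimes> ?M' a' b' c'))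
        \<cdot> (interchange C (?H c d) (?H' c' d') (?H b c \<odot> ?H a b) (?H' b' c' \<odot> ?H' a' b') \<cdot> ((?k \<otimes> ?i') \<cdot> ?al)))"
      by (simp add: interchange_assoc)
    also have "\<dots> = (?M a c d \<otimes> ?M' a' c' d') \<cdot> (interchange C (?H c d) (?H' c' d') (?H a c) (?H' a' c')
        \<cdot> ((?k \<otimes> (?M a b c \<otimes> ?M' a' b' c')) \<cdot> ((?k \<otimes> ?i') \<cdot> ?al)))"
      using comp_cong_tail2[OF interchange_natural[of "Idn C (?H c d)" "Idn C (?H' c' d')" "?M a b c" "?M' a' b' c'"],
          of "(?k \<otimes> ?i') \<cdot> ?al"] by simp
    finally show ?thesis by (simp add: tensor_merge)
  qed
  have lunit: "((ECmp E a b b \<otimes> ECmp E' a' b' b') \<cdot> interchange C (EHom E b b) (EHom E' b' b') (EHom E a b) (EHom E' a' b'))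
      \<cdot> (((EIdn E b \<otimes> EIdn E' b') \<cdot> inv_arr C (LUn C (Uni C))) \<otimes> Idn C (EHom E a b \<odot> EHom E' a' b'))
    = LUn C (EHom E a b \<odot> EHom E' a' b')"
    if [simp]: "a \<in> EObj E" "b \<in> EObj E" "a' \<in> EObj E'" "b' \<in> EObj E'" for a b a' b'
  proof -
    let ?h = "Idn C (EHom E a b)" and ?h' = "Idn C (EHom E' a' b')"
    let ?l = "inv_arr C (LUn C (Uni C)) \<otimes> Idn C (EHom E a b \<odot> EHom E' a' b')"
    have "((ECmp E a b b \<otimes> ECmp E' a' b' b') \<cdot> interchange C (EHom E b b) (EHom E' b' b') (EHom E a b) (EHom E' a' b'))
        \<cdot> (((EIdn E b \<otimes> EIdn E' b') \<cdot> inv_arr C (LUn C (Uni C))) \<otimes> Idn C (EHom E a b \<odot> EHom E' a' b'))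
      = (ECmp E a b b \<otimes> ECmp E' a' b' b') \<cdot> (interchange C (EHom E b b) (EHom E' b' b') (EHom E a b) (EHom E' a' b')
        \<cdot> (((EIdn E b \<otimes> EIdn E' b') \<otimes> (?h \<otimes> ?h')) \<cdot> ?l))"
      by (simp add: tensor_merge)
    also have "\<dots> = (ECmp E a b b \<otimes> ECmp E' a' b' b') \<cdot> (((EIdn E b \<otimes> ?h) \<otimes> (EIdn E' b' \<otimes> ?h'))
        \<cdot> (interchange C (Uni C) (Uni C) (EHom E a b) (EHom E' a' b') \<cdot> ?l))"
      using comp_cong_tail2[OF interchange_natural[of "EIdn E b" "EIdn E' b'" ?h ?h'], of ?l] by simp
    finally show ?thesis
      by (simp add: tensor_merge E.ecmp_lunit E'.ecmp_lunit interchange_lunit)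
  qed
  have runit: "((ECmp E a a b \<otimes> ECmp E' a' a' b') \<cdot> interchange C (EHom E a b) (EHom E' a' b') (EHom E a a) (EHom E' a' a'))
      \<cdot> (Idn C (EHom E a b \<odot> EHom E' a' b') \<otimes> ((EIdn E a \<otimes> EIdn E' a') \<cdot> inv_arr C (LUn C (Uni C))))
    = RUn C (EHom E a b \<odot> EHom E' a' b')"
    if [simp]: "a \<in> EObj E" "b \<in> EObj E" "a' \<in> EObj E'" "b' \<in> EObj E'" for a b a' b'
  proof -
    let ?h = "Idn C (EHom E a b)" and ?h' = "Idn C (EHom E' a' b')"
    let ?l = "Idn C (EHom E a b \<odot> EHom E' a' b') \<otimes> inv_arr C (LUn C (Uni C))"
    have "((ECmp E a a b \<otimes> ECmp E' a' a' b') \<cdot> interchange C (EHom E a b) (EHom E' a' b') (EHom E a a) (EHom E' a' a'))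
        \<cdot> (Idn C (EHom E a b \<odot> EHom E' a' b') \<otimes> ((EIdn E a \<otimes> EIdn E' a') \<cdot> inv_arr C (LUn C (Uni C))))
      = (ECmp E a a b \<otimes> ECmp E' a' a' b') \<cdot> (interchange C (EHom E a b) (EHom E' a' b') (EHom E a a) (EHom E' a' a')
        \<cdot> (((?h \<otimes> ?h') \<otimes> (EIdn E a \<otimes> EIdn E' a')) \<cdot> ?l))"
      by (simp add: tensor_merge)
    also have "\<dots> = (ECmp E a a b \<otimes> ECmp E' a' a' b') \<cdot> (((?h \<otimes> EIdn E a) \<otimes> (?h' \<otimes> EIdn E' a'))
        \<cdot> (interchange C (EHom E a b) (EHom E' a' b') (Uni C) (Uni C) \<cdot> ?l))"
      using comp_cong_tail2[OF interchange_natural[of ?h ?h' "EIdn E a" "EIdn E' a'"], of ?l] by simp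
    finally show ?thesis
      by (simp add: tensor_merge E.ecmp_runit E'.ecmp_runit interchange_runit)
  qed
  show ?thesis
    by unfold_locales (auto simp: vcat_tensor_def assoc lunit runit simp del: comp_assoc_arr)
qed

end


section \<open>Transport and products of monoidal structure\<close>

text \<open>Transport of structure along a map \<open>N\<close> of arrows that fixes objects and is
  onto: arrows of \<open>M\<close> lift to \<open>A\<close> with the same domain and codomain, so
  each axiom for \<open>M\<close> is the image of one for \<open>A\<close>. It serves both for the
  underlying category of the associated \<open>\<V>\<close>-category and for
  \<open>prod_br\<close>.\<close>

locale monoidal_copy = A: monoidal_category A for A :: "('o, 'm, 'y) moncat_scheme" +
  fixes M :: "('o, 'k, 'z) moncat_scheme" and N :: "'m \<Rightarrow> 'k"
  assumes copy_Obj: "Obj M = Obj A"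
    and copy_Arr: "Arr M = N ` Arr A"
    and copy_Dom: "f \<in> Arr A \<Longrightarrow> Dom M (N f) = Dom A f"
    and copy_Cod: "f \<in> Arr A \<Longrightarrow> Cod M (N f) = Cod A f"
    and copy_Idn: "a \<in> Obj A \<Longrightarrow> Idn M a = N (Idn A a)"
    and copy_Cmp: "f \<in> Arr A \<Longrightarrow> g \<in> Arr A \<Longrightarrow> Cod A f = Dom A g \<Longrightarrow> N g \<cdot>\<^bsub>M\<^esub> N f = N (g \<cdot>\<^bsub>A\<^esub> f)"
    and copy_TObj: "a \<in> Obj A \<Longrightarrow> b \<in> Obj A \<Longrightarrow> a \<odot>\<^bsub>M\<^esub> b = a \<odot>\<^bsub>A\<^esub> b"
    and copy_TArr: "f \<in> Arr A \<Longrightarrow> g \<in> Arr A \<Longrightarrow> N f \<otimes>\<^bsub>M\<^esub> N g = N (f \<otimes>\<^bsub>A\<^esub> g)"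
    and copy_Uni: "Uni M = Uni A"
    and copy_Asc: "a \<in> Obj A \<Longrightarrow> b \<in> Obj A \<Longrightarrow> c \<in> Obj A \<Longrightarrow> Asc M a b c = N (Asc A a b c)"
    and copy_LUn: "a \<in> Obj A \<Longrightarrow> LUn M a = N (LUn A a)"
    and copy_RUn: "a \<in> Obj A \<Longrightarrow> RUn M a = N (RUn A a)"
begin

lemmas copy_simps = copy_Obj copy_Arr copy_Dom copy_Cod copy_Idn copy_Cmp copy_TObj copy_TArr
  copy_Uni copy_Asc copy_LUn copy_RUn

lemma inverse_arrs_copy:
  assumes "inverse_arrs A f g"
  shows "inverse_arrs M (N f) (N g)"
  using A.inverse_arrsD[OF assms] by (simp add: inverse_arrs_def copy_simps)

lemma iso_copy: "iso A f \<Longrightarrow> iso M (N f)"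
  by (meson A.inverse_arrs_inv inverse_arrs_copy iso_def)

lemma category_copy: "category M"
  by unfold_locales (auto simp: copy_simps)

lemma inv_arr_copy: "iso A f \<Longrightarrow> inv_arr M (N f) = N (inv_arr A f)"
  by (rule category.inv_arr_eq[OF category_copy inverse_arrs_copy[OF A.inverse_arrs_inv]])

lemma monoidal_category_copy: "monoidal_category M"
proof -
  interpret M: category M by (rule category_copy)
  show ?thesis
  proof unfold_locales
    fix a b c d
    assume "a \<in> Obj M" "b \<in> Obj M" "c \<in> Obj M" "d \<in> Obj M"
    then show "Asc M a b (c \<odot>\<^bsub>M\<^esub> d) \<cdot>\<^bsub>M\<^esub> Asc M (a \<odot>\<^bsub>M\<^esub> b) c d
        = (Idn M a \<otimes>\<^bsub>M\<^esub> Asc M b c d) \<cdot>\<^bsub>M\<^esub> Asc M a (b \<odot>\<^bsub>M\<^esub> c) d \<cdot>\<^bsub>M\<^esub> (Asc M a b c \<otimes>\<^bsub>M\<^esub> Idn M d)"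
      using A.pentagon[of a b c d] by (simp add: copy_simps)
  next
    fix a b
    assume "a \<in> Obj M" "b \<in> Obj M"
    then show "(Idn M a \<otimes>\<^bsub>M\<^esub> LUn M b) \<cdot>\<^bsub>M\<^esub> Asc M a (Uni M) b = RUn M a \<otimes>\<^bsub>M\<^esub> Idn M b"
      using A.triangle[of a b] by (simp add: copy_simps)
  next
    fix f a b g a' b'
    assume "f \<in> hom M a b" "g \<in> hom M a' b'"
    then show "f \<otimes>\<^bsub>M\<^esub> g \<in> hom M (a \<odot>\<^bsub>M\<^esub> a') (b \<odot>\<^bsub>M\<^esub> b')"
      by (auto simp: copy_simps)
  next
    fix f a b g c f' a' b' g' c'
    assume "f \<in> hom M a b" "g \<in> hom M b c" "f' \<in> hom M a' b'" "g' \<in> hom M b' c'"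
    then show "(g \<cdot>\<^bsub>M\<^esub> f) \<otimes>\<^bsub>M\<^esub> (g' \<cdot>\<^bsub>M\<^esub> f') = (g \<otimes>\<^bsub>M\<^esub> g') \<cdot>\<^bsub>M\<^esub> (f \<otimes>\<^bsub>M\<^esub> f')"
      by (auto simp: copy_simps A.tensor_comp_arr)
  next
    fix f a a' g b b' h c c'
    assume "f \<in> hom M a a'" "g \<in> hom M b b'" "h \<in> hom M c c'"
    then show "Asc M a' b' c' \<cdot>\<^bsub>M\<^esub> ((f \<otimes>\<^bsub>M\<^esub> g) \<otimes>\<^bsub>M\<^esub> h) = (f \<otimes>\<^bsub>M\<^esub> (g \<otimes>\<^bsub>M\<^esub> h)) \<cdot>\<^bsub>M\<^esub> Asc M a b c"
      by (auto simp: copy_simps A.asc_natural)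
  next
    fix f a b
    assume f: "f \<in> hom M a b"
    then obtain f' where "f = N f'" "f' \<in> hom A a b" by (auto simp: copy_simps)
    then show "LUn M b \<cdot>\<^bsub>M\<^esub> (Idn M (Uni M) \<otimes>\<^bsub>M\<^esub> f) = f \<cdot>\<^bsub>M\<^esub> LUn M a"
      and "RUn M b \<cdot>\<^bsub>M\<^esub> (f \<otimes>\<^bsub>M\<^esub> Idn M (Uni M)) = f \<cdot>\<^bsub>M\<^esub> RUn M a"
      using A.lun_nat[of f' a b] A.run_nat[of f' a b] by (auto simp: copy_simps)
  qed (auto simp: copy_simps iso_copy)
qed

end

locale braided_copy = A: braided_monoidal_category A + monoidal_copy A M N
  for A :: "('o, 'm, 'y) brcat_scheme" and M :: "('o, 'k, 'z) brcat_scheme" and N +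
  assumes copy_Brd: "a \<in> Obj A \<Longrightarrow> b \<in> Obj A \<Longrightarrow> Brd M a b = N (Brd A a b)"
begin

lemma braided_monoidal_category_copy: "braided_monoidal_category M"
proof -
  interpret M: monoidal_category M by (rule monoidal_category_copy)
  show ?thesis
  proof unfold_locales
    fix a b c
    assume "a \<in> Obj M" "b \<in> Obj M" "c \<in> Obj M"
    then show "Asc M b c a \<cdot>\<^bsub>M\<^esub> Brd M a (b \<odot>\<^bsub>M\<^esub> c) \<cdot>\<^bsub>M\<^esub> Asc M a b c
        = (Idn M b \<otimes>\<^bsub>M\<^esub> Brd M a c) \<cdot>\<^bsub>M\<^esub> Asc M b a c \<cdot>\<^bsub>M\<^esub> (Brd M a b \<otimes>\<^bsub>M\<^esub> Idn M c)"
      and "inv_arr M (Asc M c a b) \<cdot>\<^bsub>M\<^esub> Brd M (a \<odot>\<^bsub>M\<^esub> b) c \<cdot>\<^bsub>M\<^esub> inv_arr M (Asc M a b c)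
        = (Brd M a c \<otimes>\<^bsub>M\<^esub> Idn M b) \<cdot>\<^bsub>M\<^esub> inv_arr M (Asc M a c b) \<cdot>\<^bsub>M\<^esub> (Idn M a \<otimes>\<^bsub>M\<^esub> Brd M b c)"
      using A.hexagon1[of a b c] A.hexagon2[of a b c]
      by (simp_all add: copy_simps copy_Brd inv_arr_copy)
  next
    fix f a a' g b b'
    assume "f \<in> hom M a a'" "g \<in> hom M b b'"
    then show "Brd M a' b' \<cdot>\<^bsub>M\<^esub> (f \<otimes>\<^bsub>M\<^esub> g) = (g \<otimes>\<^bsub>M\<^esub> f) \<cdot>\<^bsub>M\<^esub> Brd M a b"
      by (auto simp: copy_simps copy_Brd A.brd_natural)
  qed (auto simp: copy_simps copy_Brd iso_copy)
qed

end

section \<open>Products of monoidal and braided monoidal categories\<close>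

lemma prod_mon_simps [simp]:
  "Obj (prod_mon C D) = Obj C \<times> Obj D" "Arr (prod_mon C D) = Arr C \<times> Arr D"
  "Dom (prod_mon C D) (f, g) = (Dom C f, Dom D g)" "Cod (prod_mon C D) (f, g) = (Cod C f, Cod D g)"
  "Idn (prod_mon C D) (a, b) = (Idn C a, Idn D b)"
  "Cmp (prod_mon C D) (f, g) (f', g') = (Cmp C f f', Cmp D g g')"
  "TObj (prod_mon C D) (a, b) (a', b') = (TObj C a a', TObj D b b')"
  "TArr (prod_mon C D) (f, g) (f', g') = (TArr C f f', TArr D g g')"
  "Uni (prod_mon C D) = (Uni C, Uni D)"
  "Asc (prod_mon C D) (a, b) (a', b') (a'', b'') = (Asc C a a' a'', Asc D b b' b'')"
  "LUn (prod_mon C D) (a, b) = (LUn C a, LUn D b)"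
  "RUn (prod_mon C D) (a, b) = (RUn C a, RUn D b)"
  by (simp_all add: prod_mon_def)

lemma prod_br_simps [simp]:
  "Obj (prod_br C D) = Obj (prod_mon C D)" "Arr (prod_br C D) = Arr (prod_mon C D)"
  "Dom (prod_br C D) = Dom (prod_mon C D)" "Cod (prod_br C D) = Cod (prod_mon C D)"
  "Idn (prod_br C D) = Idn (prod_mon C D)" "Cmp (prod_br C D) = Cmp (prod_mon C D)"
  "TObj (prod_br C D) = TObj (prod_mon C D)" "TArr (prod_br C D) = TArr (prod_mon C D)"
  "Uni (prod_br C D) = Uni (prod_mon C D)" "Asc (prod_br C D) = Asc (prod_mon C D)"
  "LUn (prod_br C D) = LUn (prod_mon C D)" "RUn (prod_br C D) = RUn (prod_mon C D)"
  "Brd (prod_br C D) (a, b) (a', b') = (Brd C a a', Brd D b b')"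
  by (simp_all add: prod_br_def prod_mon_def moncat.defs brcat.defs)

lemma inverse_arrs_prod_br:
  "inverse_arrs (prod_br C D) (f, g) (f', g') \<longleftrightarrow> inverse_arrs C f f' \<and> inverse_arrs D g g'"
  by (auto simp: inverse_arrs_def)

text \<open>The monoidal structure of the product is a hypothesis because an opmonoidal functor on
  \<open>prod_mon C D\<close> already provides it. The braiding axioms are then checked in each
  factor.\<close>

lemma braided_monoidal_category_prod_br:
  assumes "braided_monoidal_category C" "braided_monoidal_category D" "monoidal_category (prod_mon C D)"
  shows "braided_monoidal_category (prod_br C D)"
proof -
  interpret C: braided_monoidal_category C by fact
  interpret D: braided_monoidal_category D by fact
  interpret P: monoidal_category "prod_mon C D" by fact
  interpret monoidal_copy "prod_mon C D" "prod_br C D" id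
    by unfold_locales simp_all
  interpret P': monoidal_category "prod_br C D" by (rule monoidal_category_copy)
  \<comment> \<open>The second hexagon mentions \<open>inv_arr\<close>, so inverses in the product
    must first be identified entrywise.\<close>
  have iso: "iso (prod_br C D) (f, g)" and inv: "inv_arr (prod_br C D) (f, g) = (inv_arr C f, inv_arr D g)"
    if "iso C f" "iso D g" for f g
  proof -
    have "inverse_arrs (prod_br C D) (f, g) (inv_arr C f, inv_arr D g)"
      by (simp only: inverse_arrs_prod_br C.inverse_arrs_inv[OF that(1)] D.inverse_arrs_inv[OF that(2)])
    then show "iso (prod_br C D) (f, g)" "inv_arr (prod_br C D) (f, g) = (inv_arr C f, inv_arr D g)"
      by (rule P'.isoI, rule P'.inv_arr_eq)
  qed
  show ?thesis
    by unfold_locales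
      (auto simp: iso inv C.brd_nat D.brd_nat C.hexagon1 D.hexagon1 C.hexagon2 D.hexagon2)
qed


section \<open>Opmonoidal actions\<close>

text \<open>\<open>A\<close> is a braided record because \<open>assoc_vcat\<close> reads the field
  \<open>Brd\<close>. The braiding axioms join in \<open>closed_braided_action\<close>, so the
  monoidal \<open>\<V>\<close>-category is built from the monoidal structure of
  \<open>A\<close>.\<close>

locale closed_opmonoidal_action = opmonoidal_action V A S
  for V :: "('o, 'm, 'w) brcat_scheme" and A :: "('p, 'n, 'v) brcat_scheme"
    and S :: "('o, 'm, 'p, 'n, 'x) action_scheme" +
  fixes R :: "'p \<Rightarrow> ('p, 'n, 'o, 'm, 'u) radj_scheme"
  assumes adjoint: "a \<in> Obj A \<Longrightarrow> adjunction V A (act_on A S a) (R a)"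
begin

lemma act_obj [simp]: "x \<in> Obj V \<Longrightarrow> a \<in> Obj A \<Longrightarrow> FObj S (x, a) \<in> Obj A"
  using func.obj[of "(x, a)"] by simp

lemma act_arr [simp]:
  assumes "f \<in> Arr V" "g \<in> Arr A"
  shows "FArr S (f, g) \<in> Arr A" "Dom A (FArr S (f, g)) = FObj S (Dom V f, Dom A g)"
    "Cod A (FArr S (f, g)) = FObj S (Cod V f, Cod A g)"
  using func.arr[of "(f, g)" "(Dom V f, Dom A g)" "(Cod V f, Cod A g)"] assms by simp_all

lemma act_Idn [simp]: "x \<in> Obj V \<Longrightarrow> a \<in> Obj A \<Longrightarrow> FArr S (Idn V x, Idn A a) = Idn A (FObj S (x, a))"
  using func.pres_id[of "(x, a)"] by simp

lemma act_comp:
  assumes "f \<in> Arr V" "g \<in> Arr V" "Cod V f = Dom V g" "f' \<in> Arr A" "g' \<in> Arr A" "Cod A f' = Dom A g'"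
  shows "FArr S (g, g') \<cdot>\<^bsub>A\<^esub> FArr S (f, f') = FArr S (g \<cdot>\<^bsub>V\<^esub> f, g' \<cdot>\<^bsub>A\<^esub> f')"
  using func.pres_comp[of "(f, f')" "(Dom V f, Dom A f')" "(Dom V g, Dom A g')" "(g, g')" "(Cod V g, Cod A g')"]
    assms by simp

lemma act_comp_tail:
  assumes "f \<in> Arr V" "g \<in> Arr V" "Cod V f = Dom V g" "f' \<in> Arr A" "g' \<in> Arr A" "Cod A f' = Dom A g'"
    "k \<in> Arr A" "Cod A k = FObj S (Dom V f, Dom A f')"
  shows "FArr S (g, g') \<cdot>\<^bsub>A\<^esub> (FArr S (f, f') \<cdot>\<^bsub>A\<^esub> k) = FArr S (g \<cdot>\<^bsub>V\<^esub> f, g' \<cdot>\<^bsub>A\<^esub> f') \<cdot>\<^bsub>A\<^esub> k"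
  by (rule A.comp_cong_tail[OF act_comp]) (use assms in simp_all)

lemmas act_merge = act_comp act_comp_tail

lemma ActAsc_simps [simp]:
  assumes "x \<in> Obj V" "y \<in> Obj V" "a \<in> Obj A"
  shows "ActAsc S (x, y, a) \<in> Arr A" "Dom A (ActAsc S (x, y, a)) = FObj S (x, FObj S (y, a))"
    "Cod A (ActAsc S (x, y, a)) = FObj S (x \<odot>\<^bsub>V\<^esub> y, a)" "iso A (ActAsc S (x, y, a))"
  using assoc.component[of "(x, y, a)"] assoc.component_iso[of "(x, y, a)"] assms
  by (simp_all add: act_twice_def act_tensor_def opmon_comp_def opmon_prod_def opmon_tensor_def
      opmon_reassoc_def opmon_id_def)

lemma ActUni_simps [simp]:
  assumes "a \<in> Obj A"
  shows "ActUni S a \<in> Arr A" "Dom A (ActUni S a) = FObj S (Uni V, a)" "Cod A (ActUni S a) = a"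
    "iso A (ActUni S a)"
  using unit.component[OF assms] unit.component_iso[OF assms]
  by (simp_all add: act_unit_def opmon_comp_def opmon_unit_def opmon_id_def)

lemma ActAsc_natural:
  assumes "f \<in> Arr V" "g \<in> Arr V" "h \<in> Arr A"
  shows "ActAsc S (Cod V f, Cod V g, Cod A h) \<cdot>\<^bsub>A\<^esub> FArr S (f, FArr S (g, h))
    = FArr S (f \<otimes>\<^bsub>V\<^esub> g, h) \<cdot>\<^bsub>A\<^esub> ActAsc S (Dom V f, Dom V g, Dom A h)"
  using assoc.naturality[of "(f, g, h)" "(Dom V f, Dom V g, Dom A h)" "(Cod V f, Cod V g, Cod A h)"] assms
  by (simp add: act_twice_def act_tensor_def opmon_comp_def opmon_prod_def opmon_tensor_def
      opmon_reassoc_def opmon_id_def)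

lemma ActAsc_inv_natural:
  assumes [simp]: "f \<in> Arr V" "g \<in> Arr V" "h \<in> Arr A"
  shows "inv_arr A (ActAsc S (Cod V f, Cod V g, Cod A h)) \<cdot>\<^bsub>A\<^esub> FArr S (f \<otimes>\<^bsub>V\<^esub> g, h)
    = FArr S (f, FArr S (g, h)) \<cdot>\<^bsub>A\<^esub> inv_arr A (ActAsc S (Dom V f, Dom V g, Dom A h))"
  by (rule A.inv_square) (simp_all add: ActAsc_natural)

lemma ActUni_natural:
  assumes "f \<in> Arr A"
  shows "ActUni S (Cod A f) \<cdot>\<^bsub>A\<^esub> FArr S (Idn V (Uni V), f) = f \<cdot>\<^bsub>A\<^esub> ActUni S (Dom A f)"
  using unit.naturality[of f "Dom A f" "Cod A f"] assms
  by (simp add: act_unit_def opmon_comp_def opmon_unit_def opmon_id_def)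

text \<open>Composition in the associated \<open>\<V>\<close>-category is defined with the inverse
  of \<open>\<alpha>\<close>, so its associativity calls for the pentagon with every
  \<open>\<alpha>\<close> inverted.\<close>

lemma act_pentagon_inv:
  assumes [simp]: "x \<in> Obj V" "y \<in> Obj V" "z \<in> Obj V" "a \<in> Obj A"
  shows "FArr S (Idn V x, inv_arr A (ActAsc S (y, z, a))) \<cdot>\<^bsub>A\<^esub> inv_arr A (ActAsc S (x, y \<odot>\<^bsub>V\<^esub> z, a))
      \<cdot>\<^bsub>A\<^esub> FArr S (Asc V x y z, Idn A a)
    = inv_arr A (ActAsc S (x, y, FObj S (z, a))) \<cdot>\<^bsub>A\<^esub> inv_arr A (ActAsc S (x \<odot>\<^bsub>V\<^esub> y, z, a))"
    (is "?l = ?r")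
proof (rule A.iso_cancel_right)
  let ?k = "ActAsc S (x \<odot>\<^bsub>V\<^esub> y, z, a) \<cdot>\<^bsub>A\<^esub> ActAsc S (x, y, FObj S (z, a))"
  show "iso A ?k" by (rule A.iso_comp) simp_all
  have "?l \<cdot>\<^bsub>A\<^esub> ?k = FArr S (Idn V x, inv_arr A (ActAsc S (y, z, a))) \<cdot>\<^bsub>A\<^esub> (inv_arr A (ActAsc S (x, y \<odot>\<^bsub>V\<^esub> z, a))
      \<cdot>\<^bsub>A\<^esub> (FArr S (Asc V x y z, Idn A a) \<cdot>\<^bsub>A\<^esub> ?k))"
    by simp
  also have "\<dots> = FArr S (Idn V x, inv_arr A (ActAsc S (y, z, a))) \<cdot>\<^bsub>A\<^esub> FArr S (Idn V x, ActAsc S (y, z, a))"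
    by (simp add: act_pentagon)
  also have "\<dots> = ?r \<cdot>\<^bsub>A\<^esub> ?k" by (simp add: act_merge)
  finally show "?l \<cdot>\<^bsub>A\<^esub> ?k = ?r \<cdot>\<^bsub>A\<^esub> ?k" .
qed simp_all

text \<open>These are the constraints left over when the name of an arrow is composed on the left:
  the inverse of \<open>LUn\<close> introduces a unit, and \<open>\<lambda>\<close> removes it
  again.\<close>

lemma act_lunit_inv:
  assumes [simp]: "x \<in> Obj V" "a \<in> Obj A"
  shows "ActUni S (FObj S (x, a)) \<cdot>\<^bsub>A\<^esub> inv_arr A (ActAsc S (Uni V, x, a)) \<cdot>\<^bsub>A\<^esub> FArr S (inv_arr V (LUn V x), Idn A a)
    = Idn A (FObj S (x, a))"
  by (simp flip: act_lunit add: act_merge)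

lemma act_runit_inv:
  assumes [simp]: "x \<in> Obj V" "a \<in> Obj A"
  shows "FArr S (Idn V x, ActUni S a) \<cdot>\<^bsub>A\<^esub> inv_arr A (ActAsc S (x, Uni V, a)) \<cdot>\<^bsub>A\<^esub> FArr S (inv_arr V (RUn V x), Idn A a)
    = Idn A (FObj S (x, a))"
  by (simp flip: act_runit add: act_merge)

lemma FTen_simps [simp]:
  assumes "x \<in> Obj V" "y \<in> Obj V" "a \<in> Obj A" "b \<in> Obj A"
  shows "FTen S (x, a) (y, b) \<in> Arr A" "Dom A (FTen S (x, a) (y, b)) = FObj S (x \<odot>\<^bsub>V\<^esub> y, a \<odot>\<^bsub>A\<^esub> b)"
    "Cod A (FTen S (x, a) (y, b)) = FObj S (x, a) \<odot>\<^bsub>A\<^esub> FObj S (y, b)"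
  using ften_hom[of "(x, a)" "(y, b)"] assms by simp_all

lemma FTen_natural:
  assumes "f \<in> Arr V" "g \<in> Arr V" "h \<in> Arr A" "k \<in> Arr A"
  shows "FTen S (Cod V f, Cod A h) (Cod V g, Cod A k) \<cdot>\<^bsub>A\<^esub> FArr S (f \<otimes>\<^bsub>V\<^esub> g, h \<otimes>\<^bsub>A\<^esub> k)
    = (FArr S (f, h) \<otimes>\<^bsub>A\<^esub> FArr S (g, k)) \<cdot>\<^bsub>A\<^esub> FTen S (Dom V f, Dom A h) (Dom V g, Dom A k)"
  using ften_nat[of "(f, h)" "(Dom V f, Dom A h)" "(Cod V f, Cod A h)"
      "(g, k)" "(Dom V g, Dom A k)" "(Cod V g, Cod A k)"] assms
  by simp

lemma FTen_asc:
  assumes "x \<in> Obj V" "y \<in> Obj V" "z \<in> Obj V" "a \<in> Obj A" "b \<in> Obj A" "c \<in> Obj A"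
  shows "Asc A (FObj S (x, a)) (FObj S (y, b)) (FObj S (z, c))
      \<cdot>\<^bsub>A\<^esub> (FTen S (x, a) (y, b) \<otimes>\<^bsub>A\<^esub> Idn A (FObj S (z, c))) \<cdot>\<^bsub>A\<^esub> FTen S (x \<odot>\<^bsub>V\<^esub> y, a \<odot>\<^bsub>A\<^esub> b) (z, c)
    = (Idn A (FObj S (x, a)) \<otimes>\<^bsub>A\<^esub> FTen S (y, b) (z, c)) \<cdot>\<^bsub>A\<^esub> FTen S (x, a) (y \<odot>\<^bsub>V\<^esub> z, b \<odot>\<^bsub>A\<^esub> c)
      \<cdot>\<^bsub>A\<^esub> FArr S (Asc V x y z, Asc A a b c)"
  using ften_assoc[of "(x, a)" "(y, b)" "(z, c)"] assms by simp

text \<open>The unit condition for \<open>\<lambda>\<close> to be opmonoidal forces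
  \<open>\<xi>\<^sub>0\<close> to be \<open>\<lambda>\<close> at \<open>J\<close>, which is also the
  untransposed identity of the unit object \<open>EUni E\<close>. This links the unit axioms of
  \<open>\<xi>\<close> to the unit constraints of the \<open>\<V>\<close>-category.\<close>

lemma FUni_eq: "FUni S = ActUni S (Uni A)"
proof -
  have "FUni S \<in> hom A (FObj S (Uni V, Uni A)) (Uni A)"
    using funi_hom by simp
  then show ?thesis
    using unit_opmon.opmon_unit by (simp add: act_unit_def opmon_comp_def opmon_unit_def opmon_id_def)
qed

lemma FTen_lunit:
  assumes "x \<in> Obj V" "a \<in> Obj A"
  shows "LUn A (FObj S (x, a)) \<cdot>\<^bsub>A\<^esub> (ActUni S (Uni A) \<otimes>\<^bsub>A\<^esub> Idn A (FObj S (x, a))) \<cdot>\<^bsub>A\<^esub> FTen S (Uni V, Uni A) (x, a)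
    = FArr S (LUn V x, LUn A a)"
  using ften_lunit[of "(x, a)"] assms by (simp add: FUni_eq)

lemma FTen_runit:
  assumes "x \<in> Obj V" "a \<in> Obj A"
  shows "RUn A (FObj S (x, a)) \<cdot>\<^bsub>A\<^esub> (Idn A (FObj S (x, a)) \<otimes>\<^bsub>A\<^esub> ActUni S (Uni A)) \<cdot>\<^bsub>A\<^esub> FTen S (x, a) (Uni V, Uni A)
    = FArr S (RUn V x, RUn A a)"
  using ften_runit[of "(x, a)"] assms by (simp add: FUni_eq)

lemma ActUni_opmonoidal:
  assumes "a \<in> Obj A" "b \<in> Obj A"
  shows "(ActUni S a \<otimes>\<^bsub>A\<^esub> ActUni S b) \<cdot>\<^bsub>A\<^esub> FTen S (Uni V, a) (Uni V, b)
      \<cdot>\<^bsub>A\<^esub> FArr S (inv_arr V (LUn V (Uni V)), Idn A (a \<odot>\<^bsub>A\<^esub> b)) = ActUni S (a \<odot>\<^bsub>A\<^esub> b)"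
  using unit_opmon.opmon_tensor[of a b] assms
  by (simp add: act_unit_def opmon_comp_def opmon_unit_def opmon_id_def)

lemma ActAsc_opmonoidal:
  assumes "x \<in> Obj V" "x' \<in> Obj V" "y \<in> Obj V" "y' \<in> Obj V" "a \<in> Obj A" "b \<in> Obj A"
  shows "(ActAsc S (x, x', a) \<otimes>\<^bsub>A\<^esub> ActAsc S (y, y', b)) \<cdot>\<^bsub>A\<^esub> FTen S (x, FObj S (x', a)) (y, FObj S (y', b))
      \<cdot>\<^bsub>A\<^esub> FArr S (Idn V (x \<odot>\<^bsub>V\<^esub> y), FTen S (x', a) (y', b))
    = FTen S (x \<odot>\<^bsub>V\<^esub> x', a) (y \<odot>\<^bsub>V\<^esub> y', b) \<cdot>\<^bsub>A\<^esub> FArr S (interchange V x y x' y', Idn A (a \<odot>\<^bsub>A\<^esub> b))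
      \<cdot>\<^bsub>A\<^esub> ActAsc S (x \<odot>\<^bsub>V\<^esub> y, x' \<odot>\<^bsub>V\<^esub> y', a \<odot>\<^bsub>A\<^esub> b)"
  using assoc_opmon.opmon_tensor[of "(x, x', a)" "(y, y', b)"] assms
  by (simp add: act_twice_def act_tensor_def opmon_comp_def opmon_prod_def opmon_tensor_def
      opmon_reassoc_def opmon_id_def)

text \<open>The interchange on the left is the one in the composition of
  \<open>vcat_tensor V E E\<close>, so this form of the axiom makes the tensor preserve
  composition.\<close>

lemma ActAsc_inv_opmonoidal:
  assumes [simp]: "x \<in> Obj V" "x' \<in> Obj V" "y \<in> Obj V" "y' \<in> Obj V" "a \<in> Obj A" "b \<in> Obj A"
  shows "(inv_arr A (ActAsc S (x, x', a)) \<otimes>\<^bsub>A\<^esub> inv_arr A (ActAsc S (y, y', b)))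
      \<cdot>\<^bsub>A\<^esub> FTen S (x \<odot>\<^bsub>V\<^esub> x', a) (y \<odot>\<^bsub>V\<^esub> y', b) \<cdot>\<^bsub>A\<^esub> FArr S (interchange V x y x' y', Idn A (a \<odot>\<^bsub>A\<^esub> b))
    = FTen S (x, FObj S (x', a)) (y, FObj S (y', b)) \<cdot>\<^bsub>A\<^esub> FArr S (Idn V (x \<odot>\<^bsub>V\<^esub> y), FTen S (x', a) (y', b))
      \<cdot>\<^bsub>A\<^esub> inv_arr A (ActAsc S (x \<odot>\<^bsub>V\<^esub> y, x' \<odot>\<^bsub>V\<^esub> y', a \<odot>\<^bsub>A\<^esub> b))"
    (is "?i \<cdot>\<^bsub>A\<^esub> ?t = ?u \<cdot>\<^bsub>A\<^esub> ?v \<cdot>\<^bsub>A\<^esub> inv_arr A ?c")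
proof (rule A.iso_cancel_right)
  show "iso A ?c" by simp
  have "(?i \<cdot>\<^bsub>A\<^esub> ?t) \<cdot>\<^bsub>A\<^esub> ?c = ?i \<cdot>\<^bsub>A\<^esub> (FTen S (x \<odot>\<^bsub>V\<^esub> x', a) (y \<odot>\<^bsub>V\<^esub> y', b)
      \<cdot>\<^bsub>A\<^esub> FArr S (interchange V x y x' y', Idn A (a \<odot>\<^bsub>A\<^esub> b)) \<cdot>\<^bsub>A\<^esub> ?c)"
    by simp
  also have "\<dots> = (?i \<cdot>\<^bsub>A\<^esub> (ActAsc S (x, x', a) \<otimes>\<^bsub>A\<^esub> ActAsc S (y, y', b))) \<cdot>\<^bsub>A\<^esub> (?u \<cdot>\<^bsub>A\<^esub> ?v)"
    by (simp flip: ActAsc_opmonoidal)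
  also have "\<dots> = (?u \<cdot>\<^bsub>A\<^esub> ?v \<cdot>\<^bsub>A\<^esub> inv_arr A ?c) \<cdot>\<^bsub>A\<^esub> ?c"
    by (simp add: A.tensor_merge)
  finally show "(?i \<cdot>\<^bsub>A\<^esub> ?t) \<cdot>\<^bsub>A\<^esub> ?c = (?u \<cdot>\<^bsub>A\<^esub> ?v \<cdot>\<^bsub>A\<^esub> inv_arr A ?c) \<cdot>\<^bsub>A\<^esub> ?c" .
qed simp_all


section \<open>Transposition across the adjunctions\<close>

definition untranspose :: "'p \<Rightarrow> 'p \<Rightarrow> 'm \<Rightarrow> 'n" where
  "untranspose a b \<phi> = ACounit (R a) b \<cdot>\<^bsub>A\<^esub> FArr S (\<phi>, Idn A a)"

lemma adjoint_simps [simp]: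
  assumes "a \<in> Obj A"
  shows "b \<in> Obj A \<Longrightarrow> FObj (R a) b \<in> Obj V"
    "f \<in> Arr A \<Longrightarrow> FArr (R a) f \<in> Arr V"
    "f \<in> Arr A \<Longrightarrow> Dom V (FArr (R a) f) = FObj (R a) (Dom A f)"
    "f \<in> Arr A \<Longrightarrow> Cod V (FArr (R a) f) = FObj (R a) (Cod A f)"
    "b \<in> Obj A \<Longrightarrow> ACounit (R a) b \<in> Arr A"
    "b \<in> Obj A \<Longrightarrow> Dom A (ACounit (R a) b) = FObj S (FObj (R a) b, a)"
    "b \<in> Obj A \<Longrightarrow> Cod A (ACounit (R a) b) = b"
    "x \<in> Obj V \<Longrightarrow> AUnit (R a) x \<in> Arr V"
    "x \<in> Obj V \<Longrightarrow> Dom V (AUnit (R a) x) = x"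
    "x \<in> Obj V \<Longrightarrow> Cod V (AUnit (R a) x) = FObj (R a) (FObj S (x, a))"
proof -
  interpret adjunction V A "act_on A S a" "R a" using assms by (rule adjoint)
  show "b \<in> Obj A \<Longrightarrow> FObj (R a) b \<in> Obj V" by (rule G.obj)
  show "f \<in> Arr A \<Longrightarrow> FArr (R a) f \<in> Arr V"
    "f \<in> Arr A \<Longrightarrow> Dom V (FArr (R a) f) = FObj (R a) (Dom A f)"
    "f \<in> Arr A \<Longrightarrow> Cod V (FArr (R a) f) = FObj (R a) (Cod A f)"
    using G.arr[of f "Dom A f" "Cod A f"] by simp_all
  show "b \<in> Obj A \<Longrightarrow> ACounit (R a) b \<in> Arr A"
    "b \<in> Obj A \<Longrightarrow> Dom A (ACounit (R a) b) = FObj S (FObj (R a) b, a)"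
    "b \<in> Obj A \<Longrightarrow> Cod A (ACounit (R a) b) = b"
    using counit.component[of b] by (simp_all add: comp_fun_def id_fun_def act_on_def)
  show "x \<in> Obj V \<Longrightarrow> AUnit (R a) x \<in> Arr V"
    "x \<in> Obj V \<Longrightarrow> Dom V (AUnit (R a) x) = x"
    "x \<in> Obj V \<Longrightarrow> Cod V (AUnit (R a) x) = FObj (R a) (FObj S (x, a))"
    using unit.component[of x] by (simp_all add: comp_fun_def id_fun_def act_on_def)
qed

lemma transpose_simps [simp]:
  assumes "a \<in> Obj A" "x \<in> Obj V" "f \<in> Arr A" "Dom A f = FObj S (x, a)"
  shows "transpose V R a x f \<in> Arr V" "Dom V (transpose V R a x f) = x"
    "Cod V (transpose V R a x f) = FObj (R a) (Cod A f)"
  using assms by (simp_all add: transpose_def)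

lemma untranspose_simps [simp]:
  assumes "a \<in> Obj A" "b \<in> Obj A" "\<phi> \<in> Arr V" "Cod V \<phi> = FObj (R a) b"
  shows "untranspose a b \<phi> \<in> Arr A" "Dom A (untranspose a b \<phi>) = FObj S (Dom V \<phi>, a)"
    "Cod A (untranspose a b \<phi>) = b"
  using assms by (simp_all add: untranspose_def)

lemma untranspose_comp:
  assumes "a \<in> Obj A" "b \<in> Obj A" "\<phi> \<in> Arr V" "Cod V \<phi> = FObj (R a) b" "h \<in> Arr V" "Cod V h = Dom V \<phi>"
  shows "untranspose a b (\<phi> \<cdot>\<^bsub>V\<^esub> h) = untranspose a b \<phi> \<cdot>\<^bsub>A\<^esub> FArr S (h, Idn A a)"
  using assms by (simp add: untranspose_def act_merge)

lemma untranspose_Idn [simp]: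
  "a \<in> Obj A \<Longrightarrow> b \<in> Obj A \<Longrightarrow> untranspose a b (Idn V (FObj (R a) b)) = ACounit (R a) b"
  by (simp add: untranspose_def)

lemma untranspose_transpose [simp]:
  assumes [simp]: "a \<in> Obj A" "x \<in> Obj V" "f \<in> Arr A" "Dom A f = FObj S (x, a)" "Cod A f = b"
  shows "untranspose a b (transpose V R a x f) = f"
proof -
  interpret adj: adjunction V A "act_on A S a" "R a" by (rule adjoint) simp
  have [simp]: "b \<in> Obj A" using A.cod_obj[of f] by simp
  have "untranspose a b (transpose V R a x f)
      = (ACounit (R a) b \<cdot>\<^bsub>A\<^esub> FArr S (FArr (R a) f, Idn A a)) \<cdot>\<^bsub>A\<^esub> FArr S (AUnit (R a) x, Idn A a)"
    by (simp add: untranspose_def transpose_def act_merge)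
  also have "\<dots> = f \<cdot>\<^bsub>A\<^esub> (ACounit (R a) (FObj S (x, a)) \<cdot>\<^bsub>A\<^esub> FArr S (AUnit (R a) x, Idn A a))"
    using adj.counit.naturality[of f "FObj S (x, a)" b] by (simp add: comp_fun_def id_fun_def act_on_def)
  also have "\<dots> = f"
    using adj.triangle_left[of x] by (simp add: act_on_def)
  finally show ?thesis .
qed

lemma transpose_untranspose:
  assumes [simp]: "a \<in> Obj A" "b \<in> Obj A" "\<phi> \<in> Arr V" "Cod V \<phi> = FObj (R a) b"
  shows "transpose V R a (Dom V \<phi>) (untranspose a b \<phi>) = \<phi>"
proof -
  interpret adj: adjunction V A "act_on A S a" "R a" by (rule adjoint) simp
  have "transpose V R a (Dom V \<phi>) (untranspose a b \<phi>)
      = FArr (R a) (ACounit (R a) b) \<cdot>\<^bsub>V\<^esub> (FArr (R a) (FArr S (\<phi>, Idn A a)) \<cdot>\<^bsub>V\<^esub> AUnit (R a) (Dom V \<phi>))"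
    unfolding transpose_def untranspose_def
    by (subst adj.G.pres_comp[of _ "FObj S (Dom V \<phi>, a)" "FObj S (FObj (R a) b, a)" _ b]) simp_all
  also have "\<dots> = (FArr (R a) (ACounit (R a) b) \<cdot>\<^bsub>V\<^esub> AUnit (R a) (FObj (R a) b)) \<cdot>\<^bsub>V\<^esub> \<phi>"
    using adj.unit.naturality[of \<phi> "Dom V \<phi>" "FObj (R a) b"]
    by (simp add: comp_fun_def id_fun_def act_on_def)
  also have "\<dots> = \<phi>"
    using adj.triangle_right[of b] by (simp del: V.comp_assoc_arr)
  finally show ?thesis .
qed

lemma untranspose_eqI:
  assumes "a \<in> Obj A" "b \<in> Obj A" "\<phi> \<in> hom V x (FObj (R a) b)" "\<psi> \<in> hom V x (FObj (R a) b)"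
    and eq: "untranspose a b \<phi> = untranspose a b \<psi>"
  shows "\<phi> = \<psi>"
proof -
  have "\<phi> = transpose V R a x (untranspose a b \<phi>)"
    using transpose_untranspose[of a b \<phi>] assms(1-4) by simp
  also have "\<dots> = transpose V R a x (untranspose a b \<psi>)"
    by (simp only: eq)
  also have "\<dots> = \<psi>"
    using transpose_untranspose[of a b \<psi>] assms(1-4) by simp
  finally show ?thesis .
qed

end


section \<open>The associated monoidal category\<close>

context closed_opmonoidal_action
begin

abbreviation E :: "('p, 'o, 'm) vbrcat" where
  "E \<equiv> assoc_vcat V A S R"

abbreviation name :: "'n \<Rightarrow> 'm" where
  "name f \<equiv> name_of V A S R f"

lemma assoc_vcat_simps [simp]:
  "EObj E = Obj A" "EHom E a b = FObj (R a) b" "ETObj E a b = a \<odot>\<^bsub>A\<^esub> b" "EUni E = Uni A"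
  "EAsc E a b c = name (Asc A a b c)" "ELUn E a = name (LUn A a)" "ERUn E a = name (RUn A a)"
  "EBrd E a b = name (Brd A a b)"
  by (simp_all add: assoc_vcat_def Let_def)

lemma ECmp_simps [simp]:
  assumes [simp]: "a \<in> Obj A" "b \<in> Obj A" "c \<in> Obj A"
  shows "ECmp E a b c \<in> Arr V" "Dom V (ECmp E a b c) = FObj (R b) c \<odot>\<^bsub>V\<^esub> FObj (R a) b"
    "Cod V (ECmp E a b c) = FObj (R a) c"
    "untranspose a c (ECmp E a b c) = ACounit (R b) c \<cdot>\<^bsub>A\<^esub> FArr S (Idn V (FObj (R b) c), ACounit (R a) b)
      \<cdot>\<^bsub>A\<^esub> inv_arr A (ActAsc S (FObj (R b) c, FObj (R a) b, a))"
  by (simp_all add: assoc_vcat_def Let_def)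

lemma EIdn_simps [simp]:
  assumes [simp]: "a \<in> Obj A"
  shows "EIdn E a \<in> Arr V" "Dom V (EIdn E a) = Uni V" "Cod V (EIdn E a) = FObj (R a) a"
    "untranspose a a (EIdn E a) = ActUni S a"
  by (simp_all add: assoc_vcat_def Let_def)

lemma ETen_simps [simp]:
  assumes [simp]: "a \<in> Obj A" "b \<in> Obj A" "c \<in> Obj A" "d \<in> Obj A"
  shows "ETen E a c b d \<in> Arr V" "Dom V (ETen E a c b d) = FObj (R a) b \<odot>\<^bsub>V\<^esub> FObj (R c) d"
    "Cod V (ETen E a c b d) = FObj (R (a \<odot>\<^bsub>A\<^esub> c)) (b \<odot>\<^bsub>A\<^esub> d)"
    "untranspose (a \<odot>\<^bsub>A\<^esub> c) (b \<odot>\<^bsub>A\<^esub> d) (ETen E a c b d)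
      = (ACounit (R a) b \<otimes>\<^bsub>A\<^esub> ACounit (R c) d) \<cdot>\<^bsub>A\<^esub> FTen S (FObj (R a) b, a) (FObj (R c) d, c)"
  by (simp_all add: assoc_vcat_def Let_def)

text \<open>Naturality of the inverse of \<open>\<alpha>\<close> carries \<open>g\<close> and
  \<open>f\<close> past it to the two counits, which absorb them into
  \<open>untranspose b c g\<close> and \<open>untranspose a b f\<close>.\<close>

lemma untranspose_ECmp:
  assumes [simp]: "a \<in> Obj A" "b \<in> Obj A" "c \<in> Obj A" "f \<in> Arr V" "Cod V f = FObj (R a) b"
    "g \<in> Arr V" "Cod V g = FObj (R b) c"
  shows "untranspose a c (ECmp E a b c \<cdot>\<^bsub>V\<^esub> (g \<otimes>\<^bsub>V\<^esub> f))
    = untranspose b c g \<cdot>\<^bsub>A\<^esub> FArr S (Idn V (Dom V g), untranspose a b f) \<cdot>\<^bsub>A\<^esub> inv_arr A (ActAsc S (Dom V g, Dom V f, a))"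
proof -
  have "untranspose a c (ECmp E a b c \<cdot>\<^bsub>V\<^esub> (g \<otimes>\<^bsub>V\<^esub> f)) = ACounit (R b) c
      \<cdot>\<^bsub>A\<^esub> (FArr S (Idn V (FObj (R b) c), ACounit (R a) b) \<cdot>\<^bsub>A\<^esub> (inv_arr A (ActAsc S (FObj (R b) c, FObj (R a) b, a))
      \<cdot>\<^bsub>A\<^esub> FArr S (g \<otimes>\<^bsub>V\<^esub> f, Idn A a)))"
    by (simp add: untranspose_comp)
  also have "\<dots> = ACounit (R b) c \<cdot>\<^bsub>A\<^esub> (FArr S (Idn V (FObj (R b) c), ACounit (R a) b)
      \<cdot>\<^bsub>A\<^esub> (FArr S (g, FArr S (f, Idn A a)) \<cdot>\<^bsub>A\<^esub> inv_arr A (ActAsc S (Dom V g, Dom V f, a))))"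
    using ActAsc_inv_natural[of g f "Idn A a"] by simp
  also have "\<dots> = untranspose b c g \<cdot>\<^bsub>A\<^esub> FArr S (Idn V (Dom V g), untranspose a b f)
      \<cdot>\<^bsub>A\<^esub> inv_arr A (ActAsc S (Dom V g, Dom V f, a))"
    by (simp add: untranspose_def act_merge)
  finally show ?thesis .
qed

lemma untranspose_ECmp_tail:
  assumes [simp]: "a \<in> Obj A" "b \<in> Obj A" "c \<in> Obj A" "f \<in> Arr V" "Cod V f = FObj (R a) b"
    "g \<in> Arr V" "Cod V g = FObj (R b) c" "h \<in> Arr V" "Cod V h = Dom V g \<odot>\<^bsub>V\<^esub> Dom V f"
  shows "untranspose a c (ECmp E a b c \<cdot>\<^bsub>V\<^esub> ((g \<otimes>\<^bsub>V\<^esub> f) \<cdot>\<^bsub>V\<^esub> h))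
    = untranspose b c g \<cdot>\<^bsub>A\<^esub> FArr S (Idn V (Dom V g), untranspose a b f)
      \<cdot>\<^bsub>A\<^esub> inv_arr A (ActAsc S (Dom V g, Dom V f, a)) \<cdot>\<^bsub>A\<^esub> FArr S (h, Idn A a)"
  using untranspose_comp[of a c "ECmp E a b c \<cdot>\<^bsub>V\<^esub> (g \<otimes>\<^bsub>V\<^esub> f)" h]
  by (simp add: untranspose_ECmp)

text \<open>Naturality of \<open>\<xi>\<close> plays the part that naturality of
  \<open>\<alpha>\<close> plays for composition.\<close>

lemma untranspose_ETen:
  assumes [simp]: "a \<in> Obj A" "b \<in> Obj A" "c \<in> Obj A" "d \<in> Obj A"
    "f \<in> Arr V" "Cod V f = FObj (R a) b" "g \<in> Arr V" "Cod V g = FObj (R c) d"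
  shows "untranspose (a \<odot>\<^bsub>A\<^esub> c) (b \<odot>\<^bsub>A\<^esub> d) (ETen E a c b d \<cdot>\<^bsub>V\<^esub> (f \<otimes>\<^bsub>V\<^esub> g))
    = (untranspose a b f \<otimes>\<^bsub>A\<^esub> untranspose c d g) \<cdot>\<^bsub>A\<^esub> FTen S (Dom V f, a) (Dom V g, c)"
proof -
  have "untranspose (a \<odot>\<^bsub>A\<^esub> c) (b \<odot>\<^bsub>A\<^esub> d) (ETen E a c b d \<cdot>\<^bsub>V\<^esub> (f \<otimes>\<^bsub>V\<^esub> g))
      = (ACounit (R a) b \<otimes>\<^bsub>A\<^esub> ACounit (R c) d) \<cdot>\<^bsub>A\<^esub> (FTen S (FObj (R a) b, a) (FObj (R c) d, c)
        \<cdot>\<^bsub>A\<^esub> FArr S (f \<otimes>\<^bsub>V\<^esub> g, Idn A (a \<odot>\<^bsub>A\<^esub> c)))"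
    by (simp add: untranspose_comp)
  also have "\<dots> = (ACounit (R a) b \<otimes>\<^bsub>A\<^esub> ACounit (R c) d) \<cdot>\<^bsub>A\<^esub> ((FArr S (f, Idn A a) \<otimes>\<^bsub>A\<^esub> FArr S (g, Idn A c))
      \<cdot>\<^bsub>A\<^esub> FTen S (Dom V f, a) (Dom V g, c))"
    using FTen_natural[of f g "Idn A a" "Idn A c"] by simp
  also have "\<dots> = (untranspose a b f \<otimes>\<^bsub>A\<^esub> untranspose c d g) \<cdot>\<^bsub>A\<^esub> FTen S (Dom V f, a) (Dom V g, c)"
    by (simp add: untranspose_def A.tensor_merge)
  finally show ?thesis .
qed

lemma untranspose_ETen_tail:
  assumes [simp]: "a \<in> Obj A" "b \<in> Obj A" "c \<in> Obj A" "d \<in> Obj A"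
    "f \<in> Arr V" "Cod V f = FObj (R a) b" "g \<in> Arr V" "Cod V g = FObj (R c) d"
    "h \<in> Arr V" "Cod V h = Dom V f \<odot>\<^bsub>V\<^esub> Dom V g"
  shows "untranspose (a \<odot>\<^bsub>A\<^esub> c) (b \<odot>\<^bsub>A\<^esub> d) (ETen E a c b d \<cdot>\<^bsub>V\<^esub> ((f \<otimes>\<^bsub>V\<^esub> g) \<cdot>\<^bsub>V\<^esub> h))
    = (untranspose a b f \<otimes>\<^bsub>A\<^esub> untranspose c d g) \<cdot>\<^bsub>A\<^esub> FTen S (Dom V f, a) (Dom V g, c) \<cdot>\<^bsub>A\<^esub> FArr S (h, Idn A (a \<odot>\<^bsub>A\<^esub> c))"
  using untranspose_comp[of "a \<odot>\<^bsub>A\<^esub> c" "b \<odot>\<^bsub>A\<^esub> d" "ETen E a c b d \<cdot>\<^bsub>V\<^esub> (f \<otimes>\<^bsub>V\<^esub> g)" h]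
  by (simp add: untranspose_ETen)

text \<open>In untransposed form, associativity of composition is the pentagon of the action, and
  the unit laws are its two unit axioms.\<close>

lemma vcategory_assoc_vcat: "vcategory V E"
proof unfold_locales
  fix a b c d
  assume "a \<in> EObj E" "b \<in> EObj E" "c \<in> EObj E" "d \<in> EObj E"
  then have [simp]: "a \<in> Obj A" "b \<in> Obj A" "c \<in> Obj A" "d \<in> Obj A" by simp_all
  let ?x = "FObj (R c) d" and ?y = "FObj (R b) c" and ?z = "FObj (R a) b"
  let ?l = "ECmp E a b d \<cdot>\<^bsub>V\<^esub> (ECmp E b c d \<otimes>\<^bsub>V\<^esub> Idn V ?z)"
    and ?r = "ECmp E a c d \<cdot>\<^bsub>V\<^esub> (Idn V ?x \<otimes>\<^bsub>V\<^esub> ECmp E a b c) \<cdot>\<^bsub>V\<^esub> Asc V ?x ?y ?z"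
  have "untranspose a d ?l = ACounit (R c) d \<cdot>\<^bsub>A\<^esub> (FArr S (Idn V ?x, ACounit (R b) c)
      \<cdot>\<^bsub>A\<^esub> (inv_arr A (ActAsc S (?x, ?y, b)) \<cdot>\<^bsub>A\<^esub> (FArr S (Idn V ?x \<otimes>\<^bsub>V\<^esub> Idn V ?y, ACounit (R a) b)
      \<cdot>\<^bsub>A\<^esub> inv_arr A (ActAsc S (?x \<odot>\<^bsub>V\<^esub> ?y, ?z, a)))))"
    by (simp add: untranspose_ECmp)
  \<comment> \<open>Naturality of the inverse of \<open>\<alpha>\<close> moves the counit at
    \<open>a\<close>, \<open>b\<close> to the left and leaves two inverses of
    \<open>\<alpha>\<close> adjacent, ready for the pentagon.\<close>
  also have "\<dots> = ACounit (R c) d \<cdot>\<^bsub>A\<^esub> (FArr S (Idn V ?x, ACounit (R b) c)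
      \<cdot>\<^bsub>A\<^esub> (FArr S (Idn V ?x, FArr S (Idn V ?y, ACounit (R a) b))
      \<cdot>\<^bsub>A\<^esub> (inv_arr A (ActAsc S (?x, ?y, FObj S (?z, a))) \<cdot>\<^bsub>A\<^esub> inv_arr A (ActAsc S (?x \<odot>\<^bsub>V\<^esub> ?y, ?z, a)))))"
    using A.comp_cong_tail2[OF ActAsc_inv_natural[of "Idn V ?x" "Idn V ?y" "ACounit (R a) b"],
        of "inv_arr A (ActAsc S (?x \<odot>\<^bsub>V\<^esub> ?y, ?z, a))"] by simp
  also have "\<dots> = ACounit (R c) d \<cdot>\<^bsub>A\<^esub> (FArr S (Idn V ?x, ACounit (R b) c)
      \<cdot>\<^bsub>A\<^esub> (FArr S (Idn V ?x, FArr S (Idn V ?y, ACounit (R a) b))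
      \<cdot>\<^bsub>A\<^esub> (FArr S (Idn V ?x, inv_arr A (ActAsc S (?y, ?z, a))) \<cdot>\<^bsub>A\<^esub> (inv_arr A (ActAsc S (?x, ?y \<odot>\<^bsub>V\<^esub> ?z, a))
      \<cdot>\<^bsub>A\<^esub> FArr S (Asc V ?x ?y ?z, Idn A a)))))"
    by (simp add: act_pentagon_inv)
  also have "\<dots> = untranspose a d ?r"
    by (simp add: untranspose_ECmp_tail act_merge)
  finally have "?l = ?r"
    by (intro untranspose_eqI[of a d ?l "(?x \<odot>\<^bsub>V\<^esub> ?y) \<odot>\<^bsub>V\<^esub> ?z" ?r]) simp_all
  then show "ECmp E a b d \<cdot>\<^bsub>V\<^esub> (ECmp E b c d \<otimes>\<^bsub>V\<^esub> Idn V (EHom E a b))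
      = ECmp E a c d \<cdot>\<^bsub>V\<^esub> (Idn V (EHom E c d) \<otimes>\<^bsub>V\<^esub> ECmp E a b c) \<cdot>\<^bsub>V\<^esub> Asc V (EHom E c d) (EHom E b c) (EHom E a b)"
    by simp
next
  fix a b
  assume "a \<in> EObj E" "b \<in> EObj E"
  then have [simp]: "a \<in> Obj A" "b \<in> Obj A" by simp_all
  let ?h = "FObj (R a) b"
  have "untranspose a b (ECmp E a b b \<cdot>\<^bsub>V\<^esub> (EIdn E b \<otimes>\<^bsub>V\<^esub> Idn V ?h))
      = (ActUni S b \<cdot>\<^bsub>A\<^esub> FArr S (Idn V (Uni V), ACounit (R a) b)) \<cdot>\<^bsub>A\<^esub> inv_arr A (ActAsc S (Uni V, ?h, a))"
    by (simp add: untranspose_ECmp)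
  also have "\<dots> = ACounit (R a) b \<cdot>\<^bsub>A\<^esub> (ActUni S (FObj S (?h, a)) \<cdot>\<^bsub>A\<^esub> inv_arr A (ActAsc S (Uni V, ?h, a)))"
    using ActUni_natural[of "ACounit (R a) b"] by simp
  also have "\<dots> = ACounit (R a) b \<cdot>\<^bsub>A\<^esub> FArr S (LUn V ?h, Idn A a)"
    by (simp flip: act_lunit)
  also have "\<dots> = untranspose a b (LUn V ?h)"
    by (simp add: untranspose_def)
  finally show "ECmp E a b b \<cdot>\<^bsub>V\<^esub> (EIdn E b \<otimes>\<^bsub>V\<^esub> Idn V (EHom E a b)) = LUn V (EHom E a b)"
    by (intro untranspose_eqI[of a b _ "Uni V \<odot>\<^bsub>V\<^esub> ?h"]) simp_all
  have "untranspose a b (ECmp E a a b \<cdot>\<^bsub>V\<^esub> (Idn V ?h \<otimes>\<^bsub>V\<^esub> EIdn E a))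
      = ACounit (R a) b \<cdot>\<^bsub>A\<^esub> (FArr S (Idn V ?h, ActUni S a) \<cdot>\<^bsub>A\<^esub> inv_arr A (ActAsc S (?h, Uni V, a)))"
    by (simp add: untranspose_ECmp)
  also have "\<dots> = ACounit (R a) b \<cdot>\<^bsub>A\<^esub> FArr S (RUn V ?h, Idn A a)"
    by (simp flip: act_runit)
  also have "\<dots> = untranspose a b (RUn V ?h)"
    by (simp add: untranspose_def)
  finally show "ECmp E a a b \<cdot>\<^bsub>V\<^esub> (Idn V (EHom E a b) \<otimes>\<^bsub>V\<^esub> EIdn E a) = RUn V (EHom E a b)"
    by (intro untranspose_eqI[of a b _ "?h \<odot>\<^bsub>V\<^esub> Uni V"]) simp_all
qed simp_all

text \<open>Preservation of composition expresses that \<open>\<alpha>\<close> is opmonoidal,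
  preservation of identities that \<open>\<lambda>\<close> is.\<close>

lemma vfunctor_tensor:
  "vfunctor V (vcat_tensor V E E) E (\<lambda>(a, b). ETObj E a b) (\<lambda>(a, c) (b, d). ETen E a c b d)"
proof -
  interpret E: vcategory V E by (rule vcategory_assoc_vcat)
  interpret EE: vcategory V "vcat_tensor V E E"
    by (rule V.vcat_tensor_vcategory[OF vcategory_assoc_vcat vcategory_assoc_vcat])
  have comp: "ETen E a a' c c' \<cdot>\<^bsub>V\<^esub> ((ECmp E a b c \<otimes>\<^bsub>V\<^esub> ECmp E a' b' c')
        \<cdot>\<^bsub>V\<^esub> interchange V (FObj (R b) c) (FObj (R b') c') (FObj (R a) b) (FObj (R a') b'))
      = ECmp E (a \<odot>\<^bsub>A\<^esub> a') (b \<odot>\<^bsub>A\<^esub> b') (c \<odot>\<^bsub>A\<^esub> c') \<cdot>\<^bsub>V\<^esub> (ETen E b b' c c' \<otimes>\<^bsub>V\<^esub> ETen E a a' b b')"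
    (is "?l = ?r")
    if [simp]: "a \<in> Obj A" "b \<in> Obj A" "c \<in> Obj A" "a' \<in> Obj A" "b' \<in> Obj A" "c' \<in> Obj A" for a b c a' b' c'
  proof -
    let ?x = "FObj (R b) c" and ?y = "FObj (R a) b" and ?x' = "FObj (R b') c'" and ?y' = "FObj (R a') b'"
    let ?e = "ACounit (R b) c" and ?d = "ACounit (R a) b"
      and ?e' = "ACounit (R b') c'" and ?d' = "ACounit (R a') b'"
    have "untranspose (a \<odot>\<^bsub>A\<^esub> a') (c \<odot>\<^bsub>A\<^esub> c') ?l
      = ((?e \<cdot>\<^bsub>A\<^esub> FArr S (Idn V ?x, ?d)) \<otimes>\<^bsub>A\<^esub> (?e' \<cdot>\<^bsub>A\<^esub> FArr S (Idn V ?x', ?d')))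
        \<cdot>\<^bsub>A\<^esub> ((inv_arr A (ActAsc S (?x, ?y, a)) \<otimes>\<^bsub>A\<^esub> inv_arr A (ActAsc S (?x', ?y', a')))
        \<cdot>\<^bsub>A\<^esub> (FTen S (?x \<odot>\<^bsub>V\<^esub> ?y, a) (?x' \<odot>\<^bsub>V\<^esub> ?y', a') \<cdot>\<^bsub>A\<^esub> FArr S (interchange V ?x ?x' ?y ?y', Idn A (a \<odot>\<^bsub>A\<^esub> a'))))"
      by (simp add: untranspose_ETen_tail A.tensor_merge)
    also have "\<dots> = ((?e \<cdot>\<^bsub>A\<^esub> FArr S (Idn V ?x, ?d)) \<otimes>\<^bsub>A\<^esub> (?e' \<cdot>\<^bsub>A\<^esub> FArr S (Idn V ?x', ?d')))
        \<cdot>\<^bsub>A\<^esub> (FTen S (?x, FObj S (?y, a)) (?x', FObj S (?y', a'))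
        \<cdot>\<^bsub>A\<^esub> (FArr S (Idn V (?x \<odot>\<^bsub>V\<^esub> ?x'), FTen S (?y, a) (?y', a'))
        \<cdot>\<^bsub>A\<^esub> inv_arr A (ActAsc S (?x \<odot>\<^bsub>V\<^esub> ?x', ?y \<odot>\<^bsub>V\<^esub> ?y', a \<odot>\<^bsub>A\<^esub> a'))))"
      by (simp add: ActAsc_inv_opmonoidal)
    also have "\<dots> = (?e \<otimes>\<^bsub>A\<^esub> ?e') \<cdot>\<^bsub>A\<^esub> ((FArr S (Idn V ?x, ?d) \<otimes>\<^bsub>A\<^esub> FArr S (Idn V ?x', ?d'))
        \<cdot>\<^bsub>A\<^esub> (FTen S (?x, FObj S (?y, a)) (?x', FObj S (?y', a'))
        \<cdot>\<^bsub>A\<^esub> (FArr S (Idn V (?x \<odot>\<^bsub>V\<^esub> ?x'), FTen S (?y, a) (?y', a'))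
        \<cdot>\<^bsub>A\<^esub> inv_arr A (ActAsc S (?x \<odot>\<^bsub>V\<^esub> ?x', ?y \<odot>\<^bsub>V\<^esub> ?y', a \<odot>\<^bsub>A\<^esub> a')))))"
      by (simp add: A.tensor_merge)
    \<comment> \<open>Naturality of \<open>\<xi>\<close> collects the counits \<open>?d\<close> and
      \<open>?d'\<close> inside a single action, where together with \<open>FTen\<close> they form
      the untransposed \<open>ETen E a a' b b'\<close>.\<close>
    also have "\<dots> = (?e \<otimes>\<^bsub>A\<^esub> ?e') \<cdot>\<^bsub>A\<^esub> (FTen S (?x, b) (?x', b') \<cdot>\<^bsub>A\<^esub> (FArr S (Idn V (?x \<odot>\<^bsub>V\<^esub> ?x'), ?d \<otimes>\<^bsub>A\<^esub> ?d')
        \<cdot>\<^bsub>A\<^esub> (FArr S (Idn V (?x \<odot>\<^bsub>V\<^esub> ?x'), FTen S (?y, a) (?y', a'))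
        \<cdot>\<^bsub>A\<^esub> inv_arr A (ActAsc S (?x \<odot>\<^bsub>V\<^esub> ?x', ?y \<odot>\<^bsub>V\<^esub> ?y', a \<odot>\<^bsub>A\<^esub> a')))))"
      using A.comp_cong_tail2[OF FTen_natural[of "Idn V ?x" "Idn V ?x'" ?d ?d', symmetric],
          of "FArr S (Idn V (?x \<odot>\<^bsub>V\<^esub> ?x'), FTen S (?y, a) (?y', a'))
            \<cdot>\<^bsub>A\<^esub> inv_arr A (ActAsc S (?x \<odot>\<^bsub>V\<^esub> ?x', ?y \<odot>\<^bsub>V\<^esub> ?y', a \<odot>\<^bsub>A\<^esub> a'))"] by simp
    also have "\<dots> = untranspose (a \<odot>\<^bsub>A\<^esub> a') (c \<odot>\<^bsub>A\<^esub> c') ?r"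
      by (simp add: untranspose_ECmp act_merge)
    finally show ?thesis
      by (intro untranspose_eqI[of "a \<odot>\<^bsub>A\<^esub> a'" "c \<odot>\<^bsub>A\<^esub> c'" ?l "(?x \<odot>\<^bsub>V\<^esub> ?x') \<odot>\<^bsub>V\<^esub> (?y \<odot>\<^bsub>V\<^esub> ?y')" ?r]) simp_all
  qed
  have unit: "ETen E a b a b \<cdot>\<^bsub>V\<^esub> ((EIdn E a \<otimes>\<^bsub>V\<^esub> EIdn E b) \<cdot>\<^bsub>V\<^esub> inv_arr V (LUn V (Uni V))) = EIdn E (a \<odot>\<^bsub>A\<^esub> b)"
    if [simp]: "a \<in> Obj A" "b \<in> Obj A" for a b
    by (rule untranspose_eqI[of "a \<odot>\<^bsub>A\<^esub> b" "a \<odot>\<^bsub>A\<^esub> b" _ "Uni V"])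
      (simp_all add: untranspose_ETen_tail ActUni_opmonoidal)
  show ?thesis
    by unfold_locales (auto simp: vcat_tensor_def comp unit)
qed

section \<open>Names of arrows and the underlying monoidal category\<close>

lemma name_of_simps [simp]:
  assumes "f \<in> Arr A"
  shows "name f \<in> Arr V" "Dom V (name f) = Uni V" "Cod V (name f) = FObj (R (Dom A f)) (Cod A f)"
  using assms by (simp_all add: name_of_def)

lemma untranspose_name_of [simp]:
  "f \<in> Arr A \<Longrightarrow> Dom A f = a \<Longrightarrow> Cod A f = b \<Longrightarrow> untranspose a b (name f) = f \<cdot>\<^bsub>A\<^esub> ActUni S a"
  by (auto simp: name_of_def)

lemma name_of_Idn: "a \<in> Obj A \<Longrightarrow> name (Idn A a) = EIdn E a"
  by (simp add: name_of_def assoc_vcat_def Let_def)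

definition underlying_arr :: "'n \<Rightarrow> 'p \<times> 'p \<times> 'm" where
  "underlying_arr f = (Dom A f, Cod A f, name f)"

lemma underlying_arr_surj:
  assumes [simp]: "a \<in> Obj A" "b \<in> Obj A" "u \<in> Arr V" "Dom V u = Uni V" "Cod V u = FObj (R a) b"
  shows "(a, b, u) \<in> underlying_arr ` Arr A"
proof -
  \<comment> \<open>Naming composes with \<open>\<lambda>\<close> and then transposes, so its
    inverse untransposes and then cancels \<open>\<lambda>\<close>.\<close>
  let ?f = "untranspose a b u \<cdot>\<^bsub>A\<^esub> inv_arr A (ActUni S a)"
  have "name ?f = u"
    by (rule untranspose_eqI[of a b _ "Uni V"]) simp_all
  then have "(a, b, u) = underlying_arr ?f" by (simp add: underlying_arr_def)
  then show ?thesis by (rule image_eqI) simp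
qed

text \<open>Naturality of \<open>\<lambda>\<close> pulls \<open>f\<close> out of the action of the
  unit, and the constraints that remain cancel by \<open>act_lunit_inv\<close> at the unit
  object.\<close>

lemma name_of_comp:
  assumes [simp]: "f \<in> Arr A" "g \<in> Arr A" "Cod A f = Dom A g"
  shows "ECmp E (Dom A f) (Dom A g) (Cod A g) \<cdot>\<^bsub>V\<^esub> (name g \<otimes>\<^bsub>V\<^esub> name f) \<cdot>\<^bsub>V\<^esub> inv_arr V (LUn V (Uni V)) = name (g \<cdot>\<^bsub>A\<^esub> f)"
    (is "?l = _")
proof (rule untranspose_eqI)
  let ?a = "Dom A f" and ?I = "Uni V"
  let ?k = "inv_arr A (ActAsc S (?I, ?I, ?a)) \<cdot>\<^bsub>A\<^esub> FArr S (inv_arr V (LUn V ?I), Idn A ?a)"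
  have "untranspose ?a (Cod A g) ?l = g \<cdot>\<^bsub>A\<^esub> ((ActUni S (Dom A g) \<cdot>\<^bsub>A\<^esub> FArr S (Idn V ?I, f \<cdot>\<^bsub>A\<^esub> ActUni S ?a)) \<cdot>\<^bsub>A\<^esub> ?k)"
    by (simp add: untranspose_ECmp_tail)
  also have "\<dots> = g \<cdot>\<^bsub>A\<^esub> (f \<cdot>\<^bsub>A\<^esub> (ActUni S ?a \<cdot>\<^bsub>A\<^esub> (ActUni S (FObj S (?I, ?a)) \<cdot>\<^bsub>A\<^esub> ?k)))"
    using ActUni_natural[of "f \<cdot>\<^bsub>A\<^esub> ActUni S ?a"] by simp
  also have "\<dots> = g \<cdot>\<^bsub>A\<^esub> (f \<cdot>\<^bsub>A\<^esub> ActUni S ?a)"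
    by (simp add: act_lunit_inv)
  finally show "untranspose ?a (Cod A g) ?l = untranspose ?a (Cod A g) (name (g \<cdot>\<^bsub>A\<^esub> f))"
    by simp
qed simp_all

text \<open>Next to \<open>f \<otimes> g\<close> there remains one side of the tensor condition for
  \<open>\<lambda>\<close> to be opmonoidal.\<close>

lemma name_of_tensor:
  assumes [simp]: "f \<in> Arr A" "g \<in> Arr A"
  shows "ETen E (Dom A f) (Dom A g) (Cod A f) (Cod A g) \<cdot>\<^bsub>V\<^esub> (name f \<otimes>\<^bsub>V\<^esub> name g) \<cdot>\<^bsub>V\<^esub> inv_arr V (LUn V (Uni V))
    = name (f \<otimes>\<^bsub>A\<^esub> g)" (is "?l = _")
proof (rule untranspose_eqI)
  let ?a = "Dom A f" and ?b = "Dom A g"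
  have "untranspose (?a \<odot>\<^bsub>A\<^esub> ?b) (Cod A f \<odot>\<^bsub>A\<^esub> Cod A g) ?l
      = (f \<otimes>\<^bsub>A\<^esub> g) \<cdot>\<^bsub>A\<^esub> ((ActUni S ?a \<otimes>\<^bsub>A\<^esub> ActUni S ?b) \<cdot>\<^bsub>A\<^esub> (FTen S (Uni V, ?a) (Uni V, ?b)
        \<cdot>\<^bsub>A\<^esub> FArr S (inv_arr V (LUn V (Uni V)), Idn A (?a \<odot>\<^bsub>A\<^esub> ?b))))"
    by (simp add: untranspose_ETen_tail A.tensor_merge)
  then show "untranspose (?a \<odot>\<^bsub>A\<^esub> ?b) (Cod A f \<odot>\<^bsub>A\<^esub> Cod A g) ?l = untranspose (?a \<odot>\<^bsub>A\<^esub> ?b) (Cod A f \<odot>\<^bsub>A\<^esub> Cod A g) (name (f \<otimes>\<^bsub>A\<^esub> g))"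
    by (simp add: ActUni_opmonoidal)
qed simp_all

sublocale underlying: monoidal_copy A "underlying V E" underlying_arr
proof unfold_locales
  show "Arr (underlying V E) = underlying_arr ` Arr A"
    using underlying_arr_surj by (auto simp: underlying_def underlying_arr_def)
qed (simp_all add: underlying_def underlying_arr_def name_of_Idn name_of_comp name_of_tensor)

section \<open>The morphisms \<open>\<A>(f,g)\<close> in untransposed form\<close>

lemma ehom_arr_hom:
  assumes "f \<in> hom A a' a" "g \<in> hom A b b'"
  shows "ehom_arr V E (underlying_arr f) (underlying_arr g) \<in> hom V (FObj (R a) b) (FObj (R a') b')"
proof -
  have [simp]: "a \<in> Obj A" "a' \<in> Obj A" "b \<in> Obj A" "b' \<in> Obj A" using assms by auto
  show ?thesis
    using assms by (simp add: ehom_arr_def underlying_arr_def)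
qed

text \<open>Naturality of the inverse unit constraints in \<open>ehom_arr\<close> slides
  \<open>\<phi>\<close> next to the names of \<open>f\<close> and \<open>g\<close>, after which
  \<open>act_runit_inv\<close> and \<open>act_lunit_inv\<close> cancel all constraints. From here on
  \<open>\<A>(f,g)\<close> is handled through this formula and its typing.\<close>

lemma untranspose_ehom_arr:
  assumes [simp]: "f \<in> hom A a' a" "g \<in> hom A b b'" "\<phi> \<in> hom V x (FObj (R a) b)"
  shows "untranspose a' b' (ehom_arr V E (underlying_arr f) (underlying_arr g) \<cdot>\<^bsub>V\<^esub> \<phi>)
      = g \<cdot>\<^bsub>A\<^esub> untranspose a b \<phi> \<cdot>\<^bsub>A\<^esub> FArr S (Idn V x, f)"
proof -
  have [simp]: "f \<in> Arr A" "Dom A f = a'" "Cod A f = a" "g \<in> Arr A" "Dom A g = b" "Cod A g = b'"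
    "\<phi> \<in> Arr V" "Dom V \<phi> = x" "Cod V \<phi> = FObj (R a) b"
    using assms by simp_all
  have [simp]: "a \<in> Obj A" "a' \<in> Obj A" "b \<in> Obj A" "b' \<in> Obj A" "x \<in> Obj V"
    using A.dom_obj[of f] A.cod_obj[of f] A.dom_obj[of g] A.cod_obj[of g] V.dom_obj[of \<phi>]
    by (simp_all del: A.dom_obj A.cod_obj V.dom_obj)
  let ?post = "ECmp E a' b b' \<cdot>\<^bsub>V\<^esub> (name g \<otimes>\<^bsub>V\<^esub> Idn V (FObj (R a') b)) \<cdot>\<^bsub>V\<^esub> inv_arr V (LUn V (FObj (R a') b))"
  let ?pre = "ECmp E a' a b \<cdot>\<^bsub>V\<^esub> (Idn V (FObj (R a) b) \<otimes>\<^bsub>V\<^esub> name f) \<cdot>\<^bsub>V\<^esub> inv_arr V (RUn V (FObj (R a) b))"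
  let ?psi = "?pre \<cdot>\<^bsub>V\<^esub> \<phi>"
  have ehom: "ehom_arr V E (underlying_arr f) (underlying_arr g) = ?post \<cdot>\<^bsub>V\<^esub> ?pre"
    by (simp add: ehom_arr_def underlying_arr_def del: V.comp_assoc_arr)
  have "?psi = ECmp E a' a b \<cdot>\<^bsub>V\<^esub> ((Idn V (FObj (R a) b) \<otimes>\<^bsub>V\<^esub> name f) \<cdot>\<^bsub>V\<^esub> ((\<phi> \<otimes>\<^bsub>V\<^esub> Idn V (Uni V)) \<cdot>\<^bsub>V\<^esub> inv_arr V (RUn V x)))"
    using V.run_inv_natural[of \<phi> x "FObj (R a) b"] by simp
  also have "\<dots> = ECmp E a' a b \<cdot>\<^bsub>V\<^esub> ((\<phi> \<otimes>\<^bsub>V\<^esub> name f) \<cdot>\<^bsub>V\<^esub> inv_arr V (RUn V x))"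
    by (simp add: V.tensor_merge)
  finally have "untranspose a' b ?psi = untranspose a b \<phi> \<cdot>\<^bsub>A\<^esub> (FArr S (Idn V x, f \<cdot>\<^bsub>A\<^esub> ActUni S a')
      \<cdot>\<^bsub>A\<^esub> (inv_arr A (ActAsc S (x, Uni V, a')) \<cdot>\<^bsub>A\<^esub> FArr S (inv_arr V (RUn V x), Idn A a')))"
    by (simp add: untranspose_ECmp_tail)
  also have "\<dots> = untranspose a b \<phi> \<cdot>\<^bsub>A\<^esub> (FArr S (Idn V x, f) \<cdot>\<^bsub>A\<^esub> (FArr S (Idn V x, ActUni S a')
      \<cdot>\<^bsub>A\<^esub> (inv_arr A (ActAsc S (x, Uni V, a')) \<cdot>\<^bsub>A\<^esub> FArr S (inv_arr V (RUn V x), Idn A a'))))"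
    by (simp add: act_merge)
  finally have pre: "untranspose a' b ?psi = untranspose a b \<phi> \<cdot>\<^bsub>A\<^esub> FArr S (Idn V x, f)"
    by (simp add: act_runit_inv)
  have [simp]: "?psi \<in> Arr V" "Dom V ?psi = x" "Cod V ?psi = FObj (R a') b" by simp_all
  \<comment> \<open>A variable in place of \<open>?psi\<close> keeps \<open>simp\<close> from
    reassociating that composite.\<close>
  have "untranspose a' b' (?post \<cdot>\<^bsub>V\<^esub> psi) = g \<cdot>\<^bsub>A\<^esub> untranspose a' b psi"
    if [simp]: "psi \<in> Arr V" "Dom V psi = x" "Cod V psi = FObj (R a') b" for psi
  proof -
    have "?post \<cdot>\<^bsub>V\<^esub> psi = ECmp E a' b b' \<cdot>\<^bsub>V\<^esub> ((name g \<otimes>\<^bsub>V\<^esub> Idn V (FObj (R a') b))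
        \<cdot>\<^bsub>V\<^esub> ((Idn V (Uni V) \<otimes>\<^bsub>V\<^esub> psi) \<cdot>\<^bsub>V\<^esub> inv_arr V (LUn V x)))"
      using V.lun_inv_natural[of psi x "FObj (R a') b"] by simp
    also have "\<dots> = ECmp E a' b b' \<cdot>\<^bsub>V\<^esub> ((name g \<otimes>\<^bsub>V\<^esub> psi) \<cdot>\<^bsub>V\<^esub> inv_arr V (LUn V x))"
      by (simp add: V.tensor_merge)
    finally have "untranspose a' b' (?post \<cdot>\<^bsub>V\<^esub> psi)
      = g \<cdot>\<^bsub>A\<^esub> ((ActUni S b \<cdot>\<^bsub>A\<^esub> FArr S (Idn V (Uni V), untranspose a' b psi))
        \<cdot>\<^bsub>A\<^esub> (inv_arr A (ActAsc S (Uni V, x, a')) \<cdot>\<^bsub>A\<^esub> FArr S (inv_arr V (LUn V x), Idn A a')))"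
      by (simp add: untranspose_ECmp_tail)
    also have "\<dots> = g \<cdot>\<^bsub>A\<^esub> (untranspose a' b psi \<cdot>\<^bsub>A\<^esub> (ActUni S (FObj S (x, a'))
        \<cdot>\<^bsub>A\<^esub> (inv_arr A (ActAsc S (Uni V, x, a')) \<cdot>\<^bsub>A\<^esub> FArr S (inv_arr V (LUn V x), Idn A a'))))"
      using ActUni_natural[of "untranspose a' b psi"] by simp
    finally show ?thesis by (simp add: act_lunit_inv)
  qed
  from this[of ?psi] have "untranspose a' b' (?post \<cdot>\<^bsub>V\<^esub> ?psi) = g \<cdot>\<^bsub>A\<^esub> untranspose a' b ?psi"
    by simp
  then show "untranspose a' b' (ehom_arr V E (underlying_arr f) (underlying_arr g) \<cdot>\<^bsub>V\<^esub> \<phi>)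
      = g \<cdot>\<^bsub>A\<^esub> untranspose a b \<phi> \<cdot>\<^bsub>A\<^esub> FArr S (Idn V x, f)"
    unfolding pre ehom by simp
qed

lemma untranspose_ehom_arr_Idn:
  assumes "f \<in> hom A a' a" "g \<in> hom A b b'"
  shows "untranspose a' b' (ehom_arr V E (underlying_arr f) (underlying_arr g))
    = g \<cdot>\<^bsub>A\<^esub> ACounit (R a) b \<cdot>\<^bsub>A\<^esub> FArr S (Idn V (FObj (R a) b), f)"
proof -
  have [simp]: "a \<in> Obj A" "b \<in> Obj A" using assms by auto
  show ?thesis
    using untranspose_ehom_arr[OF assms, of "Idn V (FObj (R a) b)" "FObj (R a) b"] ehom_arr_hom[OF assms]
    by simp
qed

text \<open>In untransposed form this is the associativity axiom of \<open>\<xi>\<close>, once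
  naturality of the associator of \<open>A\<close> has carried it past the three counits.\<close>

lemma asc_vnatural:
  assumes [simp]: "a \<in> Obj A" "b \<in> Obj A" "c \<in> Obj A" "a' \<in> Obj A" "b' \<in> Obj A" "c' \<in> Obj A"
  shows "ehom_arr V E (underlying_arr (Idn A ((a \<odot>\<^bsub>A\<^esub> b) \<odot>\<^bsub>A\<^esub> c))) (underlying_arr (Asc A a' b' c'))
      \<cdot>\<^bsub>V\<^esub> ETen E (a \<odot>\<^bsub>A\<^esub> b) c (a' \<odot>\<^bsub>A\<^esub> b') c' \<cdot>\<^bsub>V\<^esub> (ETen E a b a' b' \<otimes>\<^bsub>V\<^esub> Idn V (FObj (R c) c'))
    = ehom_arr V E (underlying_arr (Asc A a b c)) (underlying_arr (Idn A (a' \<odot>\<^bsub>A\<^esub> (b' \<odot>\<^bsub>A\<^esub> c'))))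
      \<cdot>\<^bsub>V\<^esub> ETen E a (b \<odot>\<^bsub>A\<^esub> c) a' (b' \<odot>\<^bsub>A\<^esub> c') \<cdot>\<^bsub>V\<^esub> (Idn V (FObj (R a) a') \<otimes>\<^bsub>V\<^esub> ETen E b c b' c')
      \<cdot>\<^bsub>V\<^esub> Asc V (FObj (R a) a') (FObj (R b) b') (FObj (R c) c')"
    (is "?L \<cdot>\<^bsub>V\<^esub> ?l = ?R \<cdot>\<^bsub>V\<^esub> ?r")
proof -
  let ?x = "FObj (R a) a'" and ?y = "FObj (R b) b'" and ?z = "FObj (R c) c'"
  let ?e = "ACounit (R a) a'" and ?e' = "ACounit (R b) b'" and ?e'' = "ACounit (R c) c'"
  let ?X = "(?x \<odot>\<^bsub>V\<^esub> ?y) \<odot>\<^bsub>V\<^esub> ?z" and ?A = "(a \<odot>\<^bsub>A\<^esub> b) \<odot>\<^bsub>A\<^esub> c" and ?B = "a' \<odot>\<^bsub>A\<^esub> (b' \<odot>\<^bsub>A\<^esub> c')"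
  have [simp]: "?L \<in> Arr V" "Dom V ?L = FObj (R ?A) ((a' \<odot>\<^bsub>A\<^esub> b') \<odot>\<^bsub>A\<^esub> c')" "Cod V ?L = FObj (R ?A) ?B"
    using ehom_arr_hom[of "Idn A ?A" ?A ?A "Asc A a' b' c'" "(a' \<odot>\<^bsub>A\<^esub> b') \<odot>\<^bsub>A\<^esub> c'" ?B] by simp_all
  have [simp]: "?R \<in> Arr V" "Dom V ?R = FObj (R (a \<odot>\<^bsub>A\<^esub> (b \<odot>\<^bsub>A\<^esub> c))) ?B" "Cod V ?R = FObj (R ?A) ?B"
    using ehom_arr_hom[of "Asc A a b c" ?A "a \<odot>\<^bsub>A\<^esub> (b \<odot>\<^bsub>A\<^esub> c)" "Idn A ?B" ?B ?B] by simp_all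
  have "untranspose ?A ?B (?L \<cdot>\<^bsub>V\<^esub> ?l)
      = Asc A a' b' c' \<cdot>\<^bsub>A\<^esub> ((((?e \<otimes>\<^bsub>A\<^esub> ?e') \<cdot>\<^bsub>A\<^esub> FTen S (?x, a) (?y, b)) \<otimes>\<^bsub>A\<^esub> ?e'') \<cdot>\<^bsub>A\<^esub> FTen S (?x \<odot>\<^bsub>V\<^esub> ?y, a \<odot>\<^bsub>A\<^esub> b) (?z, c))"
    using untranspose_ehom_arr[of "Idn A ?A" ?A ?A "Asc A a' b' c'" "(a' \<odot>\<^bsub>A\<^esub> b') \<odot>\<^bsub>A\<^esub> c'" ?B ?l ?X]
    by (simp add: untranspose_ETen)
  also have "\<dots> = Asc A a' b' c' \<cdot>\<^bsub>A\<^esub> (((?e \<otimes>\<^bsub>A\<^esub> ?e') \<otimes>\<^bsub>A\<^esub> ?e'') \<cdot>\<^bsub>A\<^esub> ((FTen S (?x, a) (?y, b) \<otimes>\<^bsub>A\<^esub> Idn A (FObj S (?z, c)))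
      \<cdot>\<^bsub>A\<^esub> FTen S (?x \<odot>\<^bsub>V\<^esub> ?y, a \<odot>\<^bsub>A\<^esub> b) (?z, c)))"
    by (simp add: A.tensor_merge)
  also have "\<dots> = (?e \<otimes>\<^bsub>A\<^esub> (?e' \<otimes>\<^bsub>A\<^esub> ?e'')) \<cdot>\<^bsub>A\<^esub> (Asc A (FObj S (?x, a)) (FObj S (?y, b)) (FObj S (?z, c))
      \<cdot>\<^bsub>A\<^esub> ((FTen S (?x, a) (?y, b) \<otimes>\<^bsub>A\<^esub> Idn A (FObj S (?z, c))) \<cdot>\<^bsub>A\<^esub> FTen S (?x \<odot>\<^bsub>V\<^esub> ?y, a \<odot>\<^bsub>A\<^esub> b) (?z, c)))"
    using A.comp_cong_tail2[OF A.asc_natural[of ?e ?e' ?e''],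
        of "(FTen S (?x, a) (?y, b) \<otimes>\<^bsub>A\<^esub> Idn A (FObj S (?z, c))) \<cdot>\<^bsub>A\<^esub> FTen S (?x \<odot>\<^bsub>V\<^esub> ?y, a \<odot>\<^bsub>A\<^esub> b) (?z, c)"] by simp
  also have "\<dots> = (?e \<otimes>\<^bsub>A\<^esub> (?e' \<otimes>\<^bsub>A\<^esub> ?e'')) \<cdot>\<^bsub>A\<^esub> ((Idn A (FObj S (?x, a)) \<otimes>\<^bsub>A\<^esub> FTen S (?y, b) (?z, c))
      \<cdot>\<^bsub>A\<^esub> (FTen S (?x, a) (?y \<odot>\<^bsub>V\<^esub> ?z, b \<odot>\<^bsub>A\<^esub> c) \<cdot>\<^bsub>A\<^esub> FArr S (Asc V ?x ?y ?z, Asc A a b c)))"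
    by (simp add: FTen_asc)
  also have "\<dots> = untranspose ?A ?B (?R \<cdot>\<^bsub>V\<^esub> ?r)"
    using untranspose_ehom_arr[of "Asc A a b c" ?A "a \<odot>\<^bsub>A\<^esub> (b \<odot>\<^bsub>A\<^esub> c)" "Idn A ?B" ?B ?B ?r ?X]
    by (simp add: untranspose_ETen_tail A.tensor_merge act_merge)
  finally show ?thesis
    by (intro untranspose_eqI[of ?A ?B "?L \<cdot>\<^bsub>V\<^esub> ?l" ?X "?R \<cdot>\<^bsub>V\<^esub> ?r"]) simp_all
qed

text \<open>In untransposed form this is the left unit axiom of \<open>\<xi>\<close>: the identity
  of \<open>J\<close> becomes \<open>\<lambda>\<close> at \<open>J\<close>, which
  \<open>FUni_eq\<close> identifies with \<open>\<xi>\<^sub>0\<close>.\<close>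

lemma lun_vnatural:
  assumes [simp]: "a \<in> Obj A" "b \<in> Obj A"
  shows "ehom_arr V E (underlying_arr (Idn A (Uni A \<odot>\<^bsub>A\<^esub> a))) (underlying_arr (LUn A b))
      \<cdot>\<^bsub>V\<^esub> ETen E (Uni A) a (Uni A) b \<cdot>\<^bsub>V\<^esub> (EIdn E (Uni A) \<otimes>\<^bsub>V\<^esub> Idn V (FObj (R a) b)) \<cdot>\<^bsub>V\<^esub> inv_arr V (LUn V (FObj (R a) b))
    = ehom_arr V E (underlying_arr (LUn A a)) (underlying_arr (Idn A b))"
    (is "?L \<cdot>\<^bsub>V\<^esub> ?l = ?R")
proof -
  let ?J = "Uni A" and ?h = "FObj (R a) b" and ?e = "ACounit (R a) b"
  let ?k = "FArr S (inv_arr V (LUn V ?h), Idn A (?J \<odot>\<^bsub>A\<^esub> a))"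
  have [simp]: "?L \<in> Arr V" "Dom V ?L = FObj (R (?J \<odot>\<^bsub>A\<^esub> a)) (?J \<odot>\<^bsub>A\<^esub> b)" "Cod V ?L = FObj (R (?J \<odot>\<^bsub>A\<^esub> a)) b"
    using ehom_arr_hom[of "Idn A (?J \<odot>\<^bsub>A\<^esub> a)" "?J \<odot>\<^bsub>A\<^esub> a" "?J \<odot>\<^bsub>A\<^esub> a" "LUn A b" "?J \<odot>\<^bsub>A\<^esub> b" b] by simp_all
  have [simp]: "?R \<in> Arr V" "Dom V ?R = ?h" "Cod V ?R = FObj (R (?J \<odot>\<^bsub>A\<^esub> a)) b"
    using ehom_arr_hom[of "LUn A a" "?J \<odot>\<^bsub>A\<^esub> a" a "Idn A b" b b] by simp_all
  have "untranspose (?J \<odot>\<^bsub>A\<^esub> a) b (?L \<cdot>\<^bsub>V\<^esub> ?l) = LUn A b \<cdot>\<^bsub>A\<^esub> ((ActUni S ?J \<otimes>\<^bsub>A\<^esub> ?e) \<cdot>\<^bsub>A\<^esub> (FTen S (Uni V, ?J) (?h, a) \<cdot>\<^bsub>A\<^esub> ?k))"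
    using untranspose_ehom_arr[of "Idn A (?J \<odot>\<^bsub>A\<^esub> a)" "?J \<odot>\<^bsub>A\<^esub> a" "?J \<odot>\<^bsub>A\<^esub> a" "LUn A b" "?J \<odot>\<^bsub>A\<^esub> b" b ?l ?h]
    by (simp add: untranspose_ETen_tail)
  also have "\<dots> = LUn A b \<cdot>\<^bsub>A\<^esub> ((Idn A ?J \<otimes>\<^bsub>A\<^esub> ?e) \<cdot>\<^bsub>A\<^esub> ((ActUni S ?J \<otimes>\<^bsub>A\<^esub> Idn A (FObj S (?h, a)))
      \<cdot>\<^bsub>A\<^esub> (FTen S (Uni V, ?J) (?h, a) \<cdot>\<^bsub>A\<^esub> ?k)))"
    by (simp add: A.tensor_merge)
  also have "\<dots> = ?e \<cdot>\<^bsub>A\<^esub> (LUn A (FObj S (?h, a)) \<cdot>\<^bsub>A\<^esub> ((ActUni S ?J \<otimes>\<^bsub>A\<^esub> Idn A (FObj S (?h, a)))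
      \<cdot>\<^bsub>A\<^esub> (FTen S (Uni V, ?J) (?h, a) \<cdot>\<^bsub>A\<^esub> ?k)))"
    using A.comp_cong_tail2[OF A.lun_nat[of ?e "FObj S (?h, a)" b],
        of "(ActUni S ?J \<otimes>\<^bsub>A\<^esub> Idn A (FObj S (?h, a))) \<cdot>\<^bsub>A\<^esub> (FTen S (Uni V, ?J) (?h, a) \<cdot>\<^bsub>A\<^esub> ?k)"] by simp
  \<comment> \<open>The brackets are restored so that \<open>FTen_lunit\<close> matches; the next
    step uses \<open>simp only\<close> to keep them.\<close>
  also have "\<dots> = ?e \<cdot>\<^bsub>A\<^esub> ((LUn A (FObj S (?h, a)) \<cdot>\<^bsub>A\<^esub> (ActUni S ?J \<otimes>\<^bsub>A\<^esub> Idn A (FObj S (?h, a)))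
      \<cdot>\<^bsub>A\<^esub> FTen S (Uni V, ?J) (?h, a)) \<cdot>\<^bsub>A\<^esub> ?k)"
    by simp
  also have "\<dots> = ?e \<cdot>\<^bsub>A\<^esub> (FArr S (LUn V ?h, LUn A a) \<cdot>\<^bsub>A\<^esub> ?k)"
    by (simp only: FTen_lunit assms adjoint_simps)
  also have "\<dots> = untranspose (?J \<odot>\<^bsub>A\<^esub> a) b ?R"
    using untranspose_ehom_arr_Idn[of "LUn A a" "?J \<odot>\<^bsub>A\<^esub> a" a "Idn A b" b b]
    by (simp add: act_merge)
  finally show ?thesis
    by (intro untranspose_eqI[of "?J \<odot>\<^bsub>A\<^esub> a" b "?L \<cdot>\<^bsub>V\<^esub> ?l" ?h ?R]) simp_all
qed

text \<open>Mirror image of \<open>lun_vnatural\<close>, resting on naturality of \<open>RUn\<close>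
  and on \<open>FTen_runit\<close>.\<close>

lemma run_vnatural:
  assumes [simp]: "a \<in> Obj A" "b \<in> Obj A"
  shows "ehom_arr V E (underlying_arr (Idn A (a \<odot>\<^bsub>A\<^esub> Uni A))) (underlying_arr (RUn A b))
      \<cdot>\<^bsub>V\<^esub> ETen E a (Uni A) b (Uni A) \<cdot>\<^bsub>V\<^esub> (Idn V (FObj (R a) b) \<otimes>\<^bsub>V\<^esub> EIdn E (Uni A)) \<cdot>\<^bsub>V\<^esub> inv_arr V (RUn V (FObj (R a) b))
    = ehom_arr V E (underlying_arr (RUn A a)) (underlying_arr (Idn A b))"
    (is "?L \<cdot>\<^bsub>V\<^esub> ?l = ?R")
proof -
  let ?J = "Uni A" and ?h = "FObj (R a) b" and ?e = "ACounit (R a) b"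
  let ?k = "FArr S (inv_arr V (RUn V ?h), Idn A (a \<odot>\<^bsub>A\<^esub> ?J))"
  have [simp]: "?L \<in> Arr V" "Dom V ?L = FObj (R (a \<odot>\<^bsub>A\<^esub> ?J)) (b \<odot>\<^bsub>A\<^esub> ?J)" "Cod V ?L = FObj (R (a \<odot>\<^bsub>A\<^esub> ?J)) b"
    using ehom_arr_hom[of "Idn A (a \<odot>\<^bsub>A\<^esub> ?J)" "a \<odot>\<^bsub>A\<^esub> ?J" "a \<odot>\<^bsub>A\<^esub> ?J" "RUn A b" "b \<odot>\<^bsub>A\<^esub> ?J" b] by simp_all
  have [simp]: "?R \<in> Arr V" "Dom V ?R = ?h" "Cod V ?R = FObj (R (a \<odot>\<^bsub>A\<^esub> ?J)) b"
    using ehom_arr_hom[of "RUn A a" "a \<odot>\<^bsub>A\<^esub> ?J" a "Idn A b" b b] by simp_all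
  have "untranspose (a \<odot>\<^bsub>A\<^esub> ?J) b (?L \<cdot>\<^bsub>V\<^esub> ?l) = RUn A b \<cdot>\<^bsub>A\<^esub> ((?e \<otimes>\<^bsub>A\<^esub> ActUni S ?J) \<cdot>\<^bsub>A\<^esub> (FTen S (?h, a) (Uni V, ?J) \<cdot>\<^bsub>A\<^esub> ?k))"
    using untranspose_ehom_arr[of "Idn A (a \<odot>\<^bsub>A\<^esub> ?J)" "a \<odot>\<^bsub>A\<^esub> ?J" "a \<odot>\<^bsub>A\<^esub> ?J" "RUn A b" "b \<odot>\<^bsub>A\<^esub> ?J" b ?l ?h]
    by (simp add: untranspose_ETen_tail)
  also have "\<dots> = RUn A b \<cdot>\<^bsub>A\<^esub> ((?e \<otimes>\<^bsub>A\<^esub> Idn A ?J) \<cdot>\<^bsub>A\<^esub> ((Idn A (FObj S (?h, a)) \<otimes>\<^bsub>A\<^esub> ActUni S ?J)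
      \<cdot>\<^bsub>A\<^esub> (FTen S (?h, a) (Uni V, ?J) \<cdot>\<^bsub>A\<^esub> ?k)))"
    by (simp add: A.tensor_merge)
  also have "\<dots> = ?e \<cdot>\<^bsub>A\<^esub> (RUn A (FObj S (?h, a)) \<cdot>\<^bsub>A\<^esub> ((Idn A (FObj S (?h, a)) \<otimes>\<^bsub>A\<^esub> ActUni S ?J)
      \<cdot>\<^bsub>A\<^esub> (FTen S (?h, a) (Uni V, ?J) \<cdot>\<^bsub>A\<^esub> ?k)))"
    using A.comp_cong_tail2[OF A.run_nat[of ?e "FObj S (?h, a)" b],
        of "(Idn A (FObj S (?h, a)) \<otimes>\<^bsub>A\<^esub> ActUni S ?J) \<cdot>\<^bsub>A\<^esub> (FTen S (?h, a) (Uni V, ?J) \<cdot>\<^bsub>A\<^esub> ?k)"] by simp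
  also have "\<dots> = ?e \<cdot>\<^bsub>A\<^esub> ((RUn A (FObj S (?h, a)) \<cdot>\<^bsub>A\<^esub> (Idn A (FObj S (?h, a)) \<otimes>\<^bsub>A\<^esub> ActUni S ?J)
      \<cdot>\<^bsub>A\<^esub> FTen S (?h, a) (Uni V, ?J)) \<cdot>\<^bsub>A\<^esub> ?k)"
    by simp
  also have "\<dots> = ?e \<cdot>\<^bsub>A\<^esub> (FArr S (RUn V ?h, RUn A a) \<cdot>\<^bsub>A\<^esub> ?k)"
    by (simp only: FTen_runit assms adjoint_simps)
  also have "\<dots> = untranspose (a \<odot>\<^bsub>A\<^esub> ?J) b ?R"
    using untranspose_ehom_arr_Idn[of "RUn A a" "a \<odot>\<^bsub>A\<^esub> ?J" a "Idn A b" b b]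
    by (simp add: act_merge)
  finally show ?thesis
    by (intro untranspose_eqI[of "a \<odot>\<^bsub>A\<^esub> ?J" b "?L \<cdot>\<^bsub>V\<^esub> ?l" ?h ?R]) simp_all
qed

lemma monoidal_vcategory_assoc_vcat: "monoidal_vcategory V E"
proof (intro monoidal_vcategory.intro monoidal_vcategory_axioms.intro)
  show "braided_monoidal_category V" by (rule V.braided_monoidal_category_axioms)
  show "vcategory V E" by (rule vcategory_assoc_vcat)
  show "vfunctor V (vcat_tensor V E E) E (\<lambda>(a, b). ETObj E a b) (\<lambda>(a, c) (b, d). ETen E a c b d)"
    by (rule vfunctor_tensor)
  show "monoidal_category (underlying V E)" by (rule underlying.monoidal_category_copy)
qed (use asc_vnatural lun_vnatural run_vnatural in \<open>simp_all add: underlying.copy_simps del: V.comp_assoc_arr\<close>)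

end

section \<open>The braiding of \<open>A\<close> and its \<open>\<V>\<close>-naturality\<close>

locale closed_braided_action = closed_opmonoidal_action V A S R + A: braided_monoidal_category A
  for V :: "('o, 'm, 'w) brcat_scheme" and A :: "('p, 'n, 'v) brcat_scheme"
    and S :: "('o, 'm, 'p, 'n, 'x) action_scheme" and R :: "'p \<Rightarrow> ('p, 'n, 'o, 'm, 'u) radj_scheme"
begin

sublocale underlying_br: braided_copy A "underlying_br V E" underlying_arr
proof unfold_locales
  show "Arr (underlying_br V E) = underlying_arr ` Arr A"
    using underlying.copy_Arr by (simp add: underlying_br_def underlying_def moncat.defs)
qed (simp_all add: underlying_br_def underlying_def moncat.defs brcat.defs underlying_arr_def
    name_of_Idn name_of_comp name_of_tensor)

text \<open>General \<open>\<phi>\<close> and \<open>\<psi>\<close> let one formula serve both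
  directions: identities give the full side of \<open>\<V>\<close>-naturality, and units of the
  adjunctions make both untransposes identities. Naturality of the braiding of \<open>A\<close>
  brings it past the untransposes to meet \<open>\<xi>\<close>.\<close>

lemma untranspose_braided_left:
  assumes [simp]: "a \<in> Obj A" "b \<in> Obj A" "c \<in> Obj A" "d \<in> Obj A"
    "\<phi> \<in> Arr V" "Cod V \<phi> = FObj (R a) b" "\<psi> \<in> Arr V" "Cod V \<psi> = FObj (R c) d"
  shows "untranspose (c \<odot>\<^bsub>A\<^esub> a) (d \<odot>\<^bsub>A\<^esub> b)
      ((ehom_arr V E (underlying_arr (inv_arr A (Brd A a c))) (underlying_arr (Brd A b d)) \<cdot>\<^bsub>V\<^esub> ETen E a c b d) \<cdot>\<^bsub>V\<^esub> (\<phi> \<otimes>\<^bsub>V\<^esub> \<psi>))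
    = (untranspose c d \<psi> \<otimes>\<^bsub>A\<^esub> untranspose a b \<phi>) \<cdot>\<^bsub>A\<^esub> Brd A (FObj S (Dom V \<phi>, a)) (FObj S (Dom V \<psi>, c))
      \<cdot>\<^bsub>A\<^esub> FTen S (Dom V \<phi>, a) (Dom V \<psi>, c) \<cdot>\<^bsub>A\<^esub> FArr S (Idn V (Dom V \<phi> \<odot>\<^bsub>V\<^esub> Dom V \<psi>), inv_arr A (Brd A a c))"
    (is "untranspose _ _ ((?L \<cdot>\<^bsub>V\<^esub> ?t) \<cdot>\<^bsub>V\<^esub> _) = ?u \<cdot>\<^bsub>A\<^esub> ?b \<cdot>\<^bsub>A\<^esub> ?r")
proof -
  have [simp]: "?L \<in> Arr V" "Dom V ?L = FObj (R (a \<odot>\<^bsub>A\<^esub> c)) (b \<odot>\<^bsub>A\<^esub> d)"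
    using ehom_arr_hom[of "inv_arr A (Brd A a c)" "c \<odot>\<^bsub>A\<^esub> a" "a \<odot>\<^bsub>A\<^esub> c" "Brd A b d" "b \<odot>\<^bsub>A\<^esub> d" "d \<odot>\<^bsub>A\<^esub> b"] by simp_all
  have "untranspose (c \<odot>\<^bsub>A\<^esub> a) (d \<odot>\<^bsub>A\<^esub> b) ((?L \<cdot>\<^bsub>V\<^esub> ?t) \<cdot>\<^bsub>V\<^esub> (\<phi> \<otimes>\<^bsub>V\<^esub> \<psi>))
      = Brd A b d \<cdot>\<^bsub>A\<^esub> ((untranspose a b \<phi> \<otimes>\<^bsub>A\<^esub> untranspose c d \<psi>) \<cdot>\<^bsub>A\<^esub> ?r)"
    using untranspose_ehom_arr[of "inv_arr A (Brd A a c)" "c \<odot>\<^bsub>A\<^esub> a" "a \<odot>\<^bsub>A\<^esub> c" "Brd A b d" "b \<odot>\<^bsub>A\<^esub> d" "d \<odot>\<^bsub>A\<^esub> b"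
        "?t \<cdot>\<^bsub>V\<^esub> (\<phi> \<otimes>\<^bsub>V\<^esub> \<psi>)" "Dom V \<phi> \<odot>\<^bsub>V\<^esub> Dom V \<psi>"]
    by (simp add: untranspose_ETen)
  also have "\<dots> = ?u \<cdot>\<^bsub>A\<^esub> ?b \<cdot>\<^bsub>A\<^esub> ?r"
    using A.comp_cong_tail2[OF A.brd_natural[of "untranspose a b \<phi>" "untranspose c d \<psi>"], of ?r] by simp
  finally show ?thesis .
qed

text \<open>On this side it is the braiding of \<open>V\<close> whose naturality exchanges
  \<open>\<phi>\<close> and \<open>\<psi>\<close>.\<close>

lemma untranspose_braided_right:
  assumes [simp]: "a \<in> Obj A" "b \<in> Obj A" "c \<in> Obj A" "d \<in> Obj A"
    "\<phi> \<in> Arr V" "Cod V \<phi> = FObj (R a) b" "\<psi> \<in> Arr V" "Cod V \<psi> = FObj (R c) d"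
  shows "untranspose (c \<odot>\<^bsub>A\<^esub> a) (d \<odot>\<^bsub>A\<^esub> b) ((ETen E c a d b \<cdot>\<^bsub>V\<^esub> Brd V (FObj (R a) b) (FObj (R c) d)) \<cdot>\<^bsub>V\<^esub> (\<phi> \<otimes>\<^bsub>V\<^esub> \<psi>))
    = (untranspose c d \<psi> \<otimes>\<^bsub>A\<^esub> untranspose a b \<phi>) \<cdot>\<^bsub>A\<^esub> FTen S (Dom V \<psi>, c) (Dom V \<phi>, a)
      \<cdot>\<^bsub>A\<^esub> FArr S (Brd V (Dom V \<phi>) (Dom V \<psi>), Idn A (c \<odot>\<^bsub>A\<^esub> a))"
  using V.brd_natural[of \<phi> \<psi>] by (simp add: untranspose_ETen_tail)

text \<open>A single instance of braidedness. Both sides of the equivalence reduce to this equation,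
  quantified over all four objects.\<close>

definition braided_at :: "'o \<Rightarrow> 'o \<Rightarrow> 'p \<Rightarrow> 'p \<Rightarrow> bool" where
  "braided_at x y a c \<longleftrightarrow> Brd A (FObj S (x, a)) (FObj S (y, c)) \<cdot>\<^bsub>A\<^esub> FTen S (x, a) (y, c)
     = FTen S (y, c) (x, a) \<cdot>\<^bsub>A\<^esub> FArr S (Brd V x y, Brd A a c)"

text \<open>\<open>\<V>\<close>-naturality has the inverse braiding of \<open>A\<close> on the
  source side. Since the braiding is invertible, it can be moved across the equation to
  match.\<close>

lemma braided_at_iff:
  assumes [simp]: "x \<in> Obj V" "y \<in> Obj V" "a \<in> Obj A" "c \<in> Obj A"
  shows "braided_at x y a c \<longleftrightarrow>
    Brd A (FObj S (x, a)) (FObj S (y, c)) \<cdot>\<^bsub>A\<^esub> FTen S (x, a) (y, c) \<cdot>\<^bsub>A\<^esub> FArr S (Idn V (x \<odot>\<^bsub>V\<^esub> y), inv_arr A (Brd A a c))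
      = FTen S (y, c) (x, a) \<cdot>\<^bsub>A\<^esub> FArr S (Brd V x y, Idn A (c \<odot>\<^bsub>A\<^esub> a))"
    (is "_ \<longleftrightarrow> ?l \<cdot>\<^bsub>A\<^esub> ?t \<cdot>\<^bsub>A\<^esub> ?i = ?t' \<cdot>\<^bsub>A\<^esub> ?s")
proof
  assume "braided_at x y a c"
  then have "?l \<cdot>\<^bsub>A\<^esub> ?t = ?t' \<cdot>\<^bsub>A\<^esub> FArr S (Brd V x y, Brd A a c)" by (simp add: braided_at_def)
  then have "?l \<cdot>\<^bsub>A\<^esub> (?t \<cdot>\<^bsub>A\<^esub> ?i) = ?t' \<cdot>\<^bsub>A\<^esub> (FArr S (Brd V x y, Brd A a c) \<cdot>\<^bsub>A\<^esub> ?i)"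
    by (rule A.comp_cong_tail2) simp_all
  then show "?l \<cdot>\<^bsub>A\<^esub> ?t \<cdot>\<^bsub>A\<^esub> ?i = ?t' \<cdot>\<^bsub>A\<^esub> ?s" by (simp add: act_merge)
next
  assume eq: "?l \<cdot>\<^bsub>A\<^esub> ?t \<cdot>\<^bsub>A\<^esub> ?i = ?t' \<cdot>\<^bsub>A\<^esub> ?s"
  let ?j = "FArr S (Idn V (x \<odot>\<^bsub>V\<^esub> y), Brd A a c)"
  have "?l \<cdot>\<^bsub>A\<^esub> ?t = (?l \<cdot>\<^bsub>A\<^esub> ?t \<cdot>\<^bsub>A\<^esub> ?i) \<cdot>\<^bsub>A\<^esub> ?j" by (simp add: act_merge)
  also have "\<dots> = (?t' \<cdot>\<^bsub>A\<^esub> ?s) \<cdot>\<^bsub>A\<^esub> ?j" by (simp only: eq)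
  finally show "braided_at x y a c" by (simp add: braided_at_def act_merge)
qed

lemma vnatural_braiding_iff:
  "vnatural_braiding V E \<longleftrightarrow> (\<forall>x\<in>Obj V. \<forall>y\<in>Obj V. \<forall>a\<in>Obj A. \<forall>c\<in>Obj A. braided_at x y a c)"
proof
  assume nat: "vnatural_braiding V E"
  show "\<forall>x\<in>Obj V. \<forall>y\<in>Obj V. \<forall>a\<in>Obj A. \<forall>c\<in>Obj A. braided_at x y a c"
  proof (intro ballI)
    fix x y a c
    assume [simp]: "x \<in> Obj V" "y \<in> Obj V" "a \<in> Obj A" "c \<in> Obj A"
    \<comment> \<open>With these targets the transposes of identities are the units of the
      adjunctions at \<open>x\<close> and \<open>y\<close>. Their untransposes are identities, which
      leaves the bare equation for \<open>\<xi>\<close>.\<close>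
    let ?b = "FObj S (x, a)" and ?d = "FObj S (y, c)"
    let ?phi = "transpose V R a x (Idn A ?b)" and ?psi = "transpose V R c y (Idn A ?d)"
    have "ehom_arr V E (underlying_arr (inv_arr A (Brd A a c))) (underlying_arr (Brd A ?b ?d)) \<cdot>\<^bsub>V\<^esub> ETen E a c ?b ?d
        = ETen E c a ?d ?b \<cdot>\<^bsub>V\<^esub> Brd V (FObj (R a) ?b) (FObj (R c) ?d)"
      using nat by (simp add: vnatural_braiding_def underlying_br.copy_Brd underlying_br.inv_arr_copy)
    then show "braided_at x y a c"
      using untranspose_braided_left[of a ?b c ?d ?phi ?psi] untranspose_braided_right[of a ?b c ?d ?phi ?psi]
      by (simp add: braided_at_iff)
  qed
next
  assume br: "\<forall>x\<in>Obj V. \<forall>y\<in>Obj V. \<forall>a\<in>Obj A. \<forall>c\<in>Obj A. braided_at x y a c"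
  have "ehom_arr V E (underlying_arr (inv_arr A (Brd A a c))) (underlying_arr (Brd A b d)) \<cdot>\<^bsub>V\<^esub> ETen E a c b d
      = ETen E c a d b \<cdot>\<^bsub>V\<^esub> Brd V (FObj (R a) b) (FObj (R c) d)" (is "?L \<cdot>\<^bsub>V\<^esub> ?t = ?r")
    if [simp]: "a \<in> Obj A" "b \<in> Obj A" "c \<in> Obj A" "d \<in> Obj A" for a b c d
  proof (rule untranspose_eqI)
    let ?x = "FObj (R a) b" and ?y = "FObj (R c) d"
    have [simp]: "?L \<in> Arr V" "Dom V ?L = FObj (R (a \<odot>\<^bsub>A\<^esub> c)) (b \<odot>\<^bsub>A\<^esub> d)" "Cod V ?L = FObj (R (c \<odot>\<^bsub>A\<^esub> a)) (d \<odot>\<^bsub>A\<^esub> b)"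
      using ehom_arr_hom[of "inv_arr A (Brd A a c)" "c \<odot>\<^bsub>A\<^esub> a" "a \<odot>\<^bsub>A\<^esub> c" "Brd A b d" "b \<odot>\<^bsub>A\<^esub> d" "d \<odot>\<^bsub>A\<^esub> b"] by simp_all
    show "?L \<cdot>\<^bsub>V\<^esub> ?t \<in> hom V (?x \<odot>\<^bsub>V\<^esub> ?y) (FObj (R (c \<odot>\<^bsub>A\<^esub> a)) (d \<odot>\<^bsub>A\<^esub> b))"
      "?r \<in> hom V (?x \<odot>\<^bsub>V\<^esub> ?y) (FObj (R (c \<odot>\<^bsub>A\<^esub> a)) (d \<odot>\<^bsub>A\<^esub> b))" by simp_all
    \<comment> \<open>Braidedness at the hom-objects themselves is enough: composing it with the
      counits gives the equation.\<close>
    have "braided_at ?x ?y a c" using br by simp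
    then show "untranspose (c \<odot>\<^bsub>A\<^esub> a) (d \<odot>\<^bsub>A\<^esub> b) (?L \<cdot>\<^bsub>V\<^esub> ?t) = untranspose (c \<odot>\<^bsub>A\<^esub> a) (d \<odot>\<^bsub>A\<^esub> b) ?r"
      using untranspose_braided_left[of a b c d "Idn V ?x" "Idn V ?y"]
        untranspose_braided_right[of a b c d "Idn V ?x" "Idn V ?y"]
      by (simp add: braided_at_iff)
  qed simp_all
  then show "vnatural_braiding V E"
    by (simp add: vnatural_braiding_def underlying_br.copy_Brd underlying_br.inv_arr_copy)
qed

text \<open>\<open>prod_br V A\<close> and \<open>prod_mon V A\<close> are records of different
  types with the same underlying operations, so the structure has to be transferred axiom by
  axiom.\<close>

lemma opmonoidal_functor_prod_br: "opmonoidal_functor (prod_br V A) A S"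
proof -
  interpret P: braided_monoidal_category "prod_br V A"
    by (rule braided_monoidal_category_prod_br)
      (rule V.braided_monoidal_category_axioms A.braided_monoidal_category_axioms C.monoidal_category_axioms)+
  have hom: "hom (prod_br V A) = hom (prod_mon V A)"
    by (intro ext) (simp add: hom_def)
  show ?thesis
    by unfold_locales
      (simp_all only: prod_br_simps hom func.obj func.arr func.pres_id func.pres_comp funi_hom ften_hom
        ften_nat ften_assoc ften_lunit ften_runit)
qed

lemma braided_action_iff:
  "braided_action V A S \<longleftrightarrow> (\<forall>x\<in>Obj V. \<forall>y\<in>Obj V. \<forall>a\<in>Obj A. \<forall>c\<in>Obj A. braided_at x y a c)"
proof
  assume "braided_action V A S"
  then interpret br: braided_opmonoidal_functor "prod_br V A" A S by (simp add: braided_action_def)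
  show "\<forall>x\<in>Obj V. \<forall>y\<in>Obj V. \<forall>a\<in>Obj A. \<forall>c\<in>Obj A. braided_at x y a c"
    using br.ften_braid by (auto simp: braided_at_def)
next
  assume br: "\<forall>x\<in>Obj V. \<forall>y\<in>Obj V. \<forall>a\<in>Obj A. \<forall>c\<in>Obj A. braided_at x y a c"
  interpret P: braided_monoidal_category "prod_br V A"
    by (rule braided_monoidal_category_prod_br)
      (rule V.braided_monoidal_category_axioms A.braided_monoidal_category_axioms C.monoidal_category_axioms)+
  interpret F: opmonoidal_functor "prod_br V A" A S by (rule opmonoidal_functor_prod_br)
  have "braided_opmonoidal_functor (prod_br V A) A S"
    by unfold_locales (use br in \<open>auto simp: braided_at_def\<close>)
  then show "braided_action V A S"
    by (simp add: braided_action_def opmonoidal_action_axioms)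
qed

lemma braided_monoidal_vcategory_assoc_vcat:
  assumes "vnatural_braiding V E"
  shows "braided_monoidal_vcategory V E"
  by (intro braided_monoidal_vcategory.intro braided_monoidal_vcategory_axioms.intro
      monoidal_vcategory_assoc_vcat underlying_br.braided_monoidal_category_copy assms)

end

theorem theorem3p10:
  fixes V :: "('o, 'm) brcat" and A :: "('p, 'n) brcat"
    and S :: "('o, 'm, 'p, 'n) action"
    and R :: "'p \<Rightarrow> ('p, 'n, 'o, 'm) radj"
  assumes "braided_monoidal_category V"
    and "braided_monoidal_category A"
    and "opmonoidal_action V A S"
    and "\<And>a. a \<in> Obj A \<Longrightarrow> adjunction V A (act_on A S a) (R a)"
  shows "(braided_action V A S \<longleftrightarrow> vnatural_braiding V (assoc_vcat V A S R))
    \<and> (braided_action V A S \<longrightarrow> braided_monoidal_vcategory V (assoc_vcat V A S R))"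
proof -
  interpret closed_braided_action V A S R
    using assms by (simp add: closed_braided_action_def closed_opmonoidal_action_def
        closed_opmonoidal_action_axioms_def)
  show ?thesis
    using braided_action_iff vnatural_braiding_iff braided_monoidal_vcategory_assoc_vcat by blast
qed

end
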